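(* Let $\psi$ be a continuous, strictly positive probability density on $\mathbb{R}$ with $\psi(s)=\psi(-s)$ and $\psi(s)$, $s\ge 0$, decreasing. Let $\delta>0$, $\gamma>0$, $\vartheta_0\in(0,1)$, and let $\boldsymbol{X}$ be a process with sample paths in $\bar C^-[0,1]$ whose distribution depends on $\vartheta\in(0,1)$ and satisfies the neighborhood condition (C) with exponent $\delta$ and the expansion (D) at $\vartheta_0$ with constants $L\in\mathbb{R}$ and $\gamma$ (both conditions are spelled out in the context). Let $c_n<0$, $c_n\uparrow 0$, with $n|c_n|\to\infty$ and $$n|c_n|^{1+2\min(\delta,\gamma)}\to 0\qquad (n\to\infty).$$ For $\xi\in\mathbb{R}$ put $\vartheta_n=\vartheta_n(\xi):=\vartheta_0+\xi\,(n|c_n|)^{-1/2}$, and let $L_{n,c_n}(\vartheta_n\mid\vartheta_0)$ be the loglikelihood ratio of the point process of exceedances $N_{n,c_n}$ (see context). Then for every $\xi\in\mathbb{R}$ $$L_{n,c_n}(\vartheta_n\mid\vartheta_0)=\xi L Z_n-\frac{\xi^2L^2\vartheta_0}{2}+o_{P_{\vartheta_0}}(1)\ \to_{D_{\vartheta_0}}\ N\left(-\frac{\xi^2L^2\vartheta_0}{2},\ \xi^2L^2\vartheta_0\right),$$ with $$Z_n:=\frac{\tau(n)-n|c_n|\vartheta_0}{(n|c_n|)^{1/2}}\ \to_{D_{\vartheta_0}}\ N(0,\vartheta_0).$$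
   Context: Notation. $\Psi(x)=\int_{-\infty}^x\psi(s)\,ds$, $\psi_\beta(s)=\beta\psi(\beta s)$. The parameter $\beta>0$ is replaced by $\vartheta:=2\Psi(-\beta/2)\in(0,1)$; $P_\vartheta$ denotes probability when the parameter is $\vartheta$. $\bar C^-[0,1]=\{f\in C[0,1]:f\le 0\}$. $\bar E^-[0,1]$ is the set of bounded functions $f:[0,1]\to(-\infty,0]$ with a finite set of discontinuities, $\|f\|_\infty=\sup_t|f(t)|$. Inequalities between functions hold pointwise for all $t\in[0,1]$; a constant also denotes the constant function. Generalized Pareto process. A standard extreme value process (EVP) with parameter $\beta$ is a process $\boldsymbol{\eta}$ with paths in $C[0,1]$, $P(\eta_t\le x)=e^x$ for $x\le0$, which is max-stable ($P(\boldsymbol{\eta}\le f/n)^n=P(\boldsymbol{\eta}\le f)$, $f\in\bar E^-[0,1]$, $n\in\mathbb{N}$) and satisfies $P(\eta_{t_j}\le x_j,1\le j\le d)=\exp\left(-\int_{-\infty}^\infty\max_{j\le d}(|x_j|\psi_\beta(s-t_j))\,ds\right)$ for $x_j\le0$, $t_j\in[0,1]$, $d\in\mathbb{N}$. A standard generalized Pareto process (GPP) corresponding to $\beta$ is a process $\boldsymbol{V}$ with paths in $C[0,1]$ for which there is $x_0>0$ with $P(\boldsymbol{V}\le f)=1+\log P(\boldsymbol{\eta}\le f)=1-\int_{-\infty}^\infty\sup_{t\in[0,1]}(|f(t)|\psi(s-\beta t))\,ds$ for all $f\in\bar E^-[0,1]$ with $\|f\|_\infty\le x_0$. Condition (C)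 (under each parameter $\vartheta$, with $\boldsymbol{V}$ a GPP corresponding to the $\beta$ with $\vartheta=2\Psi(-\beta/2)$; $K$ and $r$ may depend on $\vartheta$): for some $\varepsilon_0>0$ there are $K:\bar E^-[0,1]\to\mathbb{R}$ and $r(c,f)=o(c^\delta)$ as $c\to0$ such that $P_\vartheta(\boldsymbol{X}>cf)=P_\vartheta(\boldsymbol{V}>cf)(1+c^\delta K(f)+r(c,f))$ for all $c\in(0,1)$ and $f\in\bar E^-[0,1]$ with $\|f\|_\infty\le\varepsilon_0$. Condition (D): for some $c_0<0$, for all $s\in(0,1)$, $c_0\le c<0$ and $\vartheta$ close to $\vartheta_0$, the derivatives $f_{\vartheta,c}(s):=\frac{d}{ds}P_\vartheta(\boldsymbol{X}>sc)$ satisfy $$\frac{f_{\vartheta,c}(s)}{f_{\vartheta_0,c}(s)}=1+L(\vartheta-\vartheta_0)+r_{\vartheta_0}(s,\vartheta,c),\qquad r_{\vartheta_0}(s,\vartheta,c)=o(|\vartheta-\vartheta_0|)+O(|c|^\gamma)$$ uniformly for $s\in(0,1)$, $c_0\le c<0$ and $\vartheta$ close to $\vartheta_0$; the constants $L\in\mathbb{R}$ and $\gamma>0$ may depend on $\vartheta_0$. Point process of exceedances. Let $\boldsymbol{X}^{(1)},\dots,\boldsymbol{X}^{(n)}$ be independent copies of $\boldsymbol{X}$ and $c<0$. $N_{n,c}(B)=\sum_{i=1}^n\varepsilon_{\sup_{t\in[0,1]}(X_t^{(i)}/c)}(B\cap[0,1))$ for Borel sets $B\subset\mathbb{R}$,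 where $\varepsilon_x$ is the Dirac measure at $x$. $Y_1,\dots,Y_{\tau(n)}$ denote those among $\sup_{t\in[0,1]}X_t^{(i)}/c$, $1\le i\le n$, that are $<1$, in the order of their outcome, and $\tau(n)$ is their number (with $c=c_n$ in the theorem). The loglikelihood ratio is $$L_{n,c}(\vartheta\mid\vartheta_0)=\log\left\{\frac{d\mathcal{L}_\vartheta(N_{n,c})}{d\mathcal{L}_{\vartheta_0}(N_{n,c})}(N_{n,c})\right\}=\sum_{k\le\tau(n)}\log\left(\frac{f_{\vartheta,c}(Y_k)}{f_{\vartheta_0,c}(Y_k)}\frac{P_{\vartheta_0}(\boldsymbol{X}>c)}{P_\vartheta(\boldsymbol{X}>c)}\right)+\tau(n)\log\left(\frac{P_\vartheta(\boldsymbol{X}>c)}{P_{\vartheta_0}(\boldsymbol{X}>c)}\right)+(n-\tau(n))\log\left(\frac{1-P_\vartheta(\boldsymbol{X}>c)}{1-P_{\vartheta_0}(\boldsymbol{X}>c)}\right),$$ where $\mathcal{L}_\vartheta(N_{n,c})$ is the distribution of $N_{n,c}$ under $\vartheta$. $\to_{D_{\vartheta_0}}$ denotes convergence in distribution and $o_{P_{\vartheta_0}}(1)$ convergence to $0$ in probability, both under $\vartheta_0$, as $n\to\infty$. $N(a,b)$ is the normal distribution with mean $a$ and variance $b$. *)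

theory Defs
  imports "HOL-Probability.Probability" "HOL-Library.Landau_Symbols"
begin

text \<open>
  A process is a function \<open>X :: 'a \<Rightarrow> real \<Rightarrow> real\<close> (outcome first, then time) on a measure \<open>M\<close>.
  Paths and the functions \<open>f\<close> compared with them have type \<^typ>\<open>real \<Rightarrow> real\<close>, but only their
  values on \<open>{0..1}\<close> are ever used.
\<close>

definition continuous_process :: "'a measure \<Rightarrow> ('a \<Rightarrow> real \<Rightarrow> real) \<Rightarrow> bool" where
  "continuous_process M X \<longleftrightarrow>
     prob_space M \<and>
     (\<forall>t\<in>{0..1}. (\<lambda>\<omega>. X \<omega> t) \<in> borel_measurable M) \<and>
     (\<forall>\<omega>\<in>space M. continuous_on {0..1} (X \<omega>))"

definition nonpos_continuous_process :: "'a measure \<Rightarrow> ('a \<Rightarrow> real \<Rightarrow> real) \<Rightarrow> bool" where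
  "nonpos_continuous_process M X \<longleftrightarrow>
     continuous_process M X \<and> (\<forall>\<omega>\<in>space M. \<forall>t\<in>{0..1}. X \<omega> t \<le> 0)"

definition prob_le :: "'a measure \<Rightarrow> ('a \<Rightarrow> real \<Rightarrow> real) \<Rightarrow> (real \<Rightarrow> real) \<Rightarrow> real" where
  "prob_le M X f = measure M {\<omega>\<in>space M. \<forall>t\<in>{0..1}. X \<omega> t \<le> f t}"

definition prob_gt :: "'a measure \<Rightarrow> ('a \<Rightarrow> real \<Rightarrow> real) \<Rightarrow> (real \<Rightarrow> real) \<Rightarrow> real" where
  "prob_gt M X f = measure M {\<omega>\<in>space M. \<forall>t\<in>{0..1}. X \<omega> t > f t}"

definition Ebar_neg :: "(real \<Rightarrow> real) set" where
  "Ebar_neg = {f. bounded (f ` {0..1}) \<and> (\<forall>t\<in>{0..1}. f t \<le> 0) \<and>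
                  finite {t\<in>{0..1}. \<not> continuous (at t within {0..1}) f}}"

definition sup_norm :: "(real \<Rightarrow> real) \<Rightarrow> real" where
  "sup_norm f = (SUP t\<in>{0..1}. \<bar>f t\<bar>)"

definition symmetric_unimodal_density :: "(real \<Rightarrow> real) \<Rightarrow> bool" where
  "symmetric_unimodal_density \<psi> \<longleftrightarrow>
     continuous_on UNIV \<psi> \<and> (\<forall>s. 0 < \<psi> s) \<and>
     prob_space (density lborel (\<lambda>s. ennreal (\<psi> s))) \<and>
     (\<forall>s. \<psi> s = \<psi> (- s)) \<and> antimono_on {0..} \<psi>"

definition Psi :: "(real \<Rightarrow> real) \<Rightarrow> real \<Rightarrow> real" where
  "Psi \<psi> x = (LINT s:{..x}|lborel. \<psi> s)"

definition scaled :: "(real \<Rightarrow> real) \<Rightarrow> real \<Rightarrow> real \<Rightarrow> real" where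
  "scaled \<psi> \<beta> s = \<beta> * \<psi> (\<beta> * s)"

definition standard_EVP :: "(real \<Rightarrow> real) \<Rightarrow> real \<Rightarrow> 'a measure \<Rightarrow> ('a \<Rightarrow> real \<Rightarrow> real) \<Rightarrow> bool" where
  "standard_EVP \<psi> \<beta> M \<eta> \<longleftrightarrow>
     continuous_process M \<eta> \<and>
     (\<forall>t\<in>{0..1}. \<forall>x\<le>0. measure M {\<omega>\<in>space M. \<eta> \<omega> t \<le> x} = exp x) \<and>
     (\<forall>f\<in>Ebar_neg. \<forall>n\<ge>1. prob_le M \<eta> (\<lambda>t. f t / real n) ^ n = prob_le M \<eta> f) \<and>
     (\<forall>(d::nat)\<ge>1. \<forall>t x :: nat \<Rightarrow> real.
        (\<forall>j\<in>{1..d}. t j \<in> {0..1} \<and> x j \<le> 0) \<longrightarrow>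
        measure M {\<omega>\<in>space M. \<forall>j\<in>{1..d}. \<eta> \<omega> (t j) \<le> x j} =
          exp (- (LINT s|lborel. (MAX j\<in>{1..d}. \<bar>x j\<bar> * scaled \<psi> \<beta> (s - t j)))))"

text \<open>
  A generalized Pareto process refers to the law of an extreme value process only, so
  the latter may be taken to be the coordinate process on a path space.
\<close>

definition standard_GPP :: "(real \<Rightarrow> real) \<Rightarrow> real \<Rightarrow> 'a measure \<Rightarrow> ('a \<Rightarrow> real \<Rightarrow> real) \<Rightarrow> bool" where
  "standard_GPP \<psi> \<beta> M V \<longleftrightarrow>
     continuous_process M V \<and>
     (\<exists>E :: (real \<Rightarrow> real) measure. standard_EVP \<psi> \<beta> E (\<lambda>\<eta>. \<eta>) \<and>
       (\<exists>x0>0. \<forall>f\<in>Ebar_neg. sup_norm f \<le> x0 \<longrightarrow>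
          prob_le M V f = 1 + ln (prob_le E (\<lambda>\<eta>. \<eta>) f) \<and>
          prob_le M V f = 1 - (LINT s|lborel. (SUP t\<in>{0..1}. \<bar>f t\<bar> * \<psi> (s - \<beta> * t)))))"

text \<open>
  Condition (C) for a fixed parameter: \<open>X\<close> on \<open>M\<close> is compared with \<open>V\<close> on \<open>Q\<close>.
  The remainder is \<open>o(c\<^sup>\<delta>)\<close> for each \<open>f\<close>; no uniformity in \<open>f\<close> is required.
\<close>

definition neighborhood_condition ::
  "real \<Rightarrow> 'a measure \<Rightarrow> ('a \<Rightarrow> real \<Rightarrow> real) \<Rightarrow> 'b measure \<Rightarrow> ('b \<Rightarrow> real \<Rightarrow> real) \<Rightarrow> bool" where
  "neighborhood_condition \<delta> M X Q V \<longleftrightarrow>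
     (\<exists>\<epsilon>0>0. \<exists>(K :: (real \<Rightarrow> real) \<Rightarrow> real) (r :: real \<Rightarrow> (real \<Rightarrow> real) \<Rightarrow> real).
        \<forall>f\<in>Ebar_neg. sup_norm f \<le> \<epsilon>0 \<longrightarrow>
          (\<lambda>c. r c f) \<in> o[at_right 0](\<lambda>c. c powr \<delta>) \<and>
          (\<forall>c\<in>{0<..<1}. prob_gt M X (\<lambda>t. c * f t) =
             prob_gt Q V (\<lambda>t. c * f t) * (1 + c powr \<delta> * K f + r c f)))"

definition exceedance_deriv :: "'a measure \<Rightarrow> ('a \<Rightarrow> real \<Rightarrow> real) \<Rightarrow> real \<Rightarrow> real \<Rightarrow> real" where
  "exceedance_deriv M X c s = deriv (\<lambda>u. prob_gt M X (\<lambda>_. u * c)) s"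

text \<open>
  Condition (D).  The remainder is split into \<open>r1 = o(\<bar>\<theta> - \<theta>0\<bar>)\<close> and \<open>r2 = O(\<bar>c\<bar>\<^sup>\<gamma>)\<close>, both
  uniform in \<open>s\<close>, \<open>c\<close> and \<open>\<theta>\<close> close to \<open>\<theta>0\<close>; \<open>\<theta>0\<close> itself belongs to these \<open>\<theta>\<close>.
  That the quotient is meaningful is stated explicitly, because \<open>x / 0 = 0\<close>.
\<close>

definition derivative_expansion ::
  "(real \<Rightarrow> 'a measure) \<Rightarrow> ('a \<Rightarrow> real \<Rightarrow> real) \<Rightarrow> real \<Rightarrow> real \<Rightarrow> real \<Rightarrow> bool" where
  "derivative_expansion P X \<theta>0 L \<gamma> \<longleftrightarrow>
     (\<exists>c0<0. \<exists>r1 r2 :: real \<Rightarrow> real \<Rightarrow> real \<Rightarrow> real.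
        (\<forall>\<^sub>F \<theta> in nhds \<theta>0. \<forall>s\<in>{0<..<1}. \<forall>c\<in>{c0..<0}.
           (\<lambda>u. prob_gt (P \<theta>) X (\<lambda>_. u * c)) differentiable (at s) \<and>
           exceedance_deriv (P \<theta>0) X c s \<noteq> 0 \<and>
           exceedance_deriv (P \<theta>) X c s / exceedance_deriv (P \<theta>0) X c s =
             1 + L * (\<theta> - \<theta>0) + (r1 s \<theta> c + r2 s \<theta> c)) \<and>
        (\<forall>e>0. \<forall>\<^sub>F \<theta> in nhds \<theta>0. \<forall>s\<in>{0<..<1}. \<forall>c\<in>{c0..<0}. \<bar>r1 s \<theta> c\<bar> \<le> e * \<bar>\<theta> - \<theta>0\<bar>) \<and>
        (\<exists>B. \<forall>\<^sub>F \<theta> in nhds \<theta>0. \<forall>s\<in>{0<..<1}. \<forall>c\<in>{c0..<0}. \<bar>r2 s \<theta> c\<bar> \<le> B * \<bar>c\<bar> powr \<gamma>))"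

definition independent_copies ::
  "'a measure \<Rightarrow> ('a \<Rightarrow> real \<Rightarrow> real) \<Rightarrow> (nat \<Rightarrow> 'a \<Rightarrow> real \<Rightarrow> real) \<Rightarrow> bool" where
  "independent_copies M X Xs \<longleftrightarrow>
     (\<forall>i. nonpos_continuous_process M (Xs i)) \<and>
     prob_space.indep_vars M (\<lambda>_. PiM {0..1} (\<lambda>_. borel)) (\<lambda>i \<omega>. restrict (Xs i \<omega>) {0..1}) UNIV \<and>
     (\<forall>i. distr M (PiM {0..1} (\<lambda>_. borel)) (\<lambda>\<omega>. restrict (Xs i \<omega>) {0..1}) =
          distr M (PiM {0..1} (\<lambda>_. borel)) (\<lambda>\<omega>. restrict (X \<omega>) {0..1}))"

definition sup_ratio :: "(nat \<Rightarrow> 'a \<Rightarrow> real \<Rightarrow> real) \<Rightarrow> real \<Rightarrow> nat \<Rightarrow> 'a \<Rightarrow> real" where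
  "sup_ratio Xs c i \<omega> = (SUP t\<in>{0..1}. Xs i \<omega> t / c)"

text \<open>The sample \<open>X\<^sup>(\<^sup>1\<^sup>), \<dots>, X\<^sup>(\<^sup>n\<^sup>)\<close> is indexed by \<open>{..<n}\<close>.\<close>

definition exceedance_process ::
  "(nat \<Rightarrow> 'a \<Rightarrow> real \<Rightarrow> real) \<Rightarrow> nat \<Rightarrow> real \<Rightarrow> 'a \<Rightarrow> real measure" where
  "exceedance_process Xs n c \<omega> =
     measure_of UNIV (sets borel)
       (\<lambda>B. \<Sum>i<n. emeasure (return borel (sup_ratio Xs c i \<omega>)) (B \<inter> {0..<1}))"

definition num_exceedances :: "(nat \<Rightarrow> 'a \<Rightarrow> real \<Rightarrow> real) \<Rightarrow> nat \<Rightarrow> real \<Rightarrow> 'a \<Rightarrow> nat" where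
  "num_exceedances Xs n c \<omega> = card {i\<in>{..<n}. sup_ratio Xs c i \<omega> < 1}"

text \<open>Finite measures on the real line, with the sigma algebra generated by the evaluations.\<close>

definition finite_measure_algebra :: "real measure measure" where
  "finite_measure_algebra =
     (SUP B\<in>sets borel. vimage_algebra {\<mu>. finite_measure \<mu> \<and> sets \<mu> = sets borel} (\<lambda>\<mu>. emeasure \<mu> B) borel)"

definition exceedance_law ::
  "'a measure \<Rightarrow> (nat \<Rightarrow> 'a \<Rightarrow> real \<Rightarrow> real) \<Rightarrow> nat \<Rightarrow> real \<Rightarrow> real measure measure" where
  "exceedance_law M Xs n c = distr M finite_measure_algebra (exceedance_process Xs n c)"

text \<open>
  The likelihood ratio is the Radon-Nikodym derivative of the laws of the point process, evaluated at
  the point process itself.  Its explicit form as a product of density quotients and a binomial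
  factor is a theorem about this definition and is not built in.
\<close>

definition loglik_ratio ::
  "(real \<Rightarrow> 'a measure) \<Rightarrow> (nat \<Rightarrow> 'a \<Rightarrow> real \<Rightarrow> real) \<Rightarrow> nat \<Rightarrow> real \<Rightarrow> real \<Rightarrow> real \<Rightarrow> 'a \<Rightarrow> real" where
  "loglik_ratio P Xs n c \<theta> \<theta>0 \<omega> =
     ln (enn2real (RN_deriv (exceedance_law (P \<theta>0) Xs n c) (exceedance_law (P \<theta>) Xs n c)
                     (exceedance_process Xs n c \<omega>)))"

text \<open>
  The variance \<open>0\<close> is possible, with the point mass at \<open>a\<close> as distribution;
  \<^term>\<open>normal_density a 0\<close> is the zero function.
\<close>

definition normal_law :: "real \<Rightarrow> real \<Rightarrow> real measure" where
  "normal_law a v = (if v = 0 then return borel a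
                     else density lborel (\<lambda>x. ennreal (normal_density a (sqrt v) x)))"

definition conv_in_distribution :: "'a measure \<Rightarrow> (nat \<Rightarrow> 'a \<Rightarrow> real) \<Rightarrow> real measure \<Rightarrow> bool" where
  "conv_in_distribution M Z \<nu> \<longleftrightarrow> weak_conv_m (\<lambda>n. distr M borel (Z n)) \<nu>"

definition tends_to_0_in_prob :: "'a measure \<Rightarrow> (nat \<Rightarrow> 'a \<Rightarrow> real) \<Rightarrow> bool" where
  "tends_to_0_in_prob M R \<longleftrightarrow>
     (\<forall>e>0. (\<lambda>n. measure M {\<omega>\<in>space M. \<bar>R n \<omega>\<bar> > e}) \<longlonglongrightarrow> 0)"

definition normalized_count ::
  "(nat \<Rightarrow> 'a \<Rightarrow> real \<Rightarrow> real) \<Rightarrow> (nat \<Rightarrow> real) \<Rightarrow> real \<Rightarrow> nat \<Rightarrow> 'a \<Rightarrow> real" where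
  "normalized_count Xs c \<theta>0 n \<omega> =
     (real (num_exceedances Xs n (c n) \<omega>) - real n * \<bar>c n\<bar> * \<theta>0) / sqrt (real n * \<bar>c n\<bar>)"

text \<open>
  The next lemmas confirm that the set function in the definition of the point process is a measure and that
  the point process is a random element of the space of finite measures, so that neither
  \<^const>\<open>measure_of\<close> nor \<^const>\<open>distr\<close> falls back to a default value.
\<close>

lemma sets_exceedance_process [simp]: "sets (exceedance_process Xs n c \<omega>) = sets borel"
  unfolding exceedance_process_def
  using sets.sets_measure_of_eq[of "borel :: real measure"] by simp

lemma space_exceedance_process [simp]: "space (exceedance_process Xs n c \<omega>) = UNIV"
  using sets_eq_imp_space_eq[OF sets_exceedance_process] by simp

lemma emeasure_exceedance_process:
  assumes "B \<in> sets borel"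
  shows "emeasure (exceedance_process Xs n c \<omega>) B =
           (\<Sum>i<n. indicator (B \<inter> {0..<1}) (sup_ratio Xs c i \<omega>))"
proof -
  let ?e = "\<lambda>i B. emeasure (return borel (sup_ratio Xs c i \<omega>)) (B \<inter> {0..<1})"
  have "emeasure (exceedance_process Xs n c \<omega>) B = (\<Sum>i<n. ?e i B)"
  proof (rule emeasure_measure_of[OF exceedance_process_def])
    show "sets borel \<subseteq> Pow (UNIV :: real set)" by simp
    show "positive (sets (exceedance_process Xs n c \<omega>)) (\<lambda>B. \<Sum>i<n. ?e i B)"
      by (simp add: positive_def)
    show "countably_additive (sets (exceedance_process Xs n c \<omega>)) (\<lambda>B. \<Sum>i<n. ?e i B)"
    proof (rule countably_additiveI)
      fix A :: "nat \<Rightarrow> real set"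
      assume A: "range A \<subseteq> sets (exceedance_process Xs n c \<omega>)" "disjoint_family A"
      have e: "(\<Sum>k. ?e i (A k)) = ?e i (\<Union>k. A k)" for i
      proof -
        have "range (\<lambda>k. A k \<inter> {0..<1}) \<subseteq> sets (return borel (sup_ratio Xs c i \<omega>))"
          using A(1) by auto
        moreover have "disjoint_family (\<lambda>k. A k \<inter> {0..<1})"
          using A(2) by (auto simp: disjoint_family_on_def)
        ultimately have "(\<Sum>k. ?e i (A k)) = emeasure (return borel (sup_ratio Xs c i \<omega>)) (\<Union>k. A k \<inter> {0..<1})"
          by (rule suminf_emeasure)
        also have "(\<Union>k. A k \<inter> {0..<1}) = (\<Union>k. A k) \<inter> {0..<1}" by blast
        finally show ?thesis .
      qed
      have "(\<Sum>k. \<Sum>i<n. ?e i (A k)) = (\<Sum>i<n. \<Sum>k. ?e i (A k))"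
        by (rule suminf_sum) (rule summableI)
      also have "\<dots> = (\<Sum>i<n. ?e i (\<Union>k. A k))" by (simp only: e)
      finally show "(\<Sum>k. \<Sum>i<n. ?e i (A k)) = (\<Sum>i<n. ?e i (\<Union>k. A k))" .
    qed
    show "B \<in> sets (exceedance_process Xs n c \<omega>)" using assms by simp
  qed
  also have "\<dots> = (\<Sum>i<n. indicator (B \<inter> {0..<1}) (sup_ratio Xs c i \<omega>))"
    using assms by (intro sum.cong emeasure_return) auto
  finally show ?thesis .
qed

lemma measurable_exceedance_process:
  assumes "\<And>i. i < n \<Longrightarrow> sup_ratio Xs c i \<in> borel_measurable M"
  shows "exceedance_process Xs n c \<in> measurable M finite_measure_algebra"
proof -
  have fin: "finite_measure (exceedance_process Xs n c \<omega>)" for \<omega>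
  proof (rule finite_measureI)
    have "emeasure (exceedance_process Xs n c \<omega>) UNIV < \<infinity>"
      by (subst emeasure_exceedance_process) (auto simp: ennreal_sum_less_top indicator_def less_top[symmetric])
    then show "emeasure (exceedance_process Xs n c \<omega>) (space (exceedance_process Xs n c \<omega>)) \<noteq> \<infinity>"
      by simp
  qed
  have meas: "(\<lambda>\<omega>. emeasure (exceedance_process Xs n c \<omega>) B) \<in> borel_measurable M"
    if "B \<in> sets borel" for B
  proof -
    have "(\<lambda>\<omega>. indicator (B \<inter> {0..<1}) (sup_ratio Xs c i \<omega>) :: ennreal) \<in> borel_measurable M"
      if "i < n" for i
      using assms[OF that] \<open>B \<in> sets borel\<close>
      by (intro measurable_compose[OF _ borel_measurable_indicator]) auto
    then show ?thesis
      unfolding emeasure_exceedance_process[OF that] by (intro borel_measurable_sum) auto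
  qed
  show ?thesis
    unfolding finite_measure_algebra_def
    using fin meas by (auto intro!: measurable_Sup2 measurable_vimage_algebra2)
qed

end

theory Submission
  imports Defs "HOL-Real_Asymp.Real_Asymp"
begin

text \<open>
  Write \<open>U\<close> for the supremum of \<open>X / c\<close> and \<open>W = min U 1\<close>; the point process is a function of the
  clipped sample \<open>W\<^sub>1, \<dots>, W\<^sub>n\<close>.  By condition (D) and the fundamental theorem of calculus
  the law of \<open>W\<close> under \<open>\<theta>\<close> has a density \<open>\<phi>\<close> with respect to its law under \<open>\<theta>0\<close>: the
  quotient of the derivatives on the unit interval, and the quotient of the non-exceedance probabilities at
  \<open>1\<close>.  Condition (C) excludes an atom at \<open>0\<close>.  Hence the loglikelihood ratio is the sum of the
  \<open>ln (\<phi> W\<^sub>i)\<close>, where \<open>\<phi> W\<^sub>i - 1\<close> is centred under \<open>\<theta>0\<close>, and a second order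
  expansion of the logarithm gives the stochastic expansion.  The exceedance probability is \<open>\<bar>c\<bar> \<theta>0\<close>
  up to a relative error \<open>O(\<bar>c\<bar>\<^sup>\<delta>)\<close>: by (C) it is compared with that of the generalized Pareto process,
  for which inclusion-exclusion over the times \<open>0\<close>, \<open>t\<close>, \<open>1\<close> and unimodality of \<open>\<psi>\<close> give the exact
  value.  The limit law follows from the convergence of characteristic functions.
\<close>

section \<open>Convergence in probability and in distribution\<close>

text \<open>The obstacle is the moving parameter \<open>\<theta> n\<close>. The constants in (C) may
  depend on \<theta>, so (C) gives no rate for the exceedance probability along
  \<open>\<theta> n\<close>, and (D) speaks only about derivatives on the open unit interval. The
  missing rate comes from integrating the quotient in (D) against the law under \<theta>0: with m =
  n |c_n|, the exceedance probability changes by a relative error O(1 / sqrt m) only. The total mass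
  one then fixes the likelihood ratio of a non-exceedance up to O(p / sqrt m), where p is the
  exceedance probability under \<theta>0; this is small enough although nearly all n observations
  are of this kind. The exponent min \<delta> \<gamma> in the rate condition is spent twice: sqrt m
  |c_n|^\<delta> bounds the error of centring the count at m \<theta>0 instead of n p, and sqrt m
  |c_n|^\<gamma> bounds the part of the remainder in (D) that does not shrink with \<theta> -
  \<theta>0. The slope \<xi> L is sqrt m times L (\<open>\<theta> n\<close> - \<theta>0), and the
  variance \<theta>0 is the limit of n p / m.\<close>

lemma tends_to_0_in_prob_add:
  assumes "prob_space M"
    and [measurable]: "\<And>n. R n \<in> borel_measurable M" "\<And>n. S n \<in> borel_measurable M"
    and R: "tends_to_0_in_prob M R" and S: "tends_to_0_in_prob M S"
  shows "tends_to_0_in_prob M (\<lambda>n \<omega>. R n \<omega> + S n \<omega>)"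
  unfolding tends_to_0_in_prob_def
proof (intro allI impI)
  interpret prob_space M by fact
  fix e :: real assume "e > 0"
  have lim: "(\<lambda>n. prob {\<omega>\<in>space M. \<bar>R n \<omega>\<bar> > e/2} + prob {\<omega>\<in>space M. \<bar>S n \<omega>\<bar> > e/2}) \<longlonglongrightarrow> 0 + 0"
    using R S half_gt_zero[OF \<open>e > 0\<close>] unfolding tends_to_0_in_prob_def by (intro tendsto_add) blast+
  have le: "prob {\<omega>\<in>space M. \<bar>R n \<omega> + S n \<omega>\<bar> > e}
      \<le> prob {\<omega>\<in>space M. \<bar>R n \<omega>\<bar> > e/2} + prob {\<omega>\<in>space M. \<bar>S n \<omega>\<bar> > e/2}" for n
  proof -
    have "prob {\<omega>\<in>space M. \<bar>R n \<omega> + S n \<omega>\<bar> > e}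
        \<le> prob ({\<omega>\<in>space M. \<bar>R n \<omega>\<bar> > e/2} \<union> {\<omega>\<in>space M. \<bar>S n \<omega>\<bar> > e/2})"
      by (intro finite_measure_mono) auto
    also have "\<dots> \<le> prob {\<omega>\<in>space M. \<bar>R n \<omega>\<bar> > e/2} + prob {\<omega>\<in>space M. \<bar>S n \<omega>\<bar> > e/2}"
      by (intro measure_Un_le) auto
    finally show ?thesis .
  qed
  show "(\<lambda>n. prob {\<omega>\<in>space M. \<bar>R n \<omega> + S n \<omega>\<bar> > e}) \<longlonglongrightarrow> 0"
    by (rule tendsto_sandwich[OF _ _ tendsto_const lim[simplified]]) (use le in auto)
qed

lemma tends_to_0_in_prob_const:
  assumes "(a \<longlonglongrightarrow> 0)"
  shows "tends_to_0_in_prob M (\<lambda>n \<omega>. a n)"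
  unfolding tends_to_0_in_prob_def
proof (intro allI impI)
  fix e :: real assume "e > 0"
  then have "\<forall>\<^sub>F n in sequentially. \<bar>a n\<bar> < e"
    using assms by (auto simp: tendsto_iff dist_real_def)
  then have "\<forall>\<^sub>F n in sequentially. measure M {\<omega>\<in>space M. \<bar>a n\<bar> > e} = 0"
    by eventually_elim simp
  then show "(\<lambda>n. measure M {\<omega>\<in>space M. \<bar>a n\<bar> > e}) \<longlonglongrightarrow> 0"
    by (rule tendsto_eventually)
qed

text \<open>A Radon-Nikodym derivative is fixed only up to null sets, and its explicit form will be
  available only from some \<open>n\<close> on; hence the weak form of \<open>eq\<close>.\<close>

lemma tends_to_0_in_prob_cong_AE:
  assumes "prob_space M"
    and [measurable]: "\<And>n. R n \<in> borel_measurable M" "\<And>n. S n \<in> borel_measurable M"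
    and R: "tends_to_0_in_prob M R"
    and eq: "\<forall>\<^sub>F n in sequentially. AE \<omega> in M. S n \<omega> = R n \<omega>"
  shows "tends_to_0_in_prob M S"
  unfolding tends_to_0_in_prob_def
proof (intro allI impI)
  interpret prob_space M by fact
  fix e :: real assume "e > 0"
  have "\<forall>\<^sub>F n in sequentially. prob {\<omega>\<in>space M. \<bar>R n \<omega>\<bar> > e} = prob {\<omega>\<in>space M. \<bar>S n \<omega>\<bar> > e}"
    using eq
  proof eventually_elim
    case (elim n)
    then show ?case by (intro finite_measure_eq_AE) auto
  qed
  then show "(\<lambda>n. prob {\<omega>\<in>space M. \<bar>S n \<omega>\<bar> > e}) \<longlonglongrightarrow> 0"
    using R \<open>e > 0\<close> unfolding tends_to_0_in_prob_def
    by (auto elim: Lim_transform_eventually)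
qed

text \<open>Markov's inequality. The case \<open>k = 2\<close> exploits independence and centring;
  \<open>k = 1\<close> serves sums whose absolute terms already have a vanishing total
  expectation.\<close>

lemma tends_to_0_in_prob_moment:
  fixes R :: "nat \<Rightarrow> 'a \<Rightarrow> real"
  assumes "prob_space M" and k: "k > 0"
    and [measurable]: "\<And>n. R n \<in> borel_measurable M"
    and bound: "\<forall>\<^sub>F n in sequentially.
      integrable M (\<lambda>\<omega>. \<bar>R n \<omega>\<bar> ^ k) \<and> (\<integral>\<omega>. \<bar>R n \<omega>\<bar> ^ k \<partial>M) \<le> a n"
    and a: "a \<longlonglongrightarrow> 0"
  shows "tends_to_0_in_prob M R"
  unfolding tends_to_0_in_prob_def
proof (intro allI impI)
  interpret prob_space M by fact
  fix e :: real assume "e > 0"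
  have "\<forall>\<^sub>F n in sequentially. prob {\<omega>\<in>space M. \<bar>R n \<omega>\<bar> > e} \<le> a n / e ^ k"
    using bound
  proof eventually_elim
    case (elim n)
    have "prob {\<omega>\<in>space M. \<bar>R n \<omega>\<bar> > e} \<le> prob {\<omega>\<in>space M. \<bar>R n \<omega>\<bar> ^ k \<ge> e ^ k}"
      using \<open>e > 0\<close> by (intro finite_measure_mono) (auto intro!: power_mono)
    also have "\<dots> \<le> (\<integral>\<omega>. \<bar>R n \<omega>\<bar> ^ k \<partial>M) / e ^ k"
      using elim \<open>e > 0\<close> by (intro integral_Markov_inequality_measure[where A="{}"]) auto
    also have "\<dots> \<le> a n / e ^ k"
      using elim \<open>e > 0\<close> by (intro divide_right_mono) auto
    finally show ?case .
  qed
  moreover have "(\<lambda>n. a n / e ^ k) \<longlonglongrightarrow> 0"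
    using tendsto_divide[OF a tendsto_const[of "e^k"]] \<open>e > 0\<close> by simp
  ultimately show "(\<lambda>n. prob {\<omega>\<in>space M. \<bar>R n \<omega>\<bar> > e}) \<longlonglongrightarrow> 0"
    by (rule tendsto_sandwich[OF _ _ tendsto_const, rotated]) simp_all
qed

section \<open>Characteristic functions and Slutsky's theorem\<close>

lemma norm_iexp_diff_le: "norm (iexp a - iexp b) \<le> \<bar>a - b\<bar>"
proof -
  have "iexp b * iexp (a - b) = iexp a"
    unfolding exp_add[symmetric] distrib_left[symmetric] of_real_add[symmetric] by simp
  then have "iexp a - iexp b = iexp b * (iexp (a - b) - 1)"
    by (simp only: right_diff_distrib mult_1_right)
  then have "norm (iexp a - iexp b) = norm (iexp (a - b) - 1)"
    by (simp add: norm_mult)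
  also have "\<dots> \<le> \<bar>a - b\<bar>"
    using iexp_approx1[of "a - b" 0] by simp
  finally show ?thesis .
qed

text \<open>Where \<open>Y n\<close> and \<open>Z n\<close> differ by at most \<open>e\<close>, the
  integrands differ by at most \<open>\<bar>t\<bar> * e\<close>; elsewhere they differ by at most 2,
  on a set of vanishing probability.\<close>

lemma char_diff_tends_to_0:
  assumes "prob_space M"
    and [measurable]: "\<And>n. Y n \<in> borel_measurable M" "\<And>n. Z n \<in> borel_measurable M"
    and diff: "tends_to_0_in_prob M (\<lambda>n \<omega>. Y n \<omega> - Z n \<omega>)"
  shows "(\<lambda>n. char (distr M borel (Y n)) t - char (distr M borel (Z n)) t) \<longlonglongrightarrow> 0"
proof (rule LIMSEQ_I)
  interpret prob_space M by fact
  fix r :: real assume r: "r > 0"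
  define e where "e = r / (2 * (\<bar>t\<bar> + 1))"
  have e: "e > 0" "\<bar>t\<bar> * e \<le> r / 2"
    using r by (auto simp: e_def field_simps)
  have "(\<lambda>n. 2 * prob {\<omega>\<in>space M. \<bar>Y n \<omega> - Z n \<omega>\<bar> > e}) \<longlonglongrightarrow> 2 * 0"
    using diff e by (intro tendsto_mult) (auto simp: tends_to_0_in_prob_def)
  then have "\<forall>\<^sub>F n in sequentially. 2 * prob {\<omega>\<in>space M. \<bar>Y n \<omega> - Z n \<omega>\<bar> > e} < r / 2"
    by (rule order_tendstoD(2)) (use r in auto)
  then obtain N where N: "\<And>n. n \<ge> N \<Longrightarrow> 2 * prob {\<omega>\<in>space M. \<bar>Y n \<omega> - Z n \<omega>\<bar> > e} < r / 2"
    by (auto simp: eventually_sequentially)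
  show "\<exists>N. \<forall>n\<ge>N. norm (char (distr M borel (Y n)) t - char (distr M borel (Z n)) t - 0) < r"
  proof (intro exI allI impI)
    fix n assume n: "n \<ge> N"
    define A where "A = {\<omega>\<in>space M. \<bar>Y n \<omega> - Z n \<omega>\<bar> > e}"
    have A[measurable]: "A \<in> sets M" unfolding A_def by measurable
    have int: "integrable M (\<lambda>\<omega>. iexp (t * Y n \<omega>))" "integrable M (\<lambda>\<omega>. iexp (t * Z n \<omega>))"
      by (auto intro!: integrable_iexp)
    have "char (distr M borel (Y n)) t - char (distr M borel (Z n)) t
        = (\<integral>\<omega>. iexp (t * Y n \<omega>) - iexp (t * Z n \<omega>) \<partial>M)"
      using int by (simp add: char_def integral_distr)
    also have "norm \<dots> \<le> (\<integral>\<omega>. norm (iexp (t * Y n \<omega>) - iexp (t * Z n \<omega>)) \<partial>M)"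
      by (rule integral_norm_bound)
    also have "\<dots> \<le> (\<integral>\<omega>. \<bar>t\<bar> * e + 2 * indicator A \<omega> \<partial>M)"
    proof (rule integral_mono)
      show "integrable M (\<lambda>\<omega>. \<bar>t\<bar> * e + 2 * indicator A \<omega> :: real)"
        by (auto simp: emeasure_eq_measure)
      show "norm (iexp (t * Y n \<omega>) - iexp (t * Z n \<omega>)) \<le> \<bar>t\<bar> * e + 2 * indicator A \<omega>"
        if "\<omega> \<in> space M" for \<omega>
      proof (cases "\<omega> \<in> A")
        case True
        have "norm (iexp (t * Y n \<omega>) - iexp (t * Z n \<omega>)) \<le> 2"
          using norm_triangle_ineq4[of "iexp (t * Y n \<omega>)" "iexp (t * Z n \<omega>)"] by simp
        also have "2 \<le> \<bar>t\<bar> * e + 2" using e by simp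
        finally show ?thesis using True by simp
      next
        case False
        then have "\<bar>Y n \<omega> - Z n \<omega>\<bar> \<le> e" using that by (auto simp: A_def)
        have "norm (iexp (t * Y n \<omega>) - iexp (t * Z n \<omega>)) \<le> \<bar>t * Y n \<omega> - t * Z n \<omega>\<bar>"
          by (rule norm_iexp_diff_le)
        also have "\<dots> = \<bar>t\<bar> * \<bar>Y n \<omega> - Z n \<omega>\<bar>"
          by (simp add: abs_mult flip: right_diff_distrib)
        also have "\<dots> \<le> \<bar>t\<bar> * e"
          using \<open>\<bar>Y n \<omega> - Z n \<omega>\<bar> \<le> e\<close> by (intro mult_left_mono) auto
        finally show ?thesis using False by simp
      qed
    qed (use int in auto)
    also have "\<dots> = \<bar>t\<bar> * e + 2 * prob A"
      by (subst Bochner_Integration.integral_add) (auto simp: emeasure_eq_measure prob_space)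
    also have "\<dots> < r"
      using N[OF n] e(2) unfolding A_def by linarith
    finally show "norm (char (distr M borel (Y n)) t - char (distr M borel (Z n)) t - 0) < r"
      by simp
  qed
qed

lemma iexp_affine: "iexp (t * (a + k * x)) = iexp (t * a) * iexp (t * k * x)"
proof -
  have "t * (a + k * x) = t * a + t * k * x" by (simp add: algebra_simps)
  then show ?thesis by (simp only: of_real_add distrib_left exp_add)
qed

lemma (in prob_space) char_affine:
  assumes [measurable]: "Z \<in> borel_measurable M"
  shows "char (distr M borel (\<lambda>\<omega>. a + k * Z \<omega>)) t = iexp (t * a) * char (distr M borel Z) (t * k)"
proof -
  have "char (distr M borel (\<lambda>\<omega>. a + k * Z \<omega>)) t = (CLINT \<omega>|M. iexp (t * (a + k * Z \<omega>)))"
    unfolding char_def by (rule integral_distr) measurable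
  also have "\<dots> = iexp (t * a) * (CLINT \<omega>|M. iexp (t * k * Z \<omega>))"
    by (simp only: iexp_affine integral_mult_right_zero)
  also have "(CLINT \<omega>|M. iexp (t * k * Z \<omega>)) = char (distr M borel Z) (t * k)"
    unfolding char_def by (rule integral_distr[symmetric]) measurable
  finally show ?thesis .
qed

lemma real_distribution_normal_law: "v \<ge> 0 \<Longrightarrow> real_distribution (normal_law a v)"
proof (cases "v = 0")
  case True
  then show ?thesis
    using prob_space_return[of a "borel :: real measure"]
    by (simp add: normal_law_def real_distribution_def real_distribution_axioms_def)
next
  case False
  moreover assume "v \<ge> 0"
  ultimately show ?thesis
    using prob_space_normal_density[of "sqrt v" a]
    by (simp add: normal_law_def real_distribution_def real_distribution_axioms_def)
qed

text \<open>For \<open>v > 0\<close> the law is an affine image of the standard normal law; the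
  scale degenerates at \<open>v = 0\<close>, where the point mass is treated separately.\<close>

lemma char_normal_law:
  assumes "v \<ge> 0"
  shows "char (normal_law a v) t = iexp (t * a) * exp (- (v * t\<^sup>2) / 2)"
proof (cases "v = 0")
  case True
  then show ?thesis by (simp add: normal_law_def char_def integral_return)
next
  case False
  with assms have v: "v > 0" by simp
  interpret std: real_distribution std_normal_distribution by (rule real_dist_normal_dist)
  have d: "distributed std_normal_distribution lborel (\<lambda>x. x) std_normal_density"
    by (simp add: distributed_def distr_id2)
  have "distributed std_normal_distribution lborel (\<lambda>x. a + sqrt v * x)
      (normal_density (a + sqrt v * 0) (\<bar>sqrt v\<bar> * 1))"
    by (rule std.normal_density_affine[OF d]) (use v in auto)
  then have eq: "normal_law a v = distr std_normal_distribution borel (\<lambda>x. a + sqrt v * x)"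
    using v by (simp add: distributed_def normal_law_def cong: distr_cong)
  have "distr std_normal_distribution borel (\<lambda>x. x) = std_normal_distribution"
    by (rule distr_id2) simp
  then have "char (normal_law a v) t = iexp (t * a) * char std_normal_distribution (t * sqrt v)"
    unfolding eq using std.char_affine[of "\<lambda>x. x" a "sqrt v" t] by simp
  also have "char std_normal_distribution (t * sqrt v) = exp (- (v * t\<^sup>2) / 2)"
    using v by (simp add: char_std_normal_distribution power_mult_distrib mult.commute)
  finally show ?thesis .
qed

text \<open>Levy's continuity theorem combined with Slutsky's theorem. The factor \<open>k\<close>
  may be 0, as happens for \<xi> = 0 or L = 0; the limit is then the point mass included in
  \<open>normal_law\<close>.\<close>

lemma conv_in_distribution_normalI:
  assumes "prob_space M" "v \<ge> 0"
    and [measurable]: "\<And>n. Y n \<in> borel_measurable M" "\<And>n. Z n \<in> borel_measurable M"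
    and diff: "tends_to_0_in_prob M (\<lambda>n \<omega>. Y n \<omega> - (a + k * Z n \<omega>))"
    and Z: "\<And>t. (\<lambda>n. char (distr M borel (Z n)) t) \<longlonglongrightarrow> exp (- (v * t\<^sup>2) / 2)"
  shows "conv_in_distribution M Y (normal_law a (k\<^sup>2 * v))"
  unfolding conv_in_distribution_def
proof (rule levy_continuity)
  interpret prob_space M by fact
  show "real_distribution (distr M borel (Y n))" for n
    by (rule real_distribution_distr) simp
  show "real_distribution (normal_law a (k\<^sup>2 * v))"
    using assms(2) by (intro real_distribution_normal_law) auto
  fix t
  have "(\<lambda>n. (char (distr M borel (Y n)) t - char (distr M borel (\<lambda>\<omega>. a + k * Z n \<omega>)) t)
        + iexp (t * a) * char (distr M borel (Z n)) (t * k))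
      \<longlonglongrightarrow> 0 + iexp (t * a) * exp (- (v * (t * k)\<^sup>2) / 2)"
    by (intro tendsto_add tendsto_mult tendsto_const Z char_diff_tends_to_0 diff) (simp_all add: prob_space_axioms)
  then show "(\<lambda>n. char (distr M borel (Y n)) t) \<longlonglongrightarrow> char (normal_law a (k\<^sup>2 * v)) t"
    using assms(2) by (simp add: char_affine char_normal_law power_mult_distrib mult_ac)
qed

text \<open>Cross terms vanish by independence and centring. Integrability is carried along in the
  induction, since the product of the new summand with the partial sum must be integrable
  first.\<close>

lemma (in prob_space) second_moment_indep_sum:
  fixes X :: "'i \<Rightarrow> 'a \<Rightarrow> real"
  assumes "finite I" "indep_vars (\<lambda>_. borel) X I"
    and int: "\<And>i. i \<in> I \<Longrightarrow> integrable M (\<lambda>\<omega>. (X i \<omega>)\<^sup>2)"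
    and mean: "\<And>i. i \<in> I \<Longrightarrow> expectation (X i) = 0"
  shows "integrable M (\<lambda>\<omega>. (\<Sum>i\<in>I. X i \<omega>)\<^sup>2) \<and>
         expectation (\<lambda>\<omega>. (\<Sum>i\<in>I. X i \<omega>)\<^sup>2) = (\<Sum>i\<in>I. expectation (\<lambda>\<omega>. (X i \<omega>)\<^sup>2))"
  using assms
proof (induction I rule: finite_induct)
  case empty
  then show ?case by simp
next
  case (insert i I)
  let ?S = "\<lambda>\<omega>. \<Sum>i\<in>I. X i \<omega>"
  have rv: "X j \<in> borel_measurable M" if "j \<in> insert i I" for j
    using insert.prems(1) that unfolding indep_vars_def by auto
  then have [measurable]: "X i \<in> borel_measurable M" "?S \<in> borel_measurable M" by auto
  have IH: "integrable M (\<lambda>\<omega>. (?S \<omega>)\<^sup>2)" "expectation (\<lambda>\<omega>. (?S \<omega>)\<^sup>2) = (\<Sum>i\<in>I. expectation (\<lambda>\<omega>. (X i \<omega>)\<^sup>2))"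
    using insert.IH insert.prems indep_vars_subset[OF insert.prems(1), of I] by auto
  have iS: "integrable M ?S" and iX: "integrable M (X i)"
    by (rule square_integrable_imp_integrable; use IH(1) insert.prems(2)[of i] in simp)+
  have iv: "indep_var borel (X i) borel ?S"
    using insert.hyps insert.prems(1) by (rule indep_vars_sum)
  note prod = indep_var_integrable[OF iv iX iS] indep_var_lebesgue_integral[OF iv iX iS]
  have eq: "(\<Sum>j\<in>insert i I. X j \<omega>)\<^sup>2 = (X i \<omega>)\<^sup>2 + (?S \<omega>)\<^sup>2 + 2 * (X i \<omega> * ?S \<omega>)" for \<omega>
    using insert.hyps by (simp add: power2_sum)
  show ?case
    unfolding eq using prod IH insert.hyps insert.prems(2,3)[of i] by simp
qed

section \<open>Triangular arrays\<close>

text \<open>Convergence of \<open>n * x n\<close> forces \<open>x n\<close> to 0, so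
  \<open>ln (1 + x n)\<close> equals \<open>x n\<close> up to twice its square, and \<open>n\<close>
  times that error still vanishes.\<close>

lemma power_tendsto_exp:
  fixes x :: "nat \<Rightarrow> real"
  assumes "(\<lambda>n. real n * x n) \<longlonglongrightarrow> a"
  shows "(\<lambda>n. (1 + x n) ^ n) \<longlonglongrightarrow> exp a"
proof -
  have "(\<lambda>n. real n * x n * inverse (real n)) \<longlonglongrightarrow> a * 0"
    by (intro tendsto_mult assms lim_inverse_n)
  moreover have "\<forall>\<^sub>F n in sequentially. real n * x n * inverse (real n) = x n"
    using eventually_gt_at_top[of 0] by eventually_elim simp
  ultimately have "x \<longlonglongrightarrow> a * 0"
    by (rule Lim_transform_eventually)
  then have x0: "x \<longlonglongrightarrow> 0" by simp
  then have small: "\<forall>\<^sub>F n in sequentially. \<bar>x n\<bar> < 1/2"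
    by (auto simp: tendsto_iff dist_real_def dest!: spec[of _ "1/2"])
  have "(\<lambda>n. 2 * (real n * x n * x n)) \<longlonglongrightarrow> 2 * (a * 0)"
    by (intro tendsto_mult tendsto_const assms x0)
  then have 0: "(\<lambda>n. \<bar>2 * (real n * x n * x n)\<bar>) \<longlonglongrightarrow> 0"
    by (simp add: tendsto_rabs_zero_iff)
  have "(\<lambda>n. real n * ln (1 + x n) - real n * x n) \<longlonglongrightarrow> 0"
  proof (rule Lim_null_comparison[OF _ 0])
    show "\<forall>\<^sub>F n in sequentially. norm (real n * ln (1 + x n) - real n * x n) \<le> \<bar>2 * (real n * x n * x n)\<bar>"
      using small
    proof eventually_elim
      case (elim n)
      have "norm (real n * ln (1 + x n) - real n * x n) = real n * \<bar>ln (1 + x n) - x n\<bar>"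
        by (simp add: abs_mult flip: right_diff_distrib)
      also have "\<dots> \<le> real n * (2 * (x n)\<^sup>2)"
        using elim by (intro mult_left_mono abs_ln_one_plus_x_minus_x_bound) auto
      finally show ?case by (simp add: power2_eq_square mult_ac abs_mult)
    qed
  qed
  from tendsto_add[OF this assms] have "(\<lambda>n. exp (real n * ln (1 + x n))) \<longlonglongrightarrow> exp a"
    by (intro tendsto_exp) simp
  moreover have "\<forall>\<^sub>F n in sequentially. exp (real n * ln (1 + x n)) = (1 + x n) ^ n"
    using small
  proof eventually_elim
    case (elim n)
    then have "1 + x n > 0" by linarith
    then show ?case by (simp add: exp_of_nat_mult)
  qed
  ultimately show ?thesis by (rule Lim_transform_eventually)
qed

text \<open>The remainder has derivative \<open>y\<^sup>2 / (1 + y)\<close>, which is at most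
  \<open>2 * x\<^sup>2\<close> between \<open>-\<bar>x\<bar>\<close> and
  \<open>\<bar>x\<bar>\<close> because \<open>1 + y\<close> is at least 1/2 there; the mean value
  inequality gives the cube.\<close>

lemma abs_ln_one_plus_x_minus_quadratic_bound:
  fixes x :: real
  assumes x: "\<bar>x\<bar> \<le> 1/2"
  shows "\<bar>ln (1 + x) - x + x\<^sup>2 / 2\<bar> \<le> 2 * \<bar>x\<bar> ^ 3"
proof -
  let ?f = "\<lambda>y :: real. ln (1 + y) - y + y\<^sup>2 / 2"
  have "norm (?f x - ?f 0) \<le> (2 * x\<^sup>2) * norm (x - 0)"
  proof (rule field_differentiable_bound[where S="{-\<bar>x\<bar>..\<bar>x\<bar>}" and f'="\<lambda>y. y\<^sup>2 / (1 + y)"])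
    fix y assume y: "y \<in> {-\<bar>x\<bar>..\<bar>x\<bar>}"
    then have y1: "1 + y \<ge> 1/2" "\<bar>y\<bar> \<le> \<bar>x\<bar>" using x by auto
    then show "(?f has_field_derivative y\<^sup>2 / (1 + y)) (at y within {-\<bar>x\<bar>..\<bar>x\<bar>})"
      by (auto intro!: derivative_eq_intros simp: field_simps power2_eq_square)
    have "y\<^sup>2 \<le> x\<^sup>2" using y1(2) by (simp add: abs_le_square_iff)
    then have "y\<^sup>2 / (1 + y) \<le> x\<^sup>2 / (1/2)"
      using y1 by (intro frac_le) auto
    then show "norm (y\<^sup>2 / (1 + y)) \<le> 2 * x\<^sup>2"
      using y1 by simp
  qed auto
  also have "(2 * x\<^sup>2) * norm (x - 0) = 2 * \<bar>x\<bar> ^ 3"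
    by (simp add: power3_eq_cube power2_eq_square)
  finally show ?thesis by simp
qed

lemma (in prob_space) expectation_indicator_lessThan:
  assumes "X \<in> borel_measurable M"
  shows "expectation (\<lambda>\<omega>. indicat_real {..<a} (X \<omega>)) = prob {\<omega>\<in>space M. X \<omega> < a}"
proof -
  have "expectation (\<lambda>\<omega>. indicat_real {..<a} (X \<omega>)) = expectation (indicat_real {\<omega>\<in>space M. X \<omega> < a})"
    by (intro Bochner_Integration.integral_cong) (auto simp: indicator_def)
  also have "\<dots> = prob {\<omega>\<in>space M. X \<omega> < a}"
    using assms by (subst Bochner_Integration.integral_indicator) (auto intro!: arg_cong[where f=prob])
  finally show ?thesis .
qed

lemma (in prob_space) centered_indicator_moments:
  fixes X :: "'a \<Rightarrow> real"
  assumes X[measurable]: "X \<in> borel_measurable M" and p: "prob {\<omega>\<in>space M. X \<omega> < a} = p"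
  shows "expectation (\<lambda>\<omega>. indicat_real {..<a} (X \<omega>) - p) = 0"
    and "expectation (\<lambda>\<omega>. (indicat_real {..<a} (X \<omega>) - p)\<^sup>2) = p * (1 - p)"
proof -
  let ?J = "\<lambda>\<omega>. indicat_real {..<a} (X \<omega>)"
  have EJ: "expectation ?J = p"
    using expectation_indicator_lessThan[OF X] p by simp
  have int: "integrable M ?J"
    by (rule integrable_const_bound[where B=1]) auto
  show "expectation (\<lambda>\<omega>. ?J \<omega> - p) = 0"
    using int EJ by (simp add: prob_space)
  have "(?J \<omega> - p)\<^sup>2 = (1 - 2 * p) * ?J \<omega> + p\<^sup>2" for \<omega>
    by (auto simp: indicator_def power2_eq_square algebra_simps)
  then have "expectation (\<lambda>\<omega>. (?J \<omega> - p)\<^sup>2) = (1 - 2 * p) * p + p\<^sup>2"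
    using int EJ by (simp add: prob_space)
  then show "expectation (\<lambda>\<omega>. (?J \<omega> - p)\<^sup>2) = p * (1 - p)"
    by (simp add: power2_eq_square algebra_simps)
qed

text \<open>The law of the count is binomial with a success probability that vanishes as \<open>n\<close> grows, so
  the central limit theorem for a single sequence does not apply.\<close>

lemma (in prob_space) char_centered_count_tendsto:
  fixes U :: "nat \<Rightarrow> nat \<Rightarrow> 'a \<Rightarrow> real" and p m :: "nat \<Rightarrow> real"
  assumes indep: "\<And>n. indep_vars (\<lambda>_. borel) (U n) {..<n}"
    and p: "\<And>n i. i < n \<Longrightarrow> prob {\<omega>\<in>space M. U n i \<omega> < 1} = p n"
    and p0: "p \<longlonglongrightarrow> 0" and m: "filterlim m at_top sequentially"
    and v: "(\<lambda>n. real n * p n / m n) \<longlonglongrightarrow> v"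
  shows "(\<lambda>n. char (distr M borel (\<lambda>\<omega>. \<Sum>i<n. (indicat_real {..<1} (U n i \<omega>) - p n) / sqrt (m n))) t)
           \<longlonglongrightarrow> exp (- (v * t\<^sup>2) / 2)"
proof -
  define X where "X n i \<omega> = (indicat_real {..<1} (U n i \<omega>) - p n) / sqrt (m n)" for n i \<omega>
  define s where "s n = p n * (1 - p n) / m n" for n
  have U[measurable]: "U n i \<in> borel_measurable M" if "i < n" for n i
    using indep[of n] that unfolding indep_vars_def by auto
  have indepX: "indep_vars (\<lambda>_. borel) (X n) {..<n}" for n
    unfolding X_def by (rule indep_vars_compose2[OF indep]) auto
  have w: "(\<lambda>n. 1 / sqrt (m n)) \<longlonglongrightarrow> 0"
    by (intro tendsto_divide_0[OF tendsto_const] filterlim_at_top_imp_at_infinity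
        filterlim_compose[OF sqrt_at_top] m)
  have im: "(\<lambda>n. 1 / m n) \<longlonglongrightarrow> 0"
    by (intro tendsto_divide_0[OF tendsto_const] filterlim_at_top_imp_at_infinity m)
  have ns: "(\<lambda>n. real n * s n) \<longlonglongrightarrow> v"
    using tendsto_mult[OF v tendsto_diff[OF tendsto_const[of 1] p0]] by (simp add: s_def mult.assoc)
  have s0: "s \<longlonglongrightarrow> 0"
    using tendsto_mult[OF tendsto_mult[OF p0 tendsto_diff[OF tendsto_const[of 1] p0]] im] by (simp add: s_def[abs_def])
  have m0: "\<forall>\<^sub>F n in sequentially. m n > 0"
    using m by (auto simp: filterlim_at_top_dense)
  have "(\<lambda>n. t\<^sup>2 * s n / 2) \<longlonglongrightarrow> t\<^sup>2 * 0 / 2"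
    by (intro tendsto_intros s0) simp
  then have small: "\<forall>\<^sub>F n in sequentially. t\<^sup>2 * s n / 2 < 1"
    by (rule order_tendstoD(2)) simp
  \<comment> \<open>Total cost of replacing each of the \<open>n\<close> characteristic functions by
    its second order expansion. Since \<open>real n * s n\<close> converges, \<open>B n\<close> is
    of order 1 / sqrt m.\<close>
  define B where "B n = real n * s n * (\<bar>t\<bar> ^ 3 / 6 * (1 / sqrt (m n)))" for n
  have B: "B \<longlonglongrightarrow> 0"
    using tendsto_mult[OF ns tendsto_mult[OF tendsto_const[of "\<bar>t\<bar> ^ 3 / 6"] w]] by (simp add: B_def[abs_def])
  let ?\<phi> = "\<lambda>n. char (distr M borel (\<lambda>\<omega>. \<Sum>i<n. X n i \<omega>)) t"
  have diff: "(\<lambda>n. ?\<phi> n - complex_of_real ((1 + - (t\<^sup>2 * s n / 2)) ^ n)) \<longlonglongrightarrow> 0"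
  proof (rule Lim_null_comparison[OF _ B])
    show "\<forall>\<^sub>F n in sequentially. norm (?\<phi> n - complex_of_real ((1 + - (t\<^sup>2 * s n / 2)) ^ n)) \<le> B n"
      using m0 small eventually_gt_at_top[of 0]
    proof eventually_elim
      case (elim n)
      have pn: "0 \<le> p n" "p n \<le> 1"
        using p[of 0 n] elim measure_nonneg prob_le_1 by metis+
      have sn: "s n \<ge> 0" using pn elim by (simp add: s_def)
      have c1: "norm (char (distr M borel (X n i)) t - (1 - t\<^sup>2 * s n / 2)) \<le> s n * (\<bar>t\<bar> ^ 3 / 6 * (1 / sqrt (m n)))"
        if i: "i < n" for i
      proof -
        note [measurable] = U[OF i]
        have Xm[measurable]: "X n i \<in> borel_measurable M" unfolding X_def by measurable
        have bnd: "\<bar>X n i \<omega>\<bar> \<le> 1 / sqrt (m n)" for \<omega>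
          using pn elim by (auto simp: X_def indicator_def intro!: divide_right_mono)
        have int: "integrable M (\<lambda>\<omega>. \<bar>X n i \<omega>\<bar> ^ k)" for k
          by (rule integrable_const_bound[where B="(1 / sqrt (m n)) ^ k"])
            (auto intro!: AE_I2 power_mono simp: bnd simp del: power_divide)
        have int2: "integrable M (\<lambda>\<omega>. (X n i \<omega>)\<^sup>2)" using int[of 2] by simp
        have int1: "integrable M (X n i)" by (rule integrable_abs_cancel[OF _ Xm]) (use int[of 1] in simp)
        have E0: "expectation (X n i) = 0"
          using centered_indicator_moments(1)[OF U[OF i] p[OF i]] by (simp add: X_def[abs_def])
        have E2: "expectation (\<lambda>\<omega>. (X n i \<omega>)\<^sup>2) = s n"
          using centered_indicator_moments(2)[OF U[OF i] p[OF i]] elim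
          by (simp add: X_def s_def power_divide)
        have "norm (char (distr M borel (X n i)) t - (1 - t\<^sup>2 * s n / 2)) \<le>
            (t\<^sup>2 / 6) * expectation (\<lambda>x. min (6 * (X n i x)\<^sup>2) (\<bar>t\<bar> * \<bar>X n i x\<bar> ^ 3))"
          using char_approx3'[OF Xm int1 int2 E0 _ refl, of "s n" t] E0 E2 by simp
        also have "\<dots> \<le> (t\<^sup>2 / 6) * expectation (\<lambda>x. \<bar>t\<bar> * (1 / sqrt (m n)) * (X n i x)\<^sup>2)"
        proof (intro mult_left_mono integral_mono)
          fix \<omega>
          \<comment> \<open>The summands are uniformly bounded by 1 / sqrt m, so the third moment is
            controlled by the variance; this replaces a Lindeberg condition.\<close>
          have "\<bar>X n i \<omega>\<bar> ^ 3 = \<bar>X n i \<omega>\<bar> * (X n i \<omega>)\<^sup>2"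
            by (simp add: power3_eq_cube power2_eq_square)
          also have "\<dots> \<le> (1 / sqrt (m n)) * (X n i \<omega>)\<^sup>2"
            by (intro mult_right_mono bnd) auto
          finally have "\<bar>t\<bar> * \<bar>X n i \<omega>\<bar> ^ 3 \<le> \<bar>t\<bar> * ((1 / sqrt (m n)) * (X n i \<omega>)\<^sup>2)"
            by (intro mult_left_mono) auto
          then show "min (6 * (X n i \<omega>)\<^sup>2) (\<bar>t\<bar> * \<bar>X n i \<omega>\<bar> ^ 3) \<le> \<bar>t\<bar> * (1 / sqrt (m n)) * (X n i \<omega>)\<^sup>2"
            by (simp add: mult.assoc min_le_iff_disj)
        next
          show "integrable M (\<lambda>x. min (6 * (X n i x)\<^sup>2) (\<bar>t\<bar> * \<bar>X n i x\<bar> ^ 3))"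
            by (intro integrable_min integrable_mult_right int int2)
          show "integrable M (\<lambda>x. \<bar>t\<bar> * (1 / sqrt (m n)) * (X n i x)\<^sup>2)"
            by (intro integrable_mult_right int2)
        qed auto
        also have "\<dots> = s n * (\<bar>t\<bar> ^ 3 / 6 * (1 / sqrt (m n)))"
          using E2 by (simp add: power3_eq_cube power2_eq_square)
        finally show ?thesis .
      qed
      have "?\<phi> n = (\<Prod>i<n. char (distr M borel (X n i)) t)"
        by (rule char_distr_sum[OF indepX])
      moreover have "complex_of_real ((1 + - (t\<^sup>2 * s n / 2)) ^ n) = (\<Prod>i<n. complex_of_real (1 - t\<^sup>2 * s n / 2))"
        by simp
      ultimately have "norm (?\<phi> n - complex_of_real ((1 + - (t\<^sup>2 * s n / 2)) ^ n))
          = norm ((\<Prod>i<n. char (distr M borel (X n i)) t) - (\<Prod>i<n. complex_of_real (1 - t\<^sup>2 * s n / 2)))"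
        by simp
      \<comment> \<open>Telescoping of a difference of products whose factors have modulus at most
        1; \<open>small\<close> ensures this for the real factors.\<close>
      also have "\<dots> \<le> (\<Sum>i<n. norm (char (distr M borel (X n i)) t - (1 - t\<^sup>2 * s n / 2)))"
      proof (rule norm_prod_diff)
        fix i assume "i \<in> {..<n}"
        then have [measurable]: "X n i \<in> borel_measurable M" unfolding X_def by auto
        show "norm (char (distr M borel (X n i)) t) \<le> 1"
          by (rule real_distribution.cmod_char_le_1[OF real_distribution_distr]) simp
        have "\<bar>1 - t\<^sup>2 * s n / 2\<bar> \<le> 1" using elim(2) sn by simp
        then show "norm (complex_of_real (1 - t\<^sup>2 * s n / 2)) \<le> 1" by (simp only: norm_of_real)
      qed
      also have "\<dots> \<le> (\<Sum>i<n. s n * (\<bar>t\<bar> ^ 3 / 6 * (1 / sqrt (m n))))"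
        using c1 by (intro sum_mono) auto
      finally show ?case by (simp add: B_def mult.assoc)
    qed
  qed
  have "(\<lambda>n. - (t\<^sup>2 / 2) * (real n * s n)) \<longlonglongrightarrow> - (t\<^sup>2 / 2) * v"
    by (intro tendsto_intros ns)
  then have "(\<lambda>n. real n * - (t\<^sup>2 * s n / 2)) \<longlonglongrightarrow> - (v * t\<^sup>2) / 2"
    by (simp add: mult_ac)
  then have "(\<lambda>n. complex_of_real ((1 + - (t\<^sup>2 * s n / 2)) ^ n)) \<longlonglongrightarrow> exp (- (v * t\<^sup>2) / 2)"
    by (intro tendsto_of_real power_tendsto_exp)
  from tendsto_add[OF diff this] show ?thesis
    by (simp add: X_def)
qed

text \<open>\<open>J\<close> marks an exceedance. If \<open>J = 1\<close>, then \<open>x\<close> is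
  close to \<open>k * w\<close> and its square to \<open>k\<^sup>2 * w\<^sup>2\<close>; if
  \<open>J = 0\<close>, then \<open>x\<close> is of order \<open>p * w\<close> and its square is
  negligible. The bound has the shape of a small factor times \<open>w\<^sup>2 * (J + p)\<close>
  because the expectation of the latter, summed over \<open>n\<close> observations, is
  \<open>2 * w\<^sup>2 * n * p\<close> and stays bounded.\<close>

lemma abs_ln_one_plus_expansion:
  fixes x k w e C p J :: real
  assumes x: "\<bar>x\<bar> \<le> 1/2" and nonneg: "w \<ge> 0" "e \<ge> 0" "p \<ge> 0"
    and J: "J = 1 \<and> \<bar>x - k * w\<bar> \<le> e * w \<or> J = 0 \<and> \<bar>x\<bar> \<le> C * p * w"
  shows "\<bar>ln (1 + x) - x + k\<^sup>2 * w\<^sup>2 * J / 2\<bar>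
    \<le> (e * (2 * \<bar>k\<bar> + e) + 2 * (\<bar>k\<bar> + e) ^ 3 * w + 2 * C\<^sup>2 * p) * w\<^sup>2 * (J + p)"
  using J
proof (elim disjE conjE)
  assume J1: "J = 1" and xk: "\<bar>x - k * w\<bar> \<le> e * w"
  have xw: "\<bar>x\<bar> \<le> (\<bar>k\<bar> + e) * w"
    using xk nonneg abs_triangle_ineq2[of x "k * w"] by (simp add: abs_mult algebra_simps)
  have "\<bar>x\<^sup>2 - (k * w)\<^sup>2\<bar> = \<bar>x - k * w\<bar> * \<bar>x + k * w\<bar>"
    by (simp add: power2_eq_square algebra_simps flip: abs_mult)
  also have "\<dots> \<le> (e * w) * ((\<bar>k\<bar> + e) * w + \<bar>k\<bar> * w)"
  proof (rule mult_mono)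
    show "\<bar>x + k * w\<bar> \<le> (\<bar>k\<bar> + e) * w + \<bar>k\<bar> * w"
      using abs_triangle_ineq[of x "k * w"] xw nonneg by (simp add: abs_mult)
  qed (use xk nonneg in auto)
  finally have sq: "\<bar>x\<^sup>2 - (k * w)\<^sup>2\<bar> \<le> e * (2 * \<bar>k\<bar> + e) * w\<^sup>2"
    by (simp add: power2_eq_square algebra_simps)
  have "2 * \<bar>x\<bar> ^ 3 \<le> 2 * ((\<bar>k\<bar> + e) * w) ^ 3"
    using xw by (intro mult_left_mono power_mono) auto
  also have "\<dots> = 2 * (\<bar>k\<bar> + e) ^ 3 * w * w\<^sup>2"
    by (simp add: power3_eq_cube power2_eq_square)
  finally have cube: "\<bar>ln (1 + x) - x + x\<^sup>2 / 2\<bar> \<le> 2 * (\<bar>k\<bar> + e) ^ 3 * w * w\<^sup>2"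
    using abs_ln_one_plus_x_minus_quadratic_bound[OF x] by linarith
  let ?\<eta> = "e * (2 * \<bar>k\<bar> + e) + 2 * (\<bar>k\<bar> + e) ^ 3 * w + 2 * C\<^sup>2 * p"
  have \<eta>: "?\<eta> \<ge> 0" using nonneg by (intro add_nonneg_nonneg) auto
  have "\<bar>ln (1 + x) - x + k\<^sup>2 * w\<^sup>2 * J / 2\<bar> \<le> \<bar>ln (1 + x) - x + x\<^sup>2 / 2\<bar> + \<bar>x\<^sup>2 - (k * w)\<^sup>2\<bar>"
    unfolding J1 power_mult_distrib by linarith
  also have "\<dots> \<le> 2 * (\<bar>k\<bar> + e) ^ 3 * w * w\<^sup>2 + e * (2 * \<bar>k\<bar> + e) * w\<^sup>2"
    using cube sq by linarith
  also have "\<dots> \<le> ?\<eta> * w\<^sup>2"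
    using nonneg by (simp add: distrib_right)
  also have "\<dots> \<le> ?\<eta> * w\<^sup>2 * (J + p)"
    using \<eta> nonneg unfolding J1 by (simp add: mult_left_le distrib_left)
  finally show ?thesis .
next
  assume J0: "J = 0" and xC: "\<bar>x\<bar> \<le> C * p * w"
  have "\<bar>ln (1 + x) - x\<bar> \<le> 2 * \<bar>x\<bar>\<^sup>2"
    using abs_ln_one_plus_x_minus_x_bound[OF x] by simp
  also have "\<dots> \<le> 2 * (C * p * w)\<^sup>2"
    using xC by (intro mult_left_mono power_mono) auto
  also have "\<dots> = (2 * C\<^sup>2 * p) * w\<^sup>2 * p"
    by (simp add: power2_eq_square)
  also have "\<dots> \<le> (e * (2 * \<bar>k\<bar> + e) + 2 * (\<bar>k\<bar> + e) ^ 3 * w + 2 * C\<^sup>2 * p) * w\<^sup>2 * p"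
    using nonneg by (intro mult_right_mono) auto
  finally show ?thesis by (simp add: J0)
qed

text \<open>The comparison is with \<open>k * w * (J - p)\<close> rather than
  \<open>k * w * J\<close>, so that the difference is centred whenever \<open>x\<close> is. The
  expectation of the right-hand side is \<open>w\<^sup>2 * p\<close> times a factor that vanishes
  with \<open>e\<close> and \<open>p\<close>.\<close>

lemma linear_part_square_bound:
  fixes x k w e C p J :: real
  assumes nonneg: "w \<ge> 0" "e \<ge> 0" "p \<ge> 0"
    and J: "J = 1 \<and> \<bar>x - k * w\<bar> \<le> e * w \<or> J = 0 \<and> \<bar>x\<bar> \<le> C * p * w"
  shows "(x - k * w * (J - p))\<^sup>2 \<le> w\<^sup>2 * ((e + \<bar>k\<bar> * p)\<^sup>2 * J + (C + \<bar>k\<bar>)\<^sup>2 * p\<^sup>2)"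
  using J
proof (elim disjE conjE)
  assume J1: "J = 1" and xk: "\<bar>x - k * w\<bar> \<le> e * w"
  have "\<bar>x - k * w * (J - p)\<bar> \<le> \<bar>x - k * w\<bar> + \<bar>k * w * p\<bar>"
    unfolding J1 by (simp add: algebra_simps)
  also have "\<dots> \<le> w * (e + \<bar>k\<bar> * p)"
    using xk nonneg by (simp add: abs_mult algebra_simps)
  finally have "\<bar>x - k * w * (J - p)\<bar>\<^sup>2 \<le> (w * (e + \<bar>k\<bar> * p))\<^sup>2"
    by (intro power_mono) auto
  also have "\<dots> = w\<^sup>2 * ((e + \<bar>k\<bar> * p)\<^sup>2 * J)"
    by (simp add: J1 power_mult_distrib)
  also have "\<dots> \<le> w\<^sup>2 * ((e + \<bar>k\<bar> * p)\<^sup>2 * J + (C + \<bar>k\<bar>)\<^sup>2 * p\<^sup>2)"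
    by (intro mult_left_mono) auto
  finally show ?thesis by simp
next
  assume J0: "J = 0" and xC: "\<bar>x\<bar> \<le> C * p * w"
  have "\<bar>x - k * w * (J - p)\<bar> \<le> \<bar>x\<bar> + \<bar>k * w * p\<bar>"
    unfolding J0 by simp
  also have "\<dots> \<le> w * ((C + \<bar>k\<bar>) * p)"
    using xC nonneg by (simp add: abs_mult algebra_simps)
  finally have "\<bar>x - k * w * (J - p)\<bar>\<^sup>2 \<le> (w * ((C + \<bar>k\<bar>) * p))\<^sup>2"
    by (intro power_mono) auto
  then show ?thesis by (simp add: J0 power_mult_distrib)
qed

text \<open>
  \<open>\<phi> n\<close> is the likelihood ratio of one clipped observation.  Below the threshold it is
  \<open>1 + k / sqrt m\<close> up to \<open>o(1 / sqrt m)\<close>.  That error is too large to be summed over the \<open>O(m)\<close>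
  exceedances; since the summands \<open>\<phi> n (U n i) - 1\<close> are centred, only its variance enters.
\<close>

lemma (in prob_space) local_asymptotic_normality:
  fixes U :: "nat \<Rightarrow> nat \<Rightarrow> 'a \<Rightarrow> real" and \<phi> :: "nat \<Rightarrow> real \<Rightarrow> real" and p m e :: "nat \<Rightarrow> real"
  assumes indep: "\<And>n. indep_vars (\<lambda>_. borel) (U n) {..<n}"
    and \<phi>[measurable]: "\<And>n. \<phi> n \<in> borel_measurable borel"
    and p: "\<And>n i. i < n \<Longrightarrow> prob {\<omega>\<in>space M. U n i \<omega> < 1} = p n"
    and mean: "\<forall>\<^sub>F n in sequentially. \<forall>i<n. expectation (\<lambda>\<omega>. \<phi> n (U n i \<omega>)) = 1"
    and below: "\<forall>\<^sub>F n in sequentially. \<forall>u<1. \<bar>\<phi> n u - 1 - k / sqrt (m n)\<bar> \<le> e n / sqrt (m n)"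
    and above: "\<forall>\<^sub>F n in sequentially. \<forall>u\<ge>1. \<bar>\<phi> n u - 1\<bar> \<le> C * p n / sqrt (m n)"
    and e: "\<And>n. e n \<ge> 0" "e \<longlonglongrightarrow> 0"
    and p0: "p \<longlonglongrightarrow> 0" and m: "filterlim m at_top sequentially"
    and v: "(\<lambda>n. real n * p n / m n) \<longlonglongrightarrow> v"
    and bias: "(\<lambda>n. (real n * p n - m n * v) / sqrt (m n)) \<longlonglongrightarrow> 0"
  shows "tends_to_0_in_prob M (\<lambda>n \<omega>. (\<Sum>i<n. ln (\<phi> n (U n i \<omega>)))
      - (k * (((\<Sum>i<n. indicat_real {..<1} (U n i \<omega>)) - m n * v) / sqrt (m n)) - k\<^sup>2 * v / 2))"
proof -
  define w where "w n = 1 / sqrt (m n)" for n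
  define J where "J n i \<omega> = indicat_real {..<1} (U n i \<omega>)" for n i \<omega>
  define x where "x n i \<omega> = \<phi> n (U n i \<omega>) - 1" for n i \<omega>
  \<comment> \<open>The target splits into four null terms: the linear error \<open>D\<close>, the
    logarithmic remainder \<open>R\<close>, the fluctuation of the quadratic term around its mean,
    and the deterministic drift \<open>c\<close>. In \<open>c\<close>, the first summand is the bias
    of centring at \<open>m n * v\<close>, the second the error in the limit variance.\<close>
  define D where "D n i \<omega> = x n i \<omega> - k * w n * (J n i \<omega> - p n)" for n i \<omega>
  define R where "R n i \<omega> = ln (1 + x n i \<omega>) - x n i \<omega> + k\<^sup>2 * (w n)\<^sup>2 * J n i \<omega> / 2" for n i \<omega>
  define c where "c n = k * w n * (m n * v - real n * p n) - k\<^sup>2 / 2 * ((w n)\<^sup>2 * (real n * p n) - v)" for n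
  have U[measurable]: "U n i \<in> borel_measurable M" if "i < n" for n i
    using indep[of n] that unfolding indep_vars_def by auto
  have [measurable]: "J n i \<in> borel_measurable M" "x n i \<in> borel_measurable M" "D n i \<in> borel_measurable M"
      "R n i \<in> borel_measurable M" if "i < n" for n i
    unfolding R_def D_def x_def J_def using that by measurable
  have indepD: "indep_vars (\<lambda>_. borel) (D n) {..<n}"
    and indepJ: "indep_vars (\<lambda>_. borel) (\<lambda>i \<omega>. J n i \<omega> - p n) {..<n}" for n
    unfolding D_def x_def J_def by (rule indep_vars_compose2[OF indep], measurable)+
  have w0: "w \<longlonglongrightarrow> 0"
    unfolding w_def by (intro tendsto_divide_0[OF tendsto_const] filterlim_at_top_imp_at_infinity
        filterlim_compose[OF sqrt_at_top] m)
  have m0: "\<forall>\<^sub>F n in sequentially. m n > 0"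
    using m by (auto simp: filterlim_at_top_dense)
  have w2: "\<forall>\<^sub>F n in sequentially. (w n)\<^sup>2 = 1 / m n"
    using m0 by eventually_elim (simp add: w_def power_divide)
  have nwp: "(\<lambda>n. (w n)\<^sup>2 * (real n * p n)) \<longlonglongrightarrow> v"
    by (rule Lim_transform_eventually[OF v]) (use w2 in eventually_elim, simp)
  have "(\<lambda>n. (\<bar>k\<bar> + e n) * w n) \<longlonglongrightarrow> (\<bar>k\<bar> + 0) * 0" "(\<lambda>n. C * p n * w n) \<longlonglongrightarrow> C * 0 * 0"
    by (intro tendsto_intros e w0 p0)+
  then have "\<forall>\<^sub>F n in sequentially. (\<bar>k\<bar> + e n) * w n < 1/2" "\<forall>\<^sub>F n in sequentially. C * p n * w n < 1/2"
    by (auto intro: order_tendstoD(2)[where a="1/2"] simp del: less_divide_eq_numeral1)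
  with m0 below above mean eventually_gt_at_top[of 0]
  have good: "\<forall>\<^sub>F n in sequentially. 0 \<le> p n \<and> p n \<le> 1 \<and> w n \<ge> 0 \<and>
      (\<forall>i<n. \<forall>\<omega>. (J n i \<omega> = 1 \<and> \<bar>x n i \<omega> - k * w n\<bar> \<le> e n * w n \<or> J n i \<omega> = 0 \<and> \<bar>x n i \<omega>\<bar> \<le> C * p n * w n)
         \<and> \<bar>x n i \<omega>\<bar> \<le> 1/2) \<and>
      (\<forall>i<n. expectation (\<lambda>\<omega>. \<phi> n (U n i \<omega>)) = 1)"
  proof eventually_elim
    case (elim n)
    have pn: "0 \<le> p n" "p n \<le> 1"
      using p[of 0 n] elim measure_nonneg prob_le_1 by metis+
    have wn: "w n \<ge> 0" using elim by (simp add: w_def)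
    have alt: "J n i \<omega> = 1 \<and> \<bar>x n i \<omega> - k * w n\<bar> \<le> e n * w n \<or> J n i \<omega> = 0 \<and> \<bar>x n i \<omega>\<bar> \<le> C * p n * w n" for i \<omega>
      using elim(2,3) by (cases "U n i \<omega> < 1") (auto simp: J_def x_def w_def)
    have "\<bar>x n i \<omega>\<bar> \<le> 1/2" for i \<omega>
      using alt[of i \<omega>]
    proof (elim disjE conjE)
      assume "\<bar>x n i \<omega> - k * w n\<bar> \<le> e n * w n"
      then have "\<bar>x n i \<omega>\<bar> \<le> (\<bar>k\<bar> + e n) * w n"
        using wn abs_triangle_ineq2[of "x n i \<omega>" "k * w n"] by (simp add: abs_mult algebra_simps)
      then show ?thesis using elim by linarith
    next
      assume "\<bar>x n i \<omega>\<bar> \<le> C * p n * w n"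
      then show ?thesis using elim by linarith
    qed
    then show ?case using pn wn alt elim by blast
  qed
  have EJ: "expectation (J n i) = p n" if "i < n" for n i
    using expectation_indicator_lessThan[OF U[OF that]] p[OF that] by (simp add: J_def[abs_def])
  have intJ: "integrable M (J n i)" if "i < n" for n i
    by (rule integrable_const_bound[where B=1]) (use that in \<open>auto simp: J_def indicator_def\<close>)

  \<comment> \<open>By orthogonality the second moments add up to
    \<open>(w n)\<^sup>2 * (real n * p n)\<close>, which converges, times a null sequence. Adding
    absolute values instead would only give o(sqrt m).\<close>
  have A: "tends_to_0_in_prob M (\<lambda>n \<omega>. \<Sum>i<n. D n i \<omega>)"
  proof (rule tends_to_0_in_prob_moment[where k=2 and a="\<lambda>n. ((w n)\<^sup>2 * (real n * p n)) * ((e n + \<bar>k\<bar> * p n)\<^sup>2 + (C + \<bar>k\<bar>)\<^sup>2 * p n)"])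
    have "(\<lambda>n. ((w n)\<^sup>2 * (real n * p n)) * ((e n + \<bar>k\<bar> * p n)\<^sup>2 + (C + \<bar>k\<bar>)\<^sup>2 * p n))
        \<longlonglongrightarrow> v * ((0 + \<bar>k\<bar> * 0)\<^sup>2 + (C + \<bar>k\<bar>)\<^sup>2 * 0)"
      by (intro tendsto_intros nwp e p0)
    then show "(\<lambda>n. ((w n)\<^sup>2 * (real n * p n)) * ((e n + \<bar>k\<bar> * p n)\<^sup>2 + (C + \<bar>k\<bar>)\<^sup>2 * p n)) \<longlonglongrightarrow> 0"
      by simp
    show "\<forall>\<^sub>F n in sequentially. integrable M (\<lambda>\<omega>. \<bar>\<Sum>i<n. D n i \<omega>\<bar>\<^sup>2) \<and> expectation (\<lambda>\<omega>. \<bar>\<Sum>i<n. D n i \<omega>\<bar>\<^sup>2)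
        \<le> ((w n)\<^sup>2 * (real n * p n)) * ((e n + \<bar>k\<bar> * p n)\<^sup>2 + (C + \<bar>k\<bar>)\<^sup>2 * p n)"
      using good
    proof eventually_elim
      case (elim n)
      let ?b = "\<lambda>J. (w n)\<^sup>2 * ((e n + \<bar>k\<bar> * p n)\<^sup>2 * J + (C + \<bar>k\<bar>)\<^sup>2 * (p n)\<^sup>2)"
      have b: "(D n i \<omega>)\<^sup>2 \<le> ?b (J n i \<omega>)" if "i < n" for i \<omega>
        unfolding D_def using elim e(1)[of n] that by (intro linear_part_square_bound) auto
      have D2: "integrable M (\<lambda>\<omega>. (D n i \<omega>)\<^sup>2)" if "i < n" for i
        by (rule Bochner_Integration.integrable_bound[where f="\<lambda>\<omega>. ?b (J n i \<omega>)"])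
          (use that intJ[OF that] b[OF that] in \<open>auto intro!: AE_I2 intro: order_trans[OF _ abs_ge_self]\<close>)
      have xint: "integrable M (x n i)" if "i < n" for i
        by (rule integrable_const_bound[where B="1/2"]) (use that elim in auto)
      \<comment> \<open>Here the mean one of the likelihood ratio enters.\<close>
      have "expectation (D n i) = 0" if "i < n" for i
      proof -
        have "expectation (x n i) = 0"
        proof -
          have "expectation (\<lambda>\<omega>. x n i \<omega> + 1) = expectation (x n i) + 1"
            using xint[OF that] by (simp add: prob_space)
          then show ?thesis using elim that by (simp add: x_def)
        qed
        then show ?thesis
          using xint[OF that] intJ[OF that] EJ[OF that] by (simp add: D_def[abs_def] prob_space)
      qed
      from second_moment_indep_sum[OF finite_lessThan indepD _ this] D2
      have S: "integrable M (\<lambda>\<omega>. (\<Sum>i<n. D n i \<omega>)\<^sup>2)"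
        "expectation (\<lambda>\<omega>. (\<Sum>i<n. D n i \<omega>)\<^sup>2) = (\<Sum>i<n. expectation (\<lambda>\<omega>. (D n i \<omega>)\<^sup>2))"
        by auto
      note S(2)
      also have "(\<Sum>i<n. expectation (\<lambda>\<omega>. (D n i \<omega>)\<^sup>2)) \<le> (\<Sum>i<n. ?b (p n))"
      proof (rule sum_mono)
        fix i assume "i \<in> {..<n}"
        then have i: "i < n" by simp
        have "expectation (\<lambda>\<omega>. (D n i \<omega>)\<^sup>2) \<le> expectation (\<lambda>\<omega>. ?b (J n i \<omega>))"
          using intJ[OF i] by (intro integral_mono D2 b i) auto
        also have "\<dots> = ?b (p n)"
          using intJ[OF i] EJ[OF i] by (simp add: prob_space)
        finally show "expectation (\<lambda>\<omega>. (D n i \<omega>)\<^sup>2) \<le> ?b (p n)" .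
      qed
      also have "\<dots> = ((w n)\<^sup>2 * (real n * p n)) * ((e n + \<bar>k\<bar> * p n)\<^sup>2 + (C + \<bar>k\<bar>)\<^sup>2 * p n)"
        by (simp add: power2_eq_square algebra_simps)
      finally show ?case using S(1) by simp
    qed
  qed (auto simp: prob_space_axioms)

  \<comment> \<open>The remainder is not centred, but it is quadratically small, so that first
    absolute moments can be summed.\<close>
  have B: "tends_to_0_in_prob M (\<lambda>n \<omega>. \<Sum>i<n. R n i \<omega>)"
  proof -
    define \<eta> where "\<eta> n = e n * (2 * \<bar>k\<bar> + e n) + 2 * (\<bar>k\<bar> + e n) ^ 3 * w n + 2 * C\<^sup>2 * p n" for n
    have "\<eta> \<longlonglongrightarrow> 0 * (2 * \<bar>k\<bar> + 0) + 2 * (\<bar>k\<bar> + 0) ^ 3 * 0 + 2 * C\<^sup>2 * 0"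
      unfolding \<eta>_def by (intro tendsto_add tendsto_mult tendsto_power tendsto_const e(2) p0 w0)
    then have \<eta>0: "(\<lambda>n. 2 * \<eta> n * ((w n)\<^sup>2 * (real n * p n))) \<longlonglongrightarrow> 2 * 0 * v"
      using tendsto_mult[OF tendsto_mult[OF tendsto_const] nwp, of \<eta> 0 2] by simp
    show ?thesis
    proof (rule tends_to_0_in_prob_moment[where k=1 and a="\<lambda>n. 2 * \<eta> n * ((w n)\<^sup>2 * (real n * p n))"])
      show "\<forall>\<^sub>F n in sequentially. integrable M (\<lambda>\<omega>. \<bar>\<Sum>i<n. R n i \<omega>\<bar> ^ 1) \<and>
          expectation (\<lambda>\<omega>. \<bar>\<Sum>i<n. R n i \<omega>\<bar> ^ 1) \<le> 2 * \<eta> n * ((w n)\<^sup>2 * (real n * p n))"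
        using good
      proof eventually_elim
        case (elim n)
        let ?b = "\<lambda>J. \<eta> n * (w n)\<^sup>2 * (J + p n)"
        have b: "\<bar>R n i \<omega>\<bar> \<le> ?b (J n i \<omega>)" if "i < n" for i \<omega>
          unfolding R_def \<eta>_def using elim e(1)[of n] that by (intro abs_ln_one_plus_expansion) auto
        have iR: "integrable M (R n i)" if "i < n" for i
          by (rule Bochner_Integration.integrable_bound[where f="\<lambda>\<omega>. ?b (J n i \<omega>)"])
            (use that intJ[OF that] b[OF that] in \<open>auto intro!: AE_I2 intro: order_trans[OF _ abs_ge_self]\<close>)
        have "expectation (\<lambda>\<omega>. \<bar>\<Sum>i<n. R n i \<omega>\<bar>) \<le> expectation (\<lambda>\<omega>. \<Sum>i<n. ?b (J n i \<omega>))"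
        proof (rule integral_mono)
          show "\<bar>\<Sum>i<n. R n i \<omega>\<bar> \<le> (\<Sum>i<n. ?b (J n i \<omega>))" for \<omega>
            by (rule order_trans[OF sum_abs sum_mono]) (use b in auto)
        next
          show "integrable M (\<lambda>\<omega>. \<bar>\<Sum>i<n. R n i \<omega>\<bar>)"
            by (intro integrable_abs Bochner_Integration.integrable_sum iR) simp
          show "integrable M (\<lambda>\<omega>. \<Sum>i<n. ?b (J n i \<omega>))"
            using intJ by (intro Bochner_Integration.integrable_sum) simp
        qed
        also have "\<dots> = (\<Sum>i<n. expectation (\<lambda>\<omega>. ?b (J n i \<omega>)))"
          using intJ by (intro Bochner_Integration.integral_sum) simp
        also have "\<dots> = (\<Sum>i<n. ?b (p n))"
        proof (rule sum.cong)
          fix i assume "i \<in> {..<n}"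
          then have i: "i < n" by simp
          show "expectation (\<lambda>\<omega>. ?b (J n i \<omega>)) = ?b (p n)"
            using intJ[OF i] EJ[OF i] by (simp add: prob_space)
        qed simp
        also have "\<dots> = 2 * \<eta> n * ((w n)\<^sup>2 * (real n * p n))" by simp
        finally show ?case
          using integrable_abs[OF Bochner_Integration.integrable_sum[of "{..<n}" M "R n"]] iR by simp
      qed
    qed (use \<eta>0 in \<open>auto simp: prob_space_axioms\<close>)
  qed

  \<comment> \<open>A weak law of large numbers: the quadratic term contains the random count, whose
    variance after scaling is of order (w n)^4 n p, that is 1 / m.\<close>
  have J: "tends_to_0_in_prob M (\<lambda>n \<omega>. - (k\<^sup>2) / 2 * (w n)\<^sup>2 * (\<Sum>i<n. J n i \<omega> - p n))"
  proof (rule tends_to_0_in_prob_moment[where k=2 and a="\<lambda>n. (k\<^sup>2 / 2)\<^sup>2 * (w n)\<^sup>2 * ((w n)\<^sup>2 * (real n * p n)) * (1 - p n)"])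
    have "(\<lambda>n. (k\<^sup>2 / 2)\<^sup>2 * (w n)\<^sup>2 * ((w n)\<^sup>2 * (real n * p n)) * (1 - p n)) \<longlonglongrightarrow> (k\<^sup>2 / 2)\<^sup>2 * 0\<^sup>2 * v * (1 - 0)"
      by (intro tendsto_mult tendsto_diff tendsto_power tendsto_const nwp w0 p0)
    then show "(\<lambda>n. (k\<^sup>2 / 2)\<^sup>2 * (w n)\<^sup>2 * ((w n)\<^sup>2 * (real n * p n)) * (1 - p n)) \<longlonglongrightarrow> 0" by simp
    show "\<forall>\<^sub>F n in sequentially. integrable M (\<lambda>\<omega>. \<bar>- (k\<^sup>2) / 2 * (w n)\<^sup>2 * (\<Sum>i<n. J n i \<omega> - p n)\<bar>\<^sup>2) \<and>
        expectation (\<lambda>\<omega>. \<bar>- (k\<^sup>2) / 2 * (w n)\<^sup>2 * (\<Sum>i<n. J n i \<omega> - p n)\<bar>\<^sup>2)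
          \<le> (k\<^sup>2 / 2)\<^sup>2 * (w n)\<^sup>2 * ((w n)\<^sup>2 * (real n * p n)) * (1 - p n)"
    proof (rule always_eventually, rule allI)
      fix n
      have mom: "expectation (\<lambda>\<omega>. J n i \<omega> - p n) = 0" "expectation (\<lambda>\<omega>. (J n i \<omega> - p n)\<^sup>2) = p n * (1 - p n)"
        if "i < n" for i
        using centered_indicator_moments[OF U[OF that] p[OF that]] by (simp_all add: J_def)
      have int: "integrable M (\<lambda>\<omega>. (J n i \<omega> - p n)\<^sup>2)" if "i < n" for i
        by (rule integrable_const_bound[where B="(1 + \<bar>p n\<bar>)\<^sup>2"])
          (use that in \<open>auto simp: J_def indicator_def abs_le_square_iff[symmetric]\<close>)
      have "integrable M (\<lambda>\<omega>. (\<Sum>i<n. J n i \<omega> - p n)\<^sup>2) \<and>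
         expectation (\<lambda>\<omega>. (\<Sum>i<n. J n i \<omega> - p n)\<^sup>2) = real n * (p n * (1 - p n))"
        using second_moment_indep_sum[OF finite_lessThan indepJ int mom(1)] mom(2) by simp
      moreover have "\<bar>- (k\<^sup>2) / 2 * (w n)\<^sup>2 * S\<bar>\<^sup>2 = ((k\<^sup>2 / 2)\<^sup>2 * (w n)\<^sup>2 * (w n)\<^sup>2) * S\<^sup>2" for S
        by (simp add: power_mult_distrib power_divide)
      ultimately show "integrable M (\<lambda>\<omega>. \<bar>- (k\<^sup>2) / 2 * (w n)\<^sup>2 * (\<Sum>i<n. J n i \<omega> - p n)\<bar>\<^sup>2) \<and>
        expectation (\<lambda>\<omega>. \<bar>- (k\<^sup>2) / 2 * (w n)\<^sup>2 * (\<Sum>i<n. J n i \<omega> - p n)\<bar>\<^sup>2)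
          \<le> (k\<^sup>2 / 2)\<^sup>2 * (w n)\<^sup>2 * ((w n)\<^sup>2 * (real n * p n)) * (1 - p n)"
        by (simp add: mult.assoc)
    qed
  qed (auto simp: prob_space_axioms)

  have c0: "c \<longlonglongrightarrow> 0"
  proof -
    have "(\<lambda>n. - k * ((real n * p n - m n * v) / sqrt (m n)) - k\<^sup>2 / 2 * ((w n)\<^sup>2 * (real n * p n) - v))
        \<longlonglongrightarrow> - k * 0 - k\<^sup>2 / 2 * (v - v)"
      by (intro tendsto_mult tendsto_diff tendsto_const bias nwp)
    moreover have "c = (\<lambda>n. - k * ((real n * p n - m n * v) / sqrt (m n)) - k\<^sup>2 / 2 * ((w n)\<^sup>2 * (real n * p n) - v))"
      by (rule ext) (simp add: c_def w_def diff_divide_distrib right_diff_distrib)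
    ultimately show ?thesis by simp
  qed
  have eq: "(\<Sum>i<n. ln (\<phi> n (U n i \<omega>)))
      - (k * (((\<Sum>i<n. indicat_real {..<1} (U n i \<omega>)) - m n * v) / sqrt (m n)) - k\<^sup>2 * v / 2)
      = (\<Sum>i<n. D n i \<omega>) + (\<Sum>i<n. R n i \<omega>) + - (k\<^sup>2) / 2 * (w n)\<^sup>2 * (\<Sum>i<n. J n i \<omega> - p n)
        + c n" for n \<omega>
  proof -
    have D: "(\<Sum>i<n. D n i \<omega>) = (\<Sum>i<n. x n i \<omega>) - k * w n * ((\<Sum>i<n. J n i \<omega>) - real n * p n)"
      by (simp add: D_def sum_subtractf sum_distrib_left right_diff_distrib mult.left_commute)
    have R: "(\<Sum>i<n. R n i \<omega>) = (\<Sum>i<n. ln (\<phi> n (U n i \<omega>))) - (\<Sum>i<n. x n i \<omega>) + k\<^sup>2 * (w n)\<^sup>2 * (\<Sum>i<n. J n i \<omega>) / 2"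
      by (simp add: R_def sum.distrib sum_subtractf sum_distrib_left sum_divide_distrib) (simp add: x_def)
    have J: "(\<Sum>i<n. J n i \<omega> - p n) = (\<Sum>i<n. J n i \<omega>) - real n * p n"
      by (simp add: sum_subtractf)
    have w: "(a - m n * v) / sqrt (m n) = w n * (a - m n * v)" for a
      by (simp add: w_def)
    show ?thesis
      unfolding D R J w J_def[symmetric] c_def by (simp add: algebra_simps add_divide_distrib diff_divide_distrib)
  qed
  have mD: "(\<lambda>\<omega>. \<Sum>i<n. D n i \<omega>) \<in> borel_measurable M"
    and mR: "(\<lambda>\<omega>. \<Sum>i<n. R n i \<omega>) \<in> borel_measurable M"
    and mJ: "(\<lambda>\<omega>. - (k\<^sup>2) / 2 * (w n)\<^sup>2 * (\<Sum>i<n. J n i \<omega> - p n)) \<in> borel_measurable M" for n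
    by auto
  note mDR = borel_measurable_add[OF mD mR]
  show ?thesis
    unfolding eq
    by (rule tends_to_0_in_prob_add[OF prob_space_axioms borel_measurable_add[OF mDR mJ] _
          tends_to_0_in_prob_add[OF prob_space_axioms mDR mJ
            tends_to_0_in_prob_add[OF prob_space_axioms mD mR A B] J]
          tends_to_0_in_prob_const[OF c0]]) simp
qed

section \<open>Exceedance probabilities of generalized Pareto processes\<close>

lemma closure_unit_rationals: "closure ({0..1} \<inter> \<rat>) = {0..1::real}"
proof -
  have "closure ({0<..<1} \<inter> \<rat>) = closure {0<..<1::real}"
    by (rule closure_open_Int_superset) (auto simp: Rats_closure_real)
  moreover have "closure ({0<..<1} \<inter> \<rat>) \<subseteq> closure ({0..1} \<inter> \<rat> :: real set)"
    by (rule closure_mono) auto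
  moreover have "closure ({0..1} \<inter> \<rat>) \<subseteq> closure {0..1::real}"
    by (rule closure_mono) auto
  ultimately show ?thesis by auto
qed

lemma continuous_unit_le_iff_rationals:
  fixes g :: "real \<Rightarrow> real"
  assumes g: "continuous_on {0..1} g"
  shows "(\<forall>t\<in>{0..1}. g t \<le> a) \<longleftrightarrow> (\<forall>t\<in>{0..1} \<inter> \<rat>. g t \<le> a)"
proof (intro iffI ballI)
  fix t assume *: "\<forall>t\<in>{0..1} \<inter> \<rat>. g t \<le> a" and t: "t \<in> {0..1::real}"
  show "g t \<le> a"
    by (rule continuous_le_on_closure[where S="{0..1} \<inter> \<rat>"])
      (use g t * in \<open>simp_all add: closure_unit_rationals\<close>)
qed auto

text \<open>By compactness the supremum is attained, so strict inequalities at all times pass to the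
  supremum; for a mere supremum only the weak inequality would.\<close>

lemma continuous_unit_SUP:
  fixes g :: "real \<Rightarrow> real"
  assumes g: "continuous_on {0..1} g"
  shows "bdd_above (g ` {0..1})"
    and "(\<forall>t\<in>{0..1}. g t < u) \<longleftrightarrow> (SUP t\<in>{0..1}. g t) < u"
proof -
  show bdd: "bdd_above (g ` {0..1})"
    using compact_continuous_image[OF g compact_Icc] by (simp add: bounded_imp_bdd_above compact_imp_bounded)
  obtain t0 where t0: "t0 \<in> {0..1}" "\<And>t. t \<in> {0..1} \<Longrightarrow> g t \<le> g t0"
    using continuous_attains_sup[OF compact_Icc _ g] by auto
  have "(SUP t\<in>{0..1}. g t) = g t0"
    by (rule cSup_eq_maximum) (use t0 in auto)
  then show "(\<forall>t\<in>{0..1}. g t < u) \<longleftrightarrow> (SUP t\<in>{0..1}. g t) < u"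
    using t0 by (auto intro: le_less_trans[OF t0(2)])
qed

text \<open>Independence and equality of laws are given for restricted paths in the product space.
  The supremum therefore has to be a measurable function on that whole space: the index set is made
  countable, and values in \<open>ereal\<close> take care of functions that are unbounded on it. On
  continuous paths the usual supremum is recovered.\<close>

definition path_sup :: "real \<Rightarrow> (real \<Rightarrow> real) \<Rightarrow> real" where
  "path_sup c g = real_of_ereal (SUP t\<in>{0..1} \<inter> \<rat>. ereal (g t / c))"

lemma measurable_path_sup [measurable]:
  "path_sup c \<in> borel_measurable (PiM {0..1} (\<lambda>_. borel))"
  unfolding path_sup_def
  by (intro borel_measurable_real_of_ereal borel_measurable_SUP countable_Int2 countable_rat
      borel_measurable_ereal borel_measurable_divide measurable_component_singleton) auto

lemma path_sup_eq_SUP: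
  assumes g: "continuous_on {0..1} g"
  shows "path_sup c (restrict g {0..1}) = (SUP t\<in>{0..1}. g t / c)"
proof -
  let ?g = "\<lambda>t. g t / c"
  have g': "continuous_on {0..1} ?g"
    using g by (auto simp: divide_inverse intro!: continuous_intros)
  define S where "S = (SUP t\<in>{0..1}. ?g t)"
  have "(SUP t\<in>{0..1} \<inter> \<rat>. ereal (restrict g {0..1} t / c)) = (SUP t\<in>{0..1} \<inter> \<rat>. ereal (?g t))"
    by (intro SUP_cong) auto
  also have "\<dots> = ereal S"
  proof (rule SUP_eqI)
    fix t assume "t \<in> {0..1} \<inter> (\<rat> :: real set)"
    then show "ereal (?g t) \<le> ereal S"
      unfolding S_def ereal_less_eq by (intro cSUP_upper continuous_unit_SUP(1) g') auto
  next
    fix y assume y: "\<And>t. t \<in> {0..1} \<inter> \<rat> \<Longrightarrow> ereal (?g t) \<le> y"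
    show "ereal S \<le> y"
    proof (cases y)
      case (real r)
      then have "\<forall>t\<in>{0..1} \<inter> \<rat>. ?g t \<le> r" using y by auto
      then have "\<forall>t\<in>{0..1}. ?g t \<le> r"
        using continuous_unit_le_iff_rationals[OF g'] by blast
      then have "S \<le> r" unfolding S_def by (intro cSUP_least) auto
      then show ?thesis using real by simp
    next
      case MInf
      then show ?thesis using y[of 0] by auto
    qed auto
  qed
  finally show ?thesis by (simp add: path_sup_def S_def)
qed

lemma measurable_restrict_path:
  assumes "continuous_process M X"
  shows "(\<lambda>\<omega>. restrict (X \<omega>) {0..1}) \<in> measurable M (PiM {0..1} (\<lambda>_. borel))"
  using assms unfolding continuous_process_def
  by (intro measurable_restrict) auto

lemma measurable_path_SUP:
  assumes X: "continuous_process M X"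
  shows "(\<lambda>\<omega>. SUP t\<in>{0..1}. X \<omega> t / c) \<in> borel_measurable M"
proof -
  have "(\<lambda>\<omega>. path_sup c (restrict (X \<omega>) {0..1})) \<in> borel_measurable M"
    by (rule measurable_compose[OF measurable_restrict_path[OF X] measurable_path_sup])
  then show ?thesis
    by (rule measurable_cong[THEN iffD1, rotated])
      (use X in \<open>auto simp: path_sup_eq_SUP continuous_process_def\<close>)
qed

lemma path_SUP_less_iff:
  fixes g :: "real \<Rightarrow> real"
  assumes "continuous_on {0..1} g" "c < 0"
  shows "(SUP t\<in>{0..1}. g t / c) < u \<longleftrightarrow> (\<forall>t\<in>{0..1}. g t > u * c)"
proof -
  have "continuous_on {0..1} (\<lambda>t. g t / c)"
    by (intro continuous_on_divide assms continuous_on_const) (use assms(2) in auto)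
  from continuous_unit_SUP(2)[OF this, of u, symmetric] show ?thesis
    using assms by (simp add: divide_less_eq)
qed

lemma prob_gt_eq_path_SUP:
  assumes X: "continuous_process M X" and c: "c < 0"
  shows "prob_gt M X (\<lambda>_. u * c) = measure M {\<omega>\<in>space M. (SUP t\<in>{0..1}. X \<omega> t / c) < u}"
  unfolding prob_gt_def
  using X path_SUP_less_iff[OF _ c] by (intro arg_cong[where f="measure M"]) (auto simp: continuous_process_def)

lemma sets_path_gt:
  assumes X: "continuous_process M X"
  shows "{\<omega>\<in>space M. \<forall>t\<in>{0..1}. X \<omega> t > a} \<in> sets M"
proof -
  have "{\<omega>\<in>space M. \<forall>t\<in>{0..1}. X \<omega> t > a} = {\<omega>\<in>space M. (SUP t\<in>{0..1}. X \<omega> t / (-1)) < - a}"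
    using X path_SUP_less_iff[of _ "-1" "-a"] by (auto simp: continuous_process_def)
  then show ?thesis
    using measurable_path_SUP[OF X, of "-1"] by simp
qed

section \<open>Overlap of shifted densities and joint exceedances of the Pareto process\<close>

lemma symmetric_unimodal_densityD:
  assumes psi: "symmetric_unimodal_density \<psi>"
  shows "\<psi> \<in> borel_measurable borel" "0 \<le> \<psi> s" "integrable lborel \<psi>" "(LINT s|lborel. \<psi> s) = 1"
    and "\<bar>a\<bar> \<le> \<bar>b\<bar> \<Longrightarrow> \<psi> b \<le> \<psi> a"
proof -
  show m: "\<psi> \<in> borel_measurable borel"
    using psi unfolding symmetric_unimodal_density_def by (intro borel_measurable_continuous_onI) auto
  have nn: "0 \<le> \<psi> s" for s
    using psi unfolding symmetric_unimodal_density_def by (simp add: less_imp_le)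
  then show "0 \<le> \<psi> s" .
  have "prob_space (density lborel (\<lambda>s. ennreal (\<psi> s)))"
    using psi unfolding symmetric_unimodal_density_def by auto
  then have "(\<integral>\<^sup>+s. ennreal (\<psi> s) \<partial>lborel) = 1"
    using m prob_space.emeasure_space_1 by (fastforce simp: emeasure_density)
  then have "has_bochner_integral lborel \<psi> 1"
    using m nn by (intro has_bochner_integral_nn_integral) auto
  then show "integrable lborel \<psi>" "(LINT s|lborel. \<psi> s) = 1"
    by (auto simp: has_bochner_integral_iff)
  have abs: "\<psi> s = \<psi> \<bar>s\<bar>" for s
    using psi unfolding symmetric_unimodal_density_def by (cases "s \<ge> 0") auto
  have "antimono_on {0..} \<psi>"
    using psi unfolding symmetric_unimodal_density_def by auto
  then show "\<psi> b \<le> \<psi> a" if "\<bar>a\<bar> \<le> \<bar>b\<bar>"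
    using that unfolding abs[of a] abs[of b] by (auto simp: monotone_on_def)
qed

lemma shifted_density:
  assumes psi: "symmetric_unimodal_density \<psi>"
  shows "integrable lborel (\<lambda>s. \<psi> (s - a))" "(LINT s|lborel. \<psi> (s - a)) = 1"
  using lborel_integrable_real_affine[of \<psi> 1 "-a"] lborel_integral_real_affine[of 1 \<psi> "-a"]
    symmetric_unimodal_densityD(3,4)[OF psi]
  by (simp_all add: add.commute[of _ "-a"] del: add_uminus_conv_diff)

text \<open>By unimodality the two densities cross at \<open>\<beta>/2\<close>: to the left the
  shifted one is smaller, to the right the original one. Translation and reflection turn both pieces
  into the tail below \<open>- \<beta> / 2\<close>. This is the origin of the parameter \<theta> = 2
  \<Psi>(-\<beta>/2).\<close>

lemma integral_min_shifted_density:
  assumes psi: "symmetric_unimodal_density \<psi>" and \<beta>: "\<beta> > 0"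
  shows "(LINT s|lborel. min (\<psi> s) (\<psi> (s - \<beta>))) = 2 * Psi \<psi> (- \<beta> / 2)"
proof -
  note D = symmetric_unimodal_densityD[OF psi]
  have sym: "\<psi> (- s) = \<psi> s" for s
    by (rule antisym) (auto intro: D(5))
  have left: "(LINT s|lborel. indicator {..\<beta>/2} s * \<psi> (s - \<beta>)) = Psi \<psi> (- \<beta> / 2)"
  proof -
    have "Psi \<psi> (- \<beta> / 2) = (LINT s|lborel. indicator {..- \<beta> / 2} s * \<psi> s)"
      by (simp add: Psi_def set_lebesgue_integral_def)
    also have "\<dots> = (LINT s|lborel. indicator {..- \<beta> / 2} (- \<beta> + 1 * s) * \<psi> (- \<beta> + 1 * s))"
      by (subst lborel_integral_real_affine[where c=1 and t="- \<beta>"]) auto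
    also have "\<dots> = (LINT s|lborel. indicator {..\<beta>/2} s * \<psi> (s - \<beta>))"
      by (intro Bochner_Integration.integral_cong) (auto simp: indicator_def field_simps)
    finally show ?thesis by simp
  qed
  have right: "(LINT s|lborel. indicator {\<beta>/2..} s * \<psi> s) = Psi \<psi> (- \<beta> / 2)"
  proof -
    have "Psi \<psi> (- \<beta> / 2) = (LINT s|lborel. indicator {..- \<beta> / 2} s * \<psi> s)"
      by (simp add: Psi_def set_lebesgue_integral_def)
    also have "\<dots> = (LINT s|lborel. indicator {..- \<beta> / 2} (0 + (-1) * s) * \<psi> (0 + (-1) * s))"
      by (subst lborel_integral_real_affine[where c="-1" and t=0]) auto
    also have "\<dots> = (LINT s|lborel. indicator {\<beta>/2..} s * \<psi> s)"
      by (intro Bochner_Integration.integral_cong) (auto simp: indicator_def sym)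
    finally show ?thesis by simp
  qed
  have int: "integrable lborel (\<lambda>s. indicator {..\<beta>/2} s * \<psi> (s - \<beta>))"
      "integrable lborel (\<lambda>s. indicator {\<beta>/2..} s * \<psi> s)"
    using integrable_mult_indicator[OF _ shifted_density(1)[OF psi, of \<beta>], of "{..\<beta>/2}"]
      integrable_mult_indicator[OF _ D(3), of "{\<beta>/2..}"] by auto
  have "(LINT s|lborel. min (\<psi> s) (\<psi> (s - \<beta>)))
      = (LINT s|lborel. indicator {..\<beta>/2} s * \<psi> (s - \<beta>) + indicator {\<beta>/2..} s * \<psi> s)"
  proof (rule integral_cong_AE)
    show "AE s in lborel. min (\<psi> s) (\<psi> (s - \<beta>)) = indicator {..\<beta>/2} s * \<psi> (s - \<beta>) + indicator {\<beta>/2..} s * \<psi> s"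
      using AE_lborel_singleton[of "\<beta>/2"]
    proof eventually_elim
      case (elim s)
      show ?case
      proof (cases "s < \<beta>/2")
        case True
        then have "\<psi> (s - \<beta>) \<le> \<psi> s" by (intro D(5)) (use \<beta> in auto)
        then show ?thesis using True by simp
      next
        case False
        then have "\<psi> s \<le> \<psi> (s - \<beta>)" by (intro D(5)) (use \<beta> in auto)
        then show ?thesis using False elim by simp
      qed
    qed
  qed (use D(1) in measurable)
  also have "\<dots> = 2 * Psi \<psi> (- \<beta> / 2)"
    using int left right by simp
  finally show ?thesis .
qed

text \<open>The test function is \<open>- x\<close> on \<open>T\<close> and 0 elsewhere, which is
  admissible because \<open>Ebar_neg\<close> allows finitely many discontinuities. The test function
  0 shows that \<open>V\<close> is almost surely nonpositive, so only the constraints on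
  \<open>T\<close> remain.\<close>

lemma GPP_finite_dimensional:
  assumes psi: "symmetric_unimodal_density \<psi>" and V: "standard_GPP \<psi> \<beta> Q V"
  obtains x0 where "x0 > 0"
    "\<And>x T. \<lbrakk>0 \<le> x; x \<le> x0; finite T; T \<noteq> {}; T \<subseteq> {0..1}\<rbrakk> \<Longrightarrow>
       measure Q {\<omega>\<in>space Q. \<forall>t\<in>T. V \<omega> t \<le> - x} = 1 - x * (LINT s|lborel. (MAX t\<in>T. \<psi> (s - \<beta> * t)))"
proof -
  note D = symmetric_unimodal_densityD[OF psi]
  from V have cp: "continuous_process Q V" by (simp add: standard_GPP_def)
  interpret prob_space Q using cp by (simp add: continuous_process_def)
  from V obtain x0 where x0: "x0 > 0" and
    le: "\<And>f. f \<in> Ebar_neg \<Longrightarrow> sup_norm f \<le> x0 \<Longrightarrow>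
       prob_le Q V f = 1 - (LINT s|lborel. (SUP t\<in>{0..1}. \<bar>f t\<bar> * \<psi> (s - \<beta> * t)))"
    unfolding standard_GPP_def by blast
  have "bounded ((\<lambda>_::real. 0::real) ` {0..1})"
    by (rule bounded_subset[of "{0}"]) auto
  then have "prob_le Q V (\<lambda>_. 0) = 1"
    using le[of "\<lambda>_. 0"] x0 by (simp add: Ebar_neg_def sup_norm_def)
  then have one: "prob {\<omega>\<in>space Q. \<forall>t\<in>{0..1}. V \<omega> t \<le> 0} = 1"
    by (simp add: prob_le_def)
  \<comment> \<open>\<open>measure\<close> is 0 outside the sigma algebra, so having probability one
    certifies measurability.\<close>
  then have E0: "{\<omega>\<in>space Q. \<forall>t\<in>{0..1}. V \<omega> t \<le> 0} \<in> events"
    using measure_notin_sets by fastforce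
  have AE0: "AE \<omega> in Q. \<forall>t\<in>{0..1}. V \<omega> t \<le> 0"
    using prob_Collect_eq_1[OF E0] one by simp
  show thesis
  proof (rule that[OF x0])
    fix x T
    assume x: "0 \<le> x" "x \<le> x0" and T: "finite T" "T \<noteq> {}" "T \<subseteq> {0..1::real}"
    define f where "f t = (if t \<in> T then - x else 0)" for t
    have fE: "f \<in> Ebar_neg"
    proof -
      have "f ` {0..1} \<subseteq> {-x, 0}" by (auto simp: f_def)
      then have "bounded (f ` {0..1})" by (rule bounded_subset[rotated]) simp
      moreover have "continuous (at t within {0..1}) f" if "t \<in> {0..1}" "t \<notin> T" for t
      proof -
        have "open (- T)" using T(1) by (simp add: finite_imp_closed open_Compl)
        then have "\<forall>\<^sub>F y in at t within {0..1}. y \<in> - T"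
          using that by (auto simp: eventually_at_topological)
        then have "\<forall>\<^sub>F y in at t within {0..1}. f y = f t"
          by eventually_elim (use that in \<open>simp add: f_def\<close>)
        then show ?thesis unfolding continuous_within by (rule tendsto_eventually)
      qed
      then have "{t\<in>{0..1}. \<not> continuous (at t within {0..1}) f} \<subseteq> T" by auto
      ultimately show ?thesis
        using x T(1) by (auto simp: Ebar_neg_def f_def intro: finite_subset)
    qed
    have sn: "sup_norm f \<le> x0"
      unfolding sup_norm_def by (rule cSUP_least) (use x x0 in \<open>auto simp: f_def\<close>)
    have "(SUP t\<in>{0..1}. \<bar>f t\<bar> * \<psi> (s - \<beta> * t)) = x * (MAX t\<in>T. \<psi> (s - \<beta> * t))" for s
    proof -
      let ?m = "MAX t\<in>T. \<psi> (s - \<beta> * t)"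
      have "?m \<in> (\<lambda>t. \<psi> (s - \<beta> * t)) ` T" using T by (intro Max_in) auto
      then obtain t0 where t0: "t0 \<in> T" "?m = \<psi> (s - \<beta> * t0)" by auto
      have ub: "\<psi> (s - \<beta> * t) \<le> ?m" if "t \<in> T" for t using T that by (intro Max_ge) auto
      have "0 \<le> ?m" using t0 D(2) by simp
      show ?thesis
      proof (rule cSup_eq_maximum)
        show "x * ?m \<in> (\<lambda>t. \<bar>f t\<bar> * \<psi> (s - \<beta> * t)) ` {0..1}"
          by (rule image_eqI[of _ _ t0]) (use t0 T x in \<open>auto simp: f_def\<close>)
        show "y \<le> x * ?m" if "y \<in> (\<lambda>t. \<bar>f t\<bar> * \<psi> (s - \<beta> * t)) ` {0..1}" for y
          using that x \<open>0 \<le> ?m\<close> by (auto simp: f_def intro: mult_left_mono[OF ub x(1)])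
      qed
    qed
    with le[OF fE sn] have "prob_le Q V f = 1 - x * (LINT s|lborel. (MAX t\<in>T. \<psi> (s - \<beta> * t)))"
      by simp
    moreover have "prob {\<omega>\<in>space Q. \<forall>t\<in>T. V \<omega> t \<le> - x} = prob_le Q V f"
    proof -
      have meas: "{\<omega>\<in>space Q. \<forall>t\<in>T. V \<omega> t \<le> - x} \<in> events"
      proof (rule sets.sets_Collect_finite_All)
        fix t assume "t \<in> T"
        then have [measurable]: "(\<lambda>\<omega>. V \<omega> t) \<in> borel_measurable Q"
          using cp T unfolding continuous_process_def by auto
        show "{\<omega>\<in>space Q. V \<omega> t \<le> - x} \<in> events" by measurable
      qed (rule T)
      have "{\<omega>\<in>space Q. \<forall>t\<in>{0..1}. V \<omega> t \<le> f t}
          = {\<omega>\<in>space Q. \<forall>t\<in>T. V \<omega> t \<le> - x} \<inter> {\<omega>\<in>space Q. \<forall>t\<in>{0..1}. V \<omega> t \<le> 0}"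
        using T x by (fastforce simp: f_def split: if_splits)
      with meas E0 have "{\<omega>\<in>space Q. \<forall>t\<in>{0..1}. V \<omega> t \<le> f t} \<in> events" by auto
      with meas show ?thesis unfolding prob_le_def
      proof (intro finite_measure_eq_AE)
        show "AE \<omega> in Q. (\<omega> \<in> {\<omega>\<in>space Q. \<forall>t\<in>T. V \<omega> t \<le> - x}) = (\<omega> \<in> {\<omega>\<in>space Q. \<forall>t\<in>{0..1}. V \<omega> t \<le> f t})"
          using AE0 by eventually_elim (use T in \<open>fastforce simp: f_def split: if_splits\<close>)
      qed
    qed
    ultimately show "prob {\<omega>\<in>space Q. \<forall>t\<in>T. V \<omega> t \<le> - x} = 1 - x * (LINT s|lborel. (MAX t\<in>T. \<psi> (s - \<beta> * t)))"
      by simp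
  qed
qed

text \<open>
  By unimodality \<open>\<psi> (s - \<beta> t) \<ge> min (\<psi> s) (\<psi> (s - \<beta>))\<close>, so a path that exceeds a level at
  \<open>0\<close> and at \<open>1\<close> almost surely exceeds it at every rational time.
\<close>

lemma GPP_exceedance_probability:
  assumes psi: "symmetric_unimodal_density \<psi>" and V: "standard_GPP \<psi> \<beta> Q V" and \<beta>: "\<beta> > 0"
  obtains x0 where "x0 > 0"
    "\<And>x. \<lbrakk>0 < x; x \<le> x0\<rbrakk> \<Longrightarrow> prob_gt Q V (\<lambda>_. - x) = x * (2 * Psi \<psi> (- \<beta> / 2))"
proof -
  note D = symmetric_unimodal_densityD[OF psi]
  from V have cp: "continuous_process Q V" by (simp add: standard_GPP_def)
  interpret prob_space Q using cp by (simp add: continuous_process_def)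
  have rv: "(\<lambda>\<omega>. V \<omega> t) \<in> borel_measurable Q" if "t \<in> {0..1}" for t
    using cp that by (simp add: continuous_process_def)
  have rv01[measurable]: "(\<lambda>\<omega>. V \<omega> 0) \<in> borel_measurable Q" "(\<lambda>\<omega>. V \<omega> 1) \<in> borel_measurable Q"
    by (auto intro: rv)
  obtain x0 where x0: "x0 > 0" and fd:
    "\<And>x T. \<lbrakk>0 \<le> x; x \<le> x0; finite T; T \<noteq> {}; T \<subseteq> {0..1}\<rbrakk> \<Longrightarrow>
       prob {\<omega>\<in>space Q. \<forall>t\<in>T. V \<omega> t \<le> - x} = 1 - x * (LINT s|lborel. (MAX t\<in>T. \<psi> (s - \<beta> * t)))"
    by (rule GPP_finite_dimensional[OF psi V]) blast
  define \<theta> where "\<theta> = 2 * Psi \<psi> (- \<beta> / 2)"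
  let ?g = "\<lambda>t s. \<psi> (s - \<beta> * t)"
  have int[simp, intro]: "integrable lborel (?g t)" for t using shifted_density[OF psi] by blast
  have int1: "(LINT s|lborel. ?g t s) = 1" for t using shifted_density[OF psi] by blast
  define A where "A x t = {\<omega>\<in>space Q. V \<omega> t \<le> - x}" for x t
  have A[measurable]: "A x t \<in> events" if "t \<in> {0..1}" for x t
    unfolding A_def using rv[OF that] by measurable
  have A1: "prob (A x t) = 1 - x" if "0 \<le> x" "x \<le> x0" "t \<in> {0..1}" for x t
    using fd[of x "{t}"] that int1 by (simp add: A_def)
  have A2: "prob (A x t \<inter> A x u) = 1 - x * (LINT s|lborel. max (?g t s) (?g u s))"
    if "0 \<le> x" "x \<le> x0" "t \<in> {0..1}" "u \<in> {0..1}" for x t u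
  proof -
    have "A x t \<inter> A x u = {\<omega>\<in>space Q. \<forall>t\<in>{t, u}. V \<omega> t \<le> - x}" by (auto simp: A_def)
    then show ?thesis using fd[of x "{t, u}"] that by simp
  qed
  have A3: "prob (A x t \<inter> A x u \<inter> A x r) = 1 - x * (LINT s|lborel. max (?g t s) (max (?g u s) (?g r s)))"
    if "0 \<le> x" "x \<le> x0" "t \<in> {0..1}" "u \<in> {0..1}" "r \<in> {0..1}" for x t u r
  proof -
    have "A x t \<inter> A x u \<inter> A x r = {\<omega>\<in>space Q. \<forall>t\<in>{t, u, r}. V \<omega> t \<le> - x}" by (auto simp: A_def)
    then show ?thesis using fd[of x "{t, u, r}"] that by simp
  qed
  have inc_exc: "prob (B - (C \<union> E)) = prob B - prob (B \<inter> C) - prob (B \<inter> E) + prob (B \<inter> C \<inter> E)"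
    if [measurable]: "B \<in> events" "C \<in> events" "E \<in> events" for B C E
  proof -
    have "prob (B - (C \<union> E)) = prob B - prob (B \<inter> (C \<union> E))"
      by (rule finite_measure_Diff') auto
    also have "B \<inter> (C \<union> E) = (B \<inter> C) \<union> (B \<inter> E)" by auto
    also have "prob \<dots> = prob (B \<inter> C) + prob (B \<inter> E) - prob ((B \<inter> C) \<inter> (B \<inter> E))"
      by (rule measure_Un3) (auto simp: fmeasurable_eq_sets)
    also have "(B \<inter> C) \<inter> (B \<inter> E) = B \<inter> C \<inter> E" by auto
    finally show ?thesis by simp
  qed
  \<comment> \<open>Exceedance at both end points: inclusion-exclusion produces the integral of the
    sum minus the maximum of the two densities, which is their minimum.\<close>
  have ends: "prob (space Q - (A x 0 \<union> A x 1)) = x * \<theta>" if x: "0 \<le> x" "x \<le> x0" for x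
  proof -
    have "space Q \<inter> A x 0 = A x 0" "space Q \<inter> A x 1 = A x 1" by (auto simp: A_def)
    then have "prob (space Q - (A x 0 \<union> A x 1))
        = prob (space Q) - prob (A x 0) - prob (A x 1) + prob (A x 0 \<inter> A x 1)"
      using inc_exc[of "space Q" "A x 0" "A x 1"] by simp
    also have "\<dots> = x * (2 - (LINT s|lborel. max (?g 0 s) (?g 1 s)))"
      using A1[OF x, of 0] A1[OF x, of 1] A2[OF x, of 0 1] by (simp add: prob_space algebra_simps)
    also have "2 - (LINT s|lborel. max (?g 0 s) (?g 1 s)) = (LINT s|lborel. ?g 0 s + ?g 1 s - max (?g 0 s) (?g 1 s))"
      using int[of 0] int[of 1] int1[of 0] int1[of 1] by simp
    also have "\<dots> = (LINT s|lborel. min (\<psi> s) (\<psi> (s - \<beta>)))"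
      by (intro Bochner_Integration.integral_cong) (auto simp: min_def max_def)
    also have "\<dots> = \<theta>" unfolding \<theta>_def by (rule integral_min_shifted_density[OF psi \<beta>])
    finally show ?thesis .
  qed
  have mid: "prob (A x t - (A x 0 \<union> A x 1)) = 0" if x: "0 \<le> x" "x \<le> x0" and t: "t \<in> {0..1}" for x t
  proof -
    \<comment> \<open>Inclusion-exclusion for failing at \<open>t\<close> while exceeding at both
      ends. Since \<open>\<beta> * t\<close> lies between 0 and \<open>\<beta>\<close>, the point
      \<open>s - \<beta> * t\<close> is no farther from 0 than one of \<open>s\<close> and
      \<open>s - \<beta>\<close>, so \<open>?g t s\<close> is at least one of the end values and
      everything cancels.\<close>
    have pt: "?g t s - max (?g t s) (?g 0 s) - max (?g t s) (?g 1 s) + max (?g t s) (max (?g 0 s) (?g 1 s)) = 0" for s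
    proof -
      have "0 \<le> \<beta> * t" "\<beta> * t \<le> \<beta>" using t \<beta> by (auto simp: mult_left_le)
      then have "\<bar>s - \<beta> * t\<bar> \<le> \<bar>s\<bar> \<or> \<bar>s - \<beta> * t\<bar> \<le> \<bar>s - \<beta>\<bar>" by linarith
      then have "?g 0 s \<le> ?g t s \<or> ?g 1 s \<le> ?g t s" using D(5) by auto
      then show ?thesis by (auto simp: max_def)
    qed
    have "prob (A x t - (A x 0 \<union> A x 1)) = prob (A x t) - prob (A x t \<inter> A x 0) - prob (A x t \<inter> A x 1)
        + prob (A x t \<inter> A x 0 \<inter> A x 1)"
      by (rule inc_exc) (use t in auto)
    also have "\<dots> = - x * ((LINT s|lborel. ?g t s) - (LINT s|lborel. max (?g t s) (?g 0 s))
        - (LINT s|lborel. max (?g t s) (?g 1 s)) + (LINT s|lborel. max (?g t s) (max (?g 0 s) (?g 1 s))))"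
      using A1[OF x t] A2[OF x t, of 0] A2[OF x t, of 1] A3[OF x t, of 0 1] by (simp add: int1 algebra_simps)
    also have "\<dots> = - x * (LINT s|lborel. ?g t s - max (?g t s) (?g 0 s) - max (?g t s) (?g 1 s)
        + max (?g t s) (max (?g 0 s) (?g 1 s)))"
      by (subst Bochner_Integration.integral_add Bochner_Integration.integral_diff;
          (intro Bochner_Integration.integrable_diff integrable_max int)?)+ (rule refl)
    also have "\<dots> = 0" unfolding pt by simp
    finally show ?thesis .
  qed
  show thesis
  proof (rule that[OF x0])
    fix x assume x: "0 < x" "x \<le> x0"
    have upper: "prob_gt Q V (\<lambda>_. - x) \<le> x * \<theta>"
    proof -
      have "prob_gt Q V (\<lambda>_. - x) \<le> prob (space Q - (A x 0 \<union> A x 1))"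
        unfolding prob_gt_def by (rule finite_measure_mono) (auto simp: A_def dest: bspec[where x=0] bspec[where x=1])
      then show ?thesis using ends[of x] x by simp
    qed
    \<comment> \<open>Passing from rational to all times preserves only weak inequalities.
      Exceedance is therefore shown at a lower level \<open>y < x\<close>, which gives the strict
      inequality at \<open>x\<close>; then \<open>y\<close> tends to \<open>x\<close>.\<close>
    have lower: "y * \<theta> \<le> prob_gt Q V (\<lambda>_. - x)" if y: "0 < y" "y < x" for y
    proof -
      have "AE \<omega> in Q. \<forall>t\<in>{0..1} \<inter> \<rat>. \<omega> \<notin> A y t - (A y 0 \<union> A y 1)"
      proof (subst AE_ball_countable)
        show "\<forall>t\<in>{0..1} \<inter> \<rat>. AE \<omega> in Q. \<omega> \<notin> A y t - (A y 0 \<union> A y 1)"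
        proof
          fix t :: real assume t: "t \<in> {0..1} \<inter> \<rat>"
          show "AE \<omega> in Q. \<omega> \<notin> A y t - (A y 0 \<union> A y 1)"
          proof (rule AE_not_in)
            show "A y t - (A y 0 \<union> A y 1) \<in> null_sets Q"
              using mid[of y t] t x y by (intro null_setsI) (auto simp: emeasure_eq_measure)
          qed
        qed
      qed (auto intro: countable_Int2 countable_rat)
      then have "prob (space Q - (A y 0 \<union> A y 1)) \<le> prob_gt Q V (\<lambda>_. - x)"
        unfolding prob_gt_def
      proof (intro finite_measure_mono_AE sets_path_gt[OF cp], eventually_elim)
        case (elim \<omega>)
        show ?case
        proof
          assume \<omega>: "\<omega> \<in> space Q - (A y 0 \<union> A y 1)"
          then have "continuous_on {0..1} (\<lambda>t. - V \<omega> t)"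
            using cp by (auto simp: continuous_process_def intro: continuous_intros)
          moreover have "\<forall>t\<in>{0..1} \<inter> \<rat>. - V \<omega> t \<le> y"
          proof
            fix t :: real assume "t \<in> {0..1} \<inter> \<rat>"
            with elim \<omega> have "\<omega> \<notin> A y t" by blast
            with \<omega> show "- V \<omega> t \<le> y" by (simp add: A_def)
          qed
          ultimately have "\<forall>t\<in>{0..1}. - V \<omega> t \<le> y"
            using continuous_unit_le_iff_rationals by blast
          then show "\<omega> \<in> {\<omega>\<in>space Q. \<forall>t\<in>{0..1}. - x < V \<omega> t}"
            using y \<omega> by force
        qed
      qed
      then show ?thesis using ends[of y] x y by simp
    qed
    have "((\<lambda>y. y * \<theta>) \<longlongrightarrow> x * \<theta>) (at_left x)"
      by (intro tendsto_intros)
    moreover have "\<forall>\<^sub>F y in at_left x. y * \<theta> \<le> prob_gt Q V (\<lambda>_. - x)"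
      using eventually_at_left_real[OF x(1)] by eventually_elim (use lower in auto)
    ultimately have "x * \<theta> \<le> prob_gt Q V (\<lambda>_. - x)"
      by (intro tendsto_upperbound) auto
    with upper show "prob_gt Q V (\<lambda>_. - x) = x * (2 * Psi \<psi> (- \<beta> / 2))"
      by (simp add: \<theta>_def)
  qed
qed

section \<open>Likelihood ratio of the point process of exceedances\<close>

text \<open>It suffices to compare on rectangles, where density and indicator both factor over the
  coordinates. Probability measures are required at every index, also outside \<open>I\<close>,
  because both families are interpreted as product probability spaces.\<close>

lemma PiM_density:
  fixes f :: "'i \<Rightarrow> 'a \<Rightarrow> ennreal"
  assumes I: "finite I" and M: "\<And>i. prob_space (M i)" and N: "\<And>i. prob_space (density (M i) (f i))"
    and f[measurable]: "\<And>i. f i \<in> borel_measurable (M i)"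
  shows "PiM I (\<lambda>i. density (M i) (f i)) = density (PiM I M) (\<lambda>x. \<Prod>i\<in>I. f i (x i))"
proof -
  interpret M: product_prob_space M by (simp add: product_prob_space_def product_prob_space_axioms_def product_sigma_finite_def M prob_space_imp_sigma_finite)
  interpret N: product_prob_space "\<lambda>i. density (M i) (f i)"
    by (simp add: product_prob_space_def product_prob_space_axioms_def product_sigma_finite_def N prob_space_imp_sigma_finite)
  have f': "(\<lambda>x. \<Prod>i\<in>I. f i (x i)) \<in> borel_measurable (PiM I M)"
  proof (rule borel_measurable_prod_ennreal)
    fix i assume "i \<in> I"
    from measurable_compose[OF measurable_component_singleton[OF this, of M] f[of i]]
    show "(\<lambda>x. f i (x i)) \<in> borel_measurable (PiM I M)" .
  qed
  show ?thesis
  proof (rule N.PiM_eqI[symmetric, OF I])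
    show "sets (density (PiM I M) (\<lambda>x. \<Prod>i\<in>I. f i (x i))) = sets (PiM I (\<lambda>i. density (M i) (f i)))"
      by (simp cong: sets_PiM_cong)
    fix A assume A: "\<And>i. i \<in> I \<Longrightarrow> A i \<in> sets (density (M i) (f i))"
    then have A': "A i \<in> sets (M i)" if "i \<in> I" for i using that by simp
    have "emeasure (density (PiM I M) (\<lambda>x. \<Prod>i\<in>I. f i (x i))) (Pi\<^sub>E I A)
        = (\<integral>\<^sup>+x. (\<Prod>i\<in>I. f i (x i)) * indicator (Pi\<^sub>E I A) x \<partial>PiM I M)"
      using A' I by (intro emeasure_density f' sets_PiM_I_finite) auto
    also have "\<dots> = (\<integral>\<^sup>+x. (\<Prod>i\<in>I. f i (x i) * indicator (A i) (x i)) \<partial>PiM I M)"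
    proof (rule nn_integral_cong)
      fix x assume x: "x \<in> space (PiM I M)"
      have "indicator (Pi\<^sub>E I A) x = (\<Prod>i\<in>I. indicator (A i) (x i) :: ennreal)"
      proof (cases "\<forall>i\<in>I. x i \<in> A i")
        case True
        then show ?thesis using x by (auto simp: space_PiM PiE_iff)
      next
        case False
        then show ?thesis using I by (auto simp: indicator_def PiE_iff intro!: prod_zero)
      qed
      then show "(\<Prod>i\<in>I. f i (x i)) * indicator (Pi\<^sub>E I A) x = (\<Prod>i\<in>I. f i (x i) * indicator (A i) (x i))"
        by (simp add: prod.distrib)
    qed
    also have "\<dots> = (\<Prod>i\<in>I. \<integral>\<^sup>+x. f i x * indicator (A i) x \<partial>M i)"
      using A' by (intro M.product_nn_integral_prod I) auto
    also have "\<dots> = (\<Prod>i\<in>I. emeasure (density (M i) (f i)) (A i))"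
      using A' by (intro prod.cong) (auto simp: emeasure_density)
    finally show "emeasure (density (PiM I M) (\<lambda>x. \<Prod>i\<in>I. f i (x i))) (Pi\<^sub>E I A)
        = (\<Prod>i\<in>I. emeasure (density (M i) (f i)) (A i))" .
  qed
qed

section \<open>Functionals of point configurations\<close>

lemma space_finite_measure_algebra:
  "space finite_measure_algebra = {\<mu>. finite_measure \<mu> \<and> sets \<mu> = sets borel}"
  unfolding finite_measure_algebra_def by (auto simp: space_Sup_eq_UN)

lemma measurable_emeasure_finite_measure_algebra:
  assumes "B \<in> sets borel"
  shows "(\<lambda>\<mu>. emeasure \<mu> B) \<in> borel_measurable finite_measure_algebra"
  unfolding finite_measure_algebra_def
  by (rule measurable_Sup1[OF imageI[OF assms] measurable_vimage_algebra1]) auto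

text \<open>The density of the law of the point process will be expressed through integrals over the
  configuration. The evaluations cover indicators, and the usual induction extends this to
  nonnegative functions.\<close>

lemma measurable_nn_integral_finite_measure_algebra:
  assumes "f \<in> borel_measurable borel"
  shows "(\<lambda>\<mu>. integral\<^sup>N \<mu> f) \<in> borel_measurable finite_measure_algebra" (is "_ \<in> ?B")
  using assms
proof induct
  case (cong f g)
  then have "f = g" by auto
  with cong show ?case by simp
next
  case (set B)
  have "(\<lambda>\<mu>. integral\<^sup>N \<mu> (indicator B)) \<in> ?B \<longleftrightarrow> (\<lambda>\<mu>. emeasure \<mu> B) \<in> ?B"
    using set by (intro measurable_cong nn_integral_indicator) (simp add: space_finite_measure_algebra)
  with set show ?case by (simp add: measurable_emeasure_finite_measure_algebra)
next
  case (mult f c)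
  have "(\<lambda>\<mu>. \<integral>\<^sup>+x. c * f x \<partial>\<mu>) \<in> ?B \<longleftrightarrow> (\<lambda>\<mu>. c * \<integral>\<^sup>+x. f x \<partial>\<mu>) \<in> ?B"
    using mult by (intro measurable_cong nn_integral_cmult) (auto simp: space_finite_measure_algebra)
  with mult show ?case by simp
next
  case (add f g)
  have "(\<lambda>\<mu>. \<integral>\<^sup>+x. f x + g x \<partial>\<mu>) \<in> ?B \<longleftrightarrow> (\<lambda>\<mu>. (\<integral>\<^sup>+x. f x \<partial>\<mu>) + (\<integral>\<^sup>+x. g x \<partial>\<mu>)) \<in> ?B"
    using add by (intro measurable_cong nn_integral_add) (auto simp: space_finite_measure_algebra)
  with add show ?case by (simp add: ac_simps)
next
  case (seq F)
  then have "(\<lambda>\<mu>. \<integral>\<^sup>+x. (SUP i. F i) x \<partial>\<mu>) \<in> ?B \<longleftrightarrow> (\<lambda>\<mu>. SUP i. (\<integral>\<^sup>+x. F i x \<partial>\<mu>)) \<in> ?B"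
    unfolding SUP_apply
    by (intro measurable_cong nn_integral_monotone_convergence_SUP) (auto simp: space_finite_measure_algebra)
  with seq show ?case by (simp add: ac_simps)
qed

text \<open>As an image of counting measure on finitely many indices, the configuration integrates
  functions by finite sums and counts repeated values with multiplicity.\<close>

lemma exceedance_process_eq_distr:
  "exceedance_process Xs n c \<omega> =
     distr (count_space {i\<in>{..<n}. sup_ratio Xs c i \<omega> \<in> {0..<1}}) borel (\<lambda>i. sup_ratio Xs c i \<omega>)"
proof (rule measure_eqI)
  fix B :: "real set" assume "B \<in> sets (exceedance_process Xs n c \<omega>)"
  then have B: "B \<in> sets borel" by simp
  let ?I = "{i\<in>{..<n}. sup_ratio Xs c i \<omega> \<in> {0..<1}}"
  have "emeasure (distr (count_space ?I) borel (\<lambda>i. sup_ratio Xs c i \<omega>)) B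
      = emeasure (count_space ?I) ((\<lambda>i. sup_ratio Xs c i \<omega>) -` B \<inter> ?I)"
    using B by (subst emeasure_distr) auto
  also have "\<dots> = of_nat (card ((\<lambda>i. sup_ratio Xs c i \<omega>) -` B \<inter> ?I))"
    by (rule emeasure_count_space_finite) auto
  also have "\<dots> = (\<Sum>i<n. indicator ((\<lambda>i. sup_ratio Xs c i \<omega>) -` B \<inter> ?I) i)"
    by (auto simp: indicator_def sum_of_bool_eq intro!: arg_cong[where f=card])
  also have "\<dots> = (\<Sum>i<n. indicator (B \<inter> {0..<1}) (sup_ratio Xs c i \<omega>))"
    by (intro sum.cong) (auto simp: indicator_def)
  finally show "emeasure (exceedance_process Xs n c \<omega>) B
      = emeasure (distr (count_space ?I) borel (\<lambda>i. sup_ratio Xs c i \<omega>)) B"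
    by (simp add: emeasure_exceedance_process[OF B])
qed simp

lemma nn_integral_exceedance_process:
  assumes [measurable]: "g \<in> borel_measurable borel" and g: "\<And>u. u \<notin> {0..<1} \<Longrightarrow> g u = 0"
  shows "(\<integral>\<^sup>+u. g u \<partial>exceedance_process Xs n c \<omega>) = (\<Sum>i<n. g (sup_ratio Xs c i \<omega>))"
proof -
  let ?I = "{i\<in>{..<n}. sup_ratio Xs c i \<omega> \<in> {0..<1}}"
  have "(\<integral>\<^sup>+u. g u \<partial>exceedance_process Xs n c \<omega>) = (\<integral>\<^sup>+i. g (sup_ratio Xs c i \<omega>) \<partial>count_space ?I)"
    unfolding exceedance_process_eq_distr by (subst nn_integral_distr) auto
  also have "\<dots> = (\<Sum>i\<in>?I. g (sup_ratio Xs c i \<omega>))"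
    by (rule nn_integral_count_space_finite) simp
  also have "\<dots> = (\<Sum>i<n. g (sup_ratio Xs c i \<omega>))"
    by (rule sum.mono_neutral_left) (use g in auto)
  finally show ?thesis .
qed

lemma exceedance_process_cong:
  assumes "\<And>i B. i < n \<Longrightarrow> B \<in> sets borel \<Longrightarrow>
    indicator (B \<inter> {0..<1}) (sup_ratio Xs c i \<omega>) = (indicator (B \<inter> {0..<1}) (sup_ratio Ys d i \<omega>') :: ennreal)"
  shows "exceedance_process Xs n c \<omega> = exceedance_process Ys n d \<omega>'"
  by (rule measure_eqI) (auto simp: emeasure_exceedance_process assms intro!: sum.cong)

text \<open>
  The observations above the threshold are invisible in the point process, so both laws are
  images of the laws of the clipped sample \<open>min (U i) 1\<close>.  A sample point is regarded as
  a process that is constant in time; this turns \<^const>\<open>exceedance_process\<close> itself into the map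
  from the sample to the configuration.
\<close>

lemma RN_deriv_exceedance_law:
  fixes U :: "nat \<Rightarrow> 'a \<Rightarrow> real" and \<phi> :: "real \<Rightarrow> real"
  assumes n: "n > 0" and M0: "prob_space M0" and M1: "prob_space M1"
    and U0: "\<forall>\<omega>\<in>space M0. \<forall>i. sup_ratio Xs c i \<omega> = U i \<omega>"
    and U1: "\<forall>\<omega>\<in>space M1. \<forall>i. sup_ratio Xs c i \<omega> = U i \<omega>"
    and indep0: "prob_space.indep_vars M0 (\<lambda>_. borel) U {..<n}"
    and indep1: "prob_space.indep_vars M1 (\<lambda>_. borel) U {..<n}"
    and \<phi>[measurable]: "\<phi> \<in> borel_measurable borel" and \<phi>_pos: "\<And>u. \<phi> u > 0"
    and \<phi>_out: "\<And>u. u \<notin> {0..<1} \<Longrightarrow> \<phi> u = q"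
    and dens: "\<And>i. i < n \<Longrightarrow> distr M1 borel (\<lambda>\<omega>. min (U i \<omega>) 1) =
        density (distr M0 borel (\<lambda>\<omega>. min (U i \<omega>) 1)) (\<lambda>u. ennreal (\<phi> u))"
  shows "AE \<omega> in M0. RN_deriv (exceedance_law M0 Xs n c) (exceedance_law M1 Xs n c)
      (exceedance_process Xs n c \<omega>) = ennreal (\<Prod>i<n. \<phi> (U i \<omega>))"
proof -
  define S where "S = (\<lambda>i (w :: nat \<Rightarrow> real) (t :: real). w i)"
  define T where "T w = exceedance_process S n 1 w" for w
  have S: "sup_ratio S 1 i w = w i" for i w
    by (simp add: sup_ratio_def S_def)
  define W where "W \<omega> = (\<lambda>i\<in>{..<n}. min (U i \<omega>) 1)" for \<omega>
  have T_meas: "T \<in> measurable (PiM {..<n} (\<lambda>_. borel)) finite_measure_algebra"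
    unfolding T_def by (rule measurable_exceedance_process) (auto simp: S[abs_def] intro: measurable_component_singleton)
  have q: "q > 0" using \<phi>_out[of 1] \<phi>_pos[of 1] by simp
  \<comment> \<open>Dividing by \<open>q\<close>, the value at non-exceedances, makes the logarithm
    vanish outside \<open>{0..<1}\<close>. The sum over the sample thus becomes an integral over the
    visible configuration; the unseen observations are restored by the factor
    \<open>q ^ n\<close>.\<close>
  define a where "a u = ln (\<phi> u / q)" for u
  have [measurable]: "a \<in> borel_measurable borel" unfolding a_def by measurable
  have a_out: "a u = 0" if "u \<notin> {0..<1}" for u using \<phi>_out[OF that] q by (simp add: a_def)
  \<comment> \<open>The product of the \<open>\<phi> (w i)\<close> written as a function of the
    configuration alone. Since \<open>ennreal\<close> truncates negative numbers to 0, the two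
    integrals are those of the positive and the negative part of \<open>a\<close>.\<close>
  define G where "G \<mu> = ennreal (q ^ n * exp (enn2real (\<integral>\<^sup>+u. ennreal (a u) \<partial>\<mu>) - enn2real (\<integral>\<^sup>+u. ennreal (- a u) \<partial>\<mu>)))" for \<mu>
  have G_meas: "G \<in> borel_measurable finite_measure_algebra"
    unfolding G_def
    by (intro measurable_compose[OF _ measurable_ennreal] borel_measurable_times borel_measurable_const
        borel_measurable_exp[THEN measurable_compose[rotated]] borel_measurable_diff
        measurable_compose[OF measurable_nn_integral_finite_measure_algebra borel_measurable_enn2real]) measurable
  have G_T: "G (T w) = (\<Prod>i<n. ennreal (\<phi> (w i)))" for w
  proof -
    have pos: "(\<integral>\<^sup>+u. ennreal (b u) \<partial>T w) = ennreal (\<Sum>i<n. max 0 (b (w i)))"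
      if b: "b = a \<or> b = (\<lambda>u. - a u)" for b
    proof -
      have "(\<integral>\<^sup>+u. ennreal (b u) \<partial>T w) = (\<Sum>i<n. ennreal (b (w i)))"
        unfolding T_def by (subst nn_integral_exceedance_process) (use b a_out in \<open>auto simp: S\<close>)
      also have "\<dots> = (\<Sum>i<n. ennreal (max 0 (b (w i))))"
        by (intro sum.cong) (auto simp: ennreal_neg max_def)
      finally show ?thesis by (simp only: sum_ennreal max.cobounded1)
    qed
    have "G (T w) = ennreal (q ^ n * exp ((\<Sum>i<n. max 0 (a (w i))) - (\<Sum>i<n. max 0 (- a (w i)))))"
      unfolding G_def pos[OF disjI1[OF refl]] pos[OF disjI2[OF refl]] by (simp add: sum_nonneg)
    also have "(\<Sum>i<n. max 0 (a (w i))) - (\<Sum>i<n. max 0 (- a (w i))) = (\<Sum>i<n. a (w i))"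
      by (subst sum_subtractf[symmetric]) (auto intro!: sum.cong)
    also have "exp (\<Sum>i<n. a (w i)) = (\<Prod>i<n. \<phi> (w i) / q)"
      using \<phi>_pos q by (simp add: exp_sum a_def)
    also have "q ^ n * (\<Prod>i<n. \<phi> (w i) / q) = (\<Prod>i<n. \<phi> (w i))"
      using q by (simp add: prod_dividef)
    also have "ennreal (\<Prod>i<n. \<phi> (w i)) = (\<Prod>i<n. ennreal (\<phi> (w i)))"
      using \<phi>_pos by (simp add: prod_ennreal less_imp_le)
    finally show ?thesis .
  qed
  \<comment> \<open>Clipping moves points only from beyond 1 to 1, which is outside
    \<open>{0..<1}\<close> as well.\<close>
  have T_W: "T (W \<omega>) = exceedance_process Xs n c \<omega>" if "\<And>i. sup_ratio Xs c i \<omega> = U i \<omega>" for \<omega>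
    unfolding T_def
    by (rule exceedance_process_cong) (auto simp: S W_def that indicator_def min_def)

  have law: "exceedance_law M Xs n c = distr (PiM {..<n} (\<lambda>i. distr M borel (\<lambda>\<omega>. min (U i \<omega>) 1))) finite_measure_algebra T"
    if "prob_space M" and U: "\<forall>\<omega>\<in>space M. \<forall>i. sup_ratio Xs c i \<omega> = U i \<omega>"
      and indep: "prob_space.indep_vars M (\<lambda>_. borel) U {..<n}" for M
  proof -
    interpret prob_space M by fact
    have indep': "indep_vars (\<lambda>_. borel) (\<lambda>i \<omega>. min (U i \<omega>) 1) {..<n}"
      by (rule indep_vars_compose2[OF indep]) auto
    have rv: "(\<lambda>\<omega>. min (U i \<omega>) 1) \<in> borel_measurable M" if "i \<in> {..<n}" for i
      using indep' that unfolding indep_vars_def by auto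
    have W: "distr M (PiM {..<n} (\<lambda>_. borel)) W = PiM {..<n} (\<lambda>i. distr M borel (\<lambda>\<omega>. min (U i \<omega>) 1))"
      unfolding W_def using indep' rv n by (subst (asm) indep_vars_iff_distr_eq_PiM') auto
    have W_meas: "W \<in> measurable M (PiM {..<n} (\<lambda>_. borel))"
      unfolding W_def using rv by (intro measurable_restrict) auto
    have "exceedance_law M Xs n c = distr M finite_measure_algebra (T \<circ> W)"
      unfolding exceedance_law_def by (intro distr_cong refl) (use U in \<open>simp add: T_W\<close>)
    also have "\<dots> = distr (distr M (PiM {..<n} (\<lambda>_. borel)) W) finite_measure_algebra T"
      by (rule distr_distr[OF T_meas W_meas, symmetric])
    finally show ?thesis unfolding W .
  qed
  \<comment> \<open>Beyond the sample size a point mass with density 1 fills the family, as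
    \<open>PiM_density\<close> asks for probability measures at all indices.\<close>
  define \<mu> where "\<mu> i = (if i < n then distr M0 borel (\<lambda>\<omega>. min (U i \<omega>) 1) else return borel 0)" for i
  define f where "f i u = (if i < n then ennreal (\<phi> u) else 1)" for i u
  interpret M0: prob_space M0 by fact
  interpret M1: prob_space M1 by fact
  have rv: "U i \<in> borel_measurable M0" "U i \<in> borel_measurable M1" if "i < n" for i
    using indep0 indep1 that unfolding M0.indep_vars_def M1.indep_vars_def by auto
  have sets_\<mu>: "sets (\<mu> i) = sets borel" for i by (simp add: \<mu>_def)
  have \<mu>: "prob_space (\<mu> i)" for i
    using rv by (auto simp: \<mu>_def intro!: M0.prob_space_distr prob_space_return)
  have f_meas: "f i \<in> borel_measurable (\<mu> i)" for i
    unfolding measurable_cong_sets[OF sets_\<mu> refl] f_def[abs_def] by (cases "i < n") auto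
  have \<mu>f: "density (\<mu> i) (f i) = distr M1 borel (\<lambda>\<omega>. min (U i \<omega>) 1)" if "i < n" for i
    using dens[OF that] that by (simp add: \<mu>_def f_def[abs_def])
  have \<mu>f_prob: "prob_space (density (\<mu> i) (f i))" for i
  proof (cases "i < n")
    case True
    then show ?thesis unfolding \<mu>f[OF True] using rv by (auto intro!: M1.prob_space_distr)
  next
    case False
    then have "f i = (\<lambda>_. 1)" by (simp add: f_def fun_eq_iff)
    then show ?thesis using \<mu>[of i] by (simp add: density_1)
  qed
  have PiM1: "PiM {..<n} (\<lambda>i. distr M1 borel (\<lambda>\<omega>. min (U i \<omega>) 1))
      = density (PiM {..<n} \<mu>) (\<lambda>w. \<Prod>i<n. f i (w i))"
    unfolding PiM_density[OF finite_lessThan \<mu> \<mu>f_prob f_meas, symmetric]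
    by (intro PiM_cong) (auto simp: \<mu>f)
  have PiM0: "PiM {..<n} (\<lambda>i. distr M0 borel (\<lambda>\<omega>. min (U i \<omega>) 1)) = PiM {..<n} \<mu>"
    by (intro PiM_cong) (auto simp: \<mu>_def)
  have T_meas': "T \<in> measurable (PiM {..<n} \<mu>) finite_measure_algebra"
    using T_meas sets_PiM_cong[of "{..<n}" "{..<n}" \<mu> "\<lambda>_. borel", OF refl sets_\<mu>]
    by (simp cong: measurable_cong_sets)
  \<comment> \<open>Sufficiency of the configuration: the density of the sample laws factors through
    \<open>T\<close>, so \<open>G\<close> is the density of the image laws.\<close>
  have fG: "(\<lambda>w. \<Prod>i<n. f i (w i)) = (\<lambda>w. G (T w))"
    unfolding G_T by (auto simp: f_def intro!: prod.cong)
  have eq: "density (exceedance_law M0 Xs n c) G = exceedance_law M1 Xs n c"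
    unfolding law[OF M0 U0 indep0] law[OF M1 U1 indep1] PiM0 PiM1 fG
    by (rule density_distr[OF G_meas T_meas'])
  have exc: "exceedance_process Xs n c \<in> measurable M0 finite_measure_algebra"
  proof (rule measurable_exceedance_process)
    show "sup_ratio Xs c i \<in> borel_measurable M0" if "i < n" for i
      using rv(1)[OF that] by (rule measurable_cong[THEN iffD1, rotated]) (simp add: U0)
  qed
  interpret L: prob_space "exceedance_law M0 Xs n c"
    unfolding exceedance_law_def by (rule M0.prob_space_distr[OF exc])
  have "AE \<mu> in exceedance_law M0 Xs n c. G \<mu> = RN_deriv (exceedance_law M0 Xs n c) (exceedance_law M1 Xs n c) \<mu>"
    by (rule L.RN_deriv_unique[OF _ eq]) (simp add: exceedance_law_def G_meas)
  then have "AE \<omega> in M0. G (exceedance_process Xs n c \<omega>)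
      = RN_deriv (exceedance_law M0 Xs n c) (exceedance_law M1 Xs n c) (exceedance_process Xs n c \<omega>)"
    unfolding exceedance_law_def by (rule AE_distrD[OF exc])
  then show ?thesis
  proof (rule AE_mp, intro AE_I2 impI)
    fix \<omega> assume \<omega>: "\<omega> \<in> space M0"
      and RN: "G (exceedance_process Xs n c \<omega>)
        = RN_deriv (exceedance_law M0 Xs n c) (exceedance_law M1 Xs n c) (exceedance_process Xs n c \<omega>)"
    have "\<phi> (W \<omega> i) = \<phi> (U i \<omega>)" if "i < n" for i
      using that \<phi>_out[of "U i \<omega>"] \<phi>_out[of 1] by (simp add: W_def min_def)
    then have "G (exceedance_process Xs n c \<omega>) = (\<Prod>i<n. ennreal (\<phi> (U i \<omega>)))"
      using T_W[of \<omega>] U0 \<omega> G_T[of "W \<omega>"] by simp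
    then show "RN_deriv (exceedance_law M0 Xs n c) (exceedance_law M1 Xs n c) (exceedance_process Xs n c \<omega>)
        = ennreal (\<Prod>i<n. \<phi> (U i \<omega>))"
      using RN \<phi>_pos by (simp add: prod_ennreal less_imp_le)
  qed
qed

section \<open>Law of the clipped supremum\<close>

lemma open_interval_approx:
  fixes a b :: real
  assumes "a < b"
  obtains A B :: "nat \<Rightarrow> real" where "\<And>k. a < A k" "\<And>k. A k \<le> B k" "\<And>k. B k < b"
    "incseq (\<lambda>k. {A k..<B k})" "(\<Union>k. {A k..<B k}) = {a<..<b}"
proof
  \<comment> \<open>The denominator starts at 2, so the two margins fit into the interval already
    for \<open>k = 0\<close>.\<close>
  define d where "d k = (b - a) / (real k + 2)" for k :: nat
  have d: "0 < d k" "2 * d k \<le> b - a" for k using assms by (auto simp: d_def field_simps intro!: mult_right_mono)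
  have d_mono: "d (Suc k) \<le> d k" for k using assms by (auto simp: d_def intro!: divide_left_mono)
  show "a < a + d k" "a + d k \<le> b - d k" "b - d k < b" for k using d[of k] by auto
  show "incseq (\<lambda>k. {a + d k..<b - d k})"
  proof (rule incseq_SucI)
    show "{a + d k..<b - d k} \<subseteq> {a + d (Suc k)..<b - d (Suc k)}" for k
      using d_mono[of k] by auto
  qed
  have d0: "d \<longlonglongrightarrow> 0" unfolding d_def by real_asymp
  show "(\<Union>k. {a + d k..<b - d k}) = {a<..<b}"
  proof (intro equalityI subsetI)
    fix x assume x: "x \<in> {a<..<b}"
    then have "0 < min (x - a) (b - x)" by auto
    from order_tendstoD(2)[OF d0 this] obtain k where "d k < min (x - a) (b - x)"
      by (auto simp: eventually_sequentially)
    then show "x \<in> (\<Union>k. {a + d k..<b - d k})" by (intro UN_I[of k]) auto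
  next
    fix x assume "x \<in> (\<Union>k. {a + d k..<b - d k})"
    then show "x \<in> {a<..<b}" using d by (auto, (smt (verit) d)+)
  qed
qed

text \<open>A monotone function that is differentiable everywhere on the open unit interval is, on
  compact subintervals, the integral of its derivative; so the law has no singular part there. All
  mass beyond 1 collapses to an atom at 1, and the limit \<open>F0\<close> removes the mass at and
  below 0.\<close>

lemma clipped_law:
  fixes U :: "'a \<Rightarrow> real" and F :: "real \<Rightarrow> real"
  assumes M: "prob_space M" and U[measurable]: "U \<in> borel_measurable M"
    and F_def: "\<And>u. F u = measure M {\<omega>\<in>space M. U \<omega> < u}"
  defines "\<mu> \<equiv> distr M borel (\<lambda>\<omega>. min (U \<omega>) 1)"
  defines "f \<equiv> \<lambda>s. indicator {0<..<1} s * deriv F s"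
  assumes diff: "\<forall>s\<in>{0<..<1}. F differentiable (at s)"
    and F0: "(F \<longlongrightarrow> 0) (at_right 0)"
  shows "f \<in> borel_measurable borel" "\<And>s. 0 \<le> f s"
    and "density \<mu> (indicator {0<..<1}) = density lborel (\<lambda>s. ennreal (f s))"
    and "emeasure \<mu> {1} = ennreal (1 - F 1)"
    and "emeasure \<mu> (- {0<..1}) = 0"
proof -
  interpret prob_space M by fact
  have mono: "mono F"
    unfolding F_def by (rule monoI) (auto intro!: finite_measure_mono)
  have F_meas[measurable]: "F \<in> borel_measurable borel"
    by (rule borel_measurable_mono[OF mono])
  have DF: "(F has_real_derivative deriv F s) (at s)" if "s \<in> {0<..<1}" for s
    using diff that by (simp add: DERIV_deriv_iff_real_differentiable)
  have lim: "(\<lambda>k. indicator {0<..<1} s * ((F (s + 1 / real (Suc k)) - F s) / (1 / real (Suc k)))) \<longlonglongrightarrow> f s" for s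
  proof (cases "s \<in> {0<..<1}")
    case True
    have "filterlim (\<lambda>k. 1 / real (Suc k)) (at 0) sequentially"
      using LIMSEQ_Suc[OF lim_1_over_n] by (simp add: filterlim_at)
    from filterlim_compose[OF DF[OF True, unfolded DERIV_def] this] True show ?thesis
      by (simp add: f_def)
  qed (simp add: f_def)
  show f_meas: "f \<in> borel_measurable borel"
    by (rule borel_measurable_LIMSEQ_real[OF lim]) measurable
  show f_nn: "0 \<le> f s" for s
    by (rule LIMSEQ_le_const[OF lim]) (auto intro!: exI mult_nonneg_nonneg divide_nonneg_nonneg monoD[OF mono])
  have [simp]: "sets \<mu> = sets borel" "space \<mu> = UNIV" by (auto simp: \<mu>_def)
  have \<mu>_eq: "emeasure \<mu> B = emeasure M {\<omega>\<in>space M. min (U \<omega>) 1 \<in> B}" if "B \<in> sets borel" for B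
    unfolding \<mu>_def using that by (subst emeasure_distr) (auto intro!: arg_cong[where f="emeasure M"])
  have ind: "(indicator {0<..<1} :: real \<Rightarrow> ennreal) \<in> borel_measurable \<mu>"
    by (rule borel_measurable_indicator) simp
  have \<mu>: "prob_space \<mu>" unfolding \<mu>_def by (rule prob_space_distr) auto
  \<comment> \<open>\<open>F\<close> is defined by a strict inequality, so \<open>F b - F a\<close>
    is exactly the mass of the half-open interval. Keeping \<open>a\<close> and \<open>b\<close>
    strictly inside the unit interval makes the fundamental theorem applicable on
    \<open>{a..b}\<close>; exhaustion by such intervals follows.\<close>
  have ico: "emeasure \<mu> {a..<b} = emeasure (density lborel (\<lambda>s. ennreal (f s))) {a..<b}"
    if ab: "0 < a" "a \<le> b" "b < 1" for a b
  proof -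
    have "emeasure \<mu> {a..<b} = emeasure M ({\<omega>\<in>space M. U \<omega> < b} - {\<omega>\<in>space M. U \<omega> < a})"
      using ab by (subst \<mu>_eq) (auto intro!: arg_cong[where f="emeasure M"])
    also have "\<dots> = ennreal (F b - F a)"
      unfolding emeasure_eq_measure F_def using ab by (subst finite_measure_Diff) auto
    also have "\<dots> = (\<integral>\<^sup>+s. ennreal (f s) * indicator {a..b} s \<partial>lborel)"
    proof (rule nn_integral_FTC_Icc[symmetric])
      show "(F has_real_derivative f s) (at s)" if "s \<in> {a..b}" for s
        using DF[of s] that ab by (simp add: f_def)
    qed (use f_nn f_meas ab in auto)
    also have "\<dots> = (\<integral>\<^sup>+s. ennreal (f s) * indicator {a..<b} s \<partial>lborel)"
      by (intro nn_integral_cong_AE, use AE_lborel_singleton[of b] in eventually_elim) (auto simp: indicator_def)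
    also have "\<dots> = emeasure (density lborel (\<lambda>s. ennreal (f s))) {a..<b}"
      using f_meas by (subst emeasure_density) auto
    finally show ?thesis .
  qed
  have ioo: "emeasure \<mu> {a<..<1} = emeasure (density lborel (\<lambda>s. ennreal (f s))) {a<..<1}" if a: "0 \<le> a" "a < 1" for a
  proof -
    obtain A B :: "nat \<Rightarrow> real" where AB: "\<And>k. a < A k" "\<And>k. A k \<le> B k" "\<And>k. B k < 1"
      "incseq (\<lambda>k. {A k..<B k})" "(\<Union>k. {A k..<B k}) = {a<..<1}"
      by (rule open_interval_approx[OF a(2)]) blast
    have "emeasure \<mu> {a<..<1} = (SUP k. emeasure \<mu> {A k..<B k})"
      using SUP_emeasure_incseq[of "\<lambda>k. {A k..<B k}" \<mu>] AB(4,5) by (simp add: image_subset_iff)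
    also have "\<dots> = (SUP k. emeasure (density lborel (\<lambda>s. ennreal (f s))) {A k..<B k})"
      using AB(2,3) by (intro SUP_cong refl ico le_less_trans[OF a(1) AB(1)]) auto
    also have "\<dots> = emeasure (density lborel (\<lambda>s. ennreal (f s))) {a<..<1}"
      using SUP_emeasure_incseq[of "\<lambda>k. {A k..<B k}" "density lborel (\<lambda>s. ennreal (f s))"] AB(4,5) by (simp add: image_subset_iff)
    finally show ?thesis .
  qed
  have gt: "emeasure (density \<mu> (indicator {0<..<1})) {x<..} = emeasure (density lborel (\<lambda>s. ennreal (f s))) {x<..}" for x
  proof -
    have 1: "emeasure (density \<mu> (indicator {0<..<1})) {x<..} = emeasure \<mu> {max 0 x<..<1}"
    proof -
      have "emeasure (density \<mu> (indicator {0<..<1})) {x<..} = (\<integral>\<^sup>+u. indicator {0<..<1} u * indicator {x<..} u \<partial>\<mu>)"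
        by (rule emeasure_density[OF ind]) simp
      also have "\<dots> = (\<integral>\<^sup>+u. indicator {max 0 x<..<1} u \<partial>\<mu>)"
        by (intro nn_integral_cong) (auto simp: indicator_def)
      finally show ?thesis by simp
    qed
    have 2: "emeasure (density lborel (\<lambda>s. ennreal (f s))) {x<..} = emeasure (density lborel (\<lambda>s. ennreal (f s))) {max 0 x<..<1}"
      using f_meas by (simp add: emeasure_density) (auto intro!: nn_integral_cong simp: indicator_def f_def)
    show ?thesis
      unfolding 1 2 using ioo[of "max 0 x"] by (cases "max 0 x < 1") auto
  qed
  show "density \<mu> (indicator {0<..<1}) = density lborel (\<lambda>s. ennreal (f s))"
  proof (rule measure_eqI_lessThan[OF _ _ _ gt])
    fix x
    have "emeasure (density \<mu> (indicator {0<..<1})) {x<..} = (\<integral>\<^sup>+u. indicator {0<..<1} u * indicator {x<..} u \<partial>\<mu>)"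
      by (rule emeasure_density[OF ind]) simp
    also have "\<dots> \<le> (\<integral>\<^sup>+u. 1 \<partial>\<mu>)"
      by (intro nn_integral_mono) (auto simp: indicator_def)
    also have "\<dots> = 1" using prob_space.emeasure_space_1[OF \<mu>] by simp
    finally show "emeasure (density \<mu> (indicator {0<..<1})) {x<..} < \<infinity>"
      by (rule le_less_trans) simp
  qed auto
  have "emeasure \<mu> {1} = emeasure M (space M - {\<omega>\<in>space M. U \<omega> < 1})"
    by (subst \<mu>_eq) (auto intro!: arg_cong[where f="emeasure M"])
  also have "\<dots> = ennreal (1 - F 1)"
    unfolding emeasure_eq_measure F_def by (subst prob_compl) auto
  finally show "emeasure \<mu> {1} = ennreal (1 - F 1)" .
  have "prob {\<omega>\<in>space M. U \<omega> \<le> 0} \<le> 0"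
  proof (rule tendsto_lowerbound[OF F0])
    show "\<forall>\<^sub>F u in at_right 0. prob {\<omega>\<in>space M. U \<omega> \<le> 0} \<le> F u"
      using eventually_at_right_less[of 0]
      by eventually_elim (auto simp: F_def intro!: finite_measure_mono)
  qed simp
  then have "emeasure M {\<omega>\<in>space M. U \<omega> \<le> 0} = 0"
    by (simp add: emeasure_eq_measure measure_le_0_iff)
  moreover have "{\<omega>\<in>space M. min (U \<omega>) 1 \<in> - {0<..1}} = {\<omega>\<in>space M. U \<omega> \<le> 0}" by auto
  ultimately show "emeasure \<mu> (- {0<..1}) = 0"
    by (subst \<mu>_eq) auto
qed

text \<open>On the open interval the density is the quotient of two Lebesgue densities, at 1 the
  quotient of two atoms. Both laws are carried by \<open>{0<..1}\<close>, so \<open>\<phi>\<close>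
  is free elsewhere; different versions are chosen below according to need.\<close>

lemma clipped_law_density:
  fixes U :: "'a \<Rightarrow> real" and F0 F1 :: "real \<Rightarrow> real"
  assumes M0: "prob_space M0" and M1: "prob_space M1"
    and U0: "U \<in> borel_measurable M0" and U1: "U \<in> borel_measurable M1"
    and F0_def: "\<And>u. F0 u = measure M0 {\<omega>\<in>space M0. U \<omega> < u}"
    and F1_def: "\<And>u. F1 u = measure M1 {\<omega>\<in>space M1. U \<omega> < u}"
    and diff: "\<forall>s\<in>{0<..<1}. F0 differentiable (at s)" "\<forall>s\<in>{0<..<1}. F1 differentiable (at s)"
    and lim: "(F0 \<longlongrightarrow> 0) (at_right 0)" "(F1 \<longlongrightarrow> 0) (at_right 0)"
    and nz: "\<forall>s\<in>{0<..<1}. deriv F0 s \<noteq> 0"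
    and lt: "F0 1 < 1"
    and \<phi>[measurable]: "\<phi> \<in> borel_measurable borel"
    and \<phi>_in: "\<And>u. u \<in> {0<..<1} \<Longrightarrow> \<phi> u = deriv F1 u / deriv F0 u"
    and \<phi>_1: "\<phi> 1 = (1 - F1 1) / (1 - F0 1)"
  shows "distr M1 borel (\<lambda>\<omega>. min (U \<omega>) 1) = density (distr M0 borel (\<lambda>\<omega>. min (U \<omega>) 1)) (\<lambda>u. ennreal (\<phi> u))"
    and "ennreal (F1 1) = (\<integral>\<^sup>+u. ennreal (\<phi> u) * indicator {0<..<1} u \<partial>distr M0 borel (\<lambda>\<omega>. min (U \<omega>) 1))"
proof -
  define \<mu>0 where "\<mu>0 = distr M0 borel (\<lambda>\<omega>. min (U \<omega>) 1)"
  define \<mu>1 where "\<mu>1 = distr M1 borel (\<lambda>\<omega>. min (U \<omega>) 1)"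
  define f0 where "f0 s = indicator {0<..<1} s * deriv F0 s" for s
  define f1 where "f1 s = indicator {0<..<1} s * deriv F1 s" for s
  note c0 = clipped_law[OF M0 U0 F0_def diff(1) lim(1), folded \<mu>0_def f0_def]
  note c1 = clipped_law[OF M1 U1 F1_def diff(2) lim(2), folded \<mu>1_def f1_def]
  note [measurable] = c0(1) c1(1)
  have [simp]: "sets \<mu>0 = sets borel" "sets \<mu>1 = sets borel" by (auto simp: \<mu>0_def \<mu>1_def)
  have meas_eq: "borel_measurable \<mu>0 = borel_measurable borel" "borel_measurable \<mu>1 = borel_measurable borel"
    by (auto intro!: measurable_cong_sets)
  have split: "integral\<^sup>N \<mu> g = (\<integral>\<^sup>+u. indicator {0<..<1} u * g u \<partial>\<mu>) + g 1 * emeasure \<mu> {1}"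
    if g: "g \<in> borel_measurable borel" and \<mu>: "sets \<mu> = sets borel" "emeasure \<mu> (- {0<..1}) = 0"
    for g :: "real \<Rightarrow> ennreal" and \<mu>
  proof -
    have m: "borel_measurable \<mu> = borel_measurable borel" using \<mu> by (auto intro!: measurable_cong_sets)
    have "- {0<..1} \<in> null_sets \<mu>" using \<mu> by (intro null_setsI) auto
    then have "AE u in \<mu>. u \<in> {0<..1}" using AE_not_in by fastforce
    then have "integral\<^sup>N \<mu> g = (\<integral>\<^sup>+u. indicator {0<..<1} u * g u + g 1 * indicator {1} u \<partial>\<mu>)"
      by (intro nn_integral_cong_AE, eventually_elim) (auto simp: indicator_def)
    also have "\<dots> = (\<integral>\<^sup>+u. indicator {0<..<1} u * g u \<partial>\<mu>) + g 1 * emeasure \<mu> {1}"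
      using g \<mu> by (subst nn_integral_add) (auto simp: m nn_integral_cmult_indicator)
    finally show ?thesis .
  qed
  have inner: "(\<integral>\<^sup>+u. indicator {0<..<1} u * (ennreal (\<phi> u) * g u) \<partial>\<mu>0) = (\<integral>\<^sup>+u. indicator {0<..<1} u * g u \<partial>\<mu>1)"
    if g[measurable]: "g \<in> borel_measurable borel" for g
  proof -
    have "(\<integral>\<^sup>+u. indicator {0<..<1} u * (ennreal (\<phi> u) * g u) \<partial>\<mu>0)
        = (\<integral>\<^sup>+u. ennreal (\<phi> u) * g u \<partial>density \<mu>0 (indicator {0<..<1}))"
      by (rule nn_integral_density[symmetric]) (auto simp: meas_eq)
    also have "\<dots> = (\<integral>\<^sup>+s. ennreal (f0 s) * (ennreal (\<phi> s) * g s) \<partial>lborel)"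
      unfolding c0(3) by (rule nn_integral_density) auto
    also have "\<dots> = (\<integral>\<^sup>+s. ennreal (f1 s) * g s \<partial>lborel)"
    proof (rule nn_integral_cong)
      fix s
      have "f0 s * \<phi> s = f1 s"
        using \<phi>_in[of s] nz by (cases "s \<in> {0<..<1}") (auto simp: f0_def f1_def)
      then have "ennreal (f0 s) * ennreal (\<phi> s) = ennreal (f1 s)"
        using c0(2)[of s] by (simp flip: ennreal_mult')
      then show "ennreal (f0 s) * (ennreal (\<phi> s) * g s) = ennreal (f1 s) * g s"
        by (simp flip: mult.assoc)
    qed
    also have "\<dots> = (\<integral>\<^sup>+u. g u \<partial>density \<mu>1 (indicator {0<..<1}))"
      unfolding c1(3) by (rule nn_integral_density[symmetric]) auto
    also have "\<dots> = (\<integral>\<^sup>+u. indicator {0<..<1} u * g u \<partial>\<mu>1)"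
      by (rule nn_integral_density) (auto simp: meas_eq)
    finally show ?thesis .
  qed
  have atom: "ennreal (\<phi> 1) * emeasure \<mu>0 {1} = emeasure \<mu>1 {1}"
  proof -
    have "emeasure \<mu>0 {1} = ennreal (1 - F0 1)" "emeasure \<mu>1 {1} = ennreal (1 - F1 1)"
      using c0(4) c1(4) by simp_all
    with lt show ?thesis by (simp add: \<phi>_1 flip: ennreal_mult'')
  qed
  show "\<mu>1 = density \<mu>0 (\<lambda>u. ennreal (\<phi> u))"
  proof (rule measure_eqI)
    fix A assume "A \<in> sets \<mu>1"
    then have A[measurable]: "A \<in> sets borel" by simp
    have "emeasure \<mu>1 A = (\<integral>\<^sup>+u. indicator A u \<partial>\<mu>1)" by simp
    also have "\<dots> = (\<integral>\<^sup>+u. indicator {0<..<1} u * indicator A u \<partial>\<mu>1) + indicator A 1 * emeasure \<mu>1 {1}"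
      by (rule split) (use c1(5) in auto)
    also have "\<dots> = (\<integral>\<^sup>+u. indicator {0<..<1} u * (ennreal (\<phi> u) * indicator A u) \<partial>\<mu>0)
        + (ennreal (\<phi> 1) * indicator A 1) * emeasure \<mu>0 {1}"
      unfolding inner[OF borel_measurable_indicator[OF A]] atom[symmetric] by (simp only: mult_ac)
    also have "\<dots> = (\<integral>\<^sup>+u. ennreal (\<phi> u) * indicator A u \<partial>\<mu>0)"
      by (rule split[symmetric]) (use c0(5) in auto)
    also have "\<dots> = emeasure (density \<mu>0 (\<lambda>u. ennreal (\<phi> u))) A"
      by (rule emeasure_density[symmetric]) (auto simp: meas_eq)
    finally show "emeasure \<mu>1 A = emeasure (density \<mu>0 (\<lambda>u. ennreal (\<phi> u))) A" .
  qed simp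
  interpret M1: prob_space M1 by fact
  have "ennreal (F1 1) = emeasure \<mu>1 {..<1}"
    unfolding F1_def \<mu>1_def using U1
    by (subst emeasure_distr) (auto simp: M1.emeasure_eq_measure intro!: arg_cong[where f=M1.prob])
  also have "\<dots> = (\<integral>\<^sup>+u. indicator {..<1} u \<partial>\<mu>1)" by simp
  also have "\<dots> = (\<integral>\<^sup>+u. indicator {0<..<1} u * indicator {..<1} u \<partial>\<mu>1) + indicator {..<1::real} 1 * emeasure \<mu>1 {1}"
    by (rule split[of "indicator {..<1}" \<mu>1]) (use c1(5) in auto)
  also have "\<dots> = (\<integral>\<^sup>+u. indicator {0<..<1} u * 1 \<partial>\<mu>1)"
    by (auto intro!: nn_integral_cong simp: indicator_def)
  also have "\<dots> = (\<integral>\<^sup>+u. ennreal (\<phi> u) * indicator {0<..<1} u \<partial>\<mu>0)"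
    using inner[of "\<lambda>_. 1"] by (simp add: mult_ac)
  finally show "ennreal (F1 1) = (\<integral>\<^sup>+u. ennreal (\<phi> u) * indicator {0<..<1} u \<partial>\<mu>0)" .
qed

text \<open>Integrates \<open>1 - b \<le> \<phi> \<le> 1 + b\<close> over the exceedances. This
  yields a relative bound on the change of the exceedance probability directly from the quotient of
  derivatives, where (C) would bring in constants depending on the parameter.\<close>

lemma clipped_mass_diff:
  fixes U :: "'a \<Rightarrow> real" and F0 F1 :: "real \<Rightarrow> real"
  assumes M0: "prob_space M0" and M1: "prob_space M1"
    and U0: "U \<in> borel_measurable M0" and U1: "U \<in> borel_measurable M1"
    and F0_def: "\<And>u. F0 u = measure M0 {\<omega>\<in>space M0. U \<omega> < u}"
    and F1_def: "\<And>u. F1 u = measure M1 {\<omega>\<in>space M1. U \<omega> < u}"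
    and diff: "\<forall>s\<in>{0<..<1}. F0 differentiable (at s)" "\<forall>s\<in>{0<..<1}. F1 differentiable (at s)"
    and lim: "(F0 \<longlongrightarrow> 0) (at_right 0)" "(F1 \<longlongrightarrow> 0) (at_right 0)"
    and nz: "\<forall>s\<in>{0<..<1}. deriv F0 s \<noteq> 0"
    and lt: "F0 1 < 1" and b: "0 \<le> b" "b \<le> 1"
    and near: "\<And>s. s \<in> {0<..<1} \<Longrightarrow> \<bar>deriv F1 s / deriv F0 s - 1\<bar> \<le> b"
  shows "\<bar>F1 1 - F0 1\<bar> \<le> b * F0 1"
proof -
  \<comment> \<open>\<open>clipped_law\<close> gives measurability of the derivatives only after
    multiplication by the indicator; inside the interval the indicators are 1.\<close>
  define \<phi> where "\<phi> u = (if u \<in> {0<..<1} then (indicator {0<..<1} u * deriv F1 u) / (indicator {0<..<1} u * deriv F0 u)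
    else (1 - F1 1) / (1 - F0 1))" for u
  note c0 = clipped_law(1)[OF M0 U0 F0_def diff(1) lim(1)]
  note c1 = clipped_law(1)[OF M1 U1 F1_def diff(2) lim(2)]
  have [measurable]: "\<phi> \<in> borel_measurable borel"
    unfolding \<phi>_def using c0 c1 by measurable
  let ?\<mu> = "distr M0 borel (\<lambda>\<omega>. min (U \<omega>) 1)"
  have F1: "ennreal (F1 1) = (\<integral>\<^sup>+u. ennreal (\<phi> u) * indicator {0<..<1} u \<partial>?\<mu>)"
    using clipped_law_density(2)[OF M0 M1 U0 U1 F0_def F1_def diff lim nz lt, of \<phi>]
    by (simp add: \<phi>_def)
  have F0: "ennreal (F0 1) = (\<integral>\<^sup>+u. indicator {0<..<1} u \<partial>?\<mu>)"
    using clipped_law_density(2)[OF M0 M0 U0 U0 F0_def F0_def diff(1) diff(1) lim(1) lim(1) nz lt, of "\<lambda>_. 1"]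
      nz lt by simp
  have mult: "ennreal a * ennreal (F0 1) = (\<integral>\<^sup>+u. ennreal a * indicator {0<..<1} u \<partial>?\<mu>)" for a
    unfolding F0 by (rule nn_integral_cmult[symmetric]) simp
  have in_range: "1 - b \<le> \<phi> u" "\<phi> u \<le> 1 + b" if "u \<in> {0<..<1}" for u
    using near[OF that] that by (auto simp: \<phi>_def abs_le_iff)
  have nn: "0 \<le> F0 1" "0 \<le> F1 1" by (simp_all add: F0_def F1_def)
  have "ennreal (F1 1) \<le> ennreal (1 + b) * ennreal (F0 1)"
    unfolding F1 mult by (intro nn_integral_mono) (use in_range in \<open>auto simp: indicator_def intro!: ennreal_leI\<close>)
  then have "F1 1 \<le> (1 + b) * F0 1"
    using b nn by (subst (asm) ennreal_mult[symmetric]) (simp_all del: ennreal_plus)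
  moreover have "ennreal (1 - b) * ennreal (F0 1) \<le> ennreal (F1 1)"
    unfolding F1 mult by (intro nn_integral_mono) (use in_range in \<open>auto simp: indicator_def intro!: ennreal_leI\<close>)
  then have "(1 - b) * F0 1 \<le> F1 1"
    using b nn by (subst (asm) ennreal_mult[symmetric]) (simp_all del: ennreal_plus)
  ultimately show ?thesis by (simp add: abs_le_iff algebra_simps)
qed

section \<open>Local asymptotic normality\<close>

text \<open>(C) is applied to the single constant function \<open>- \<epsilon>\<close>; a level
  \<open>- y\<close> corresponds to the scaling \<open>c = y / \<epsilon>\<close>, so the
  probability for the Pareto process is exact once \<open>y \<le> x0\<close>. The remainder of order
  o(c^\<delta>) is absorbed by adding 1 to \<open>\<bar>K f\<bar>\<close>.\<close>

lemma process_exceedance_expansion: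
  assumes psi: "symmetric_unimodal_density \<psi>"
    and V: "\<exists>\<beta>>0. \<theta> = 2 * Psi \<psi> (- \<beta> / 2) \<and> standard_GPP \<psi> \<beta> Q V"
    and C: "neighborhood_condition \<delta> M X Q V"
  obtains K where "\<forall>\<^sub>F y in at_right 0. \<bar>prob_gt M X (\<lambda>_. - y) - y * \<theta>\<bar> \<le> K * (y * y powr \<delta>)"
proof -
  obtain \<beta> where \<beta>: "\<beta> > 0" "\<theta> = 2 * Psi \<psi> (- \<beta> / 2)" "standard_GPP \<psi> \<beta> Q V" using V by blast
  obtain x0 where x0: "x0 > 0" "\<And>x. \<lbrakk>0 < x; x \<le> x0\<rbrakk> \<Longrightarrow> prob_gt Q V (\<lambda>_. - x) = x * \<theta>"
    using GPP_exceedance_probability[OF psi \<beta>(3,1)] unfolding \<beta>(2) by blast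
  obtain \<epsilon> K r where \<epsilon>: "\<epsilon> > 0" and r:
    "\<forall>f\<in>Ebar_neg. sup_norm f \<le> \<epsilon> \<longrightarrow> (\<lambda>c. r c f) \<in> o[at_right 0](\<lambda>c. c powr \<delta>) \<and>
      (\<forall>c\<in>{0<..<1}. prob_gt M X (\<lambda>t. c * f t) = prob_gt Q V (\<lambda>t. c * f t) * (1 + c powr \<delta> * K f + r c f))"
    using C unfolding neighborhood_condition_def by blast
  define f :: "real \<Rightarrow> real" where "f = (\<lambda>_. - \<epsilon>)"
  have f: "f \<in> Ebar_neg" "sup_norm f \<le> \<epsilon>"
  proof -
    have "bounded (f ` {0..1})" by (rule bounded_subset[of "{- \<epsilon>}"]) (auto simp: f_def)
    then show "f \<in> Ebar_neg" using \<epsilon> by (simp add: Ebar_neg_def f_def)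
    show "sup_norm f \<le> \<epsilon>" using \<epsilon> by (simp add: sup_norm_def f_def)
  qed
  have lim: "filterlim (\<lambda>y. y / \<epsilon>) (at_right 0) (at_right 0)"
    unfolding filterlim_at
  proof (intro conjI)
    show "\<forall>\<^sub>F y in at_right 0. y / \<epsilon> \<in> {0<..} \<and> y / \<epsilon> \<noteq> 0"
      using eventually_at_right_less[of 0] by eventually_elim (use \<epsilon> in simp)
    have "((\<lambda>y. y / \<epsilon>) \<longlongrightarrow> 0 / \<epsilon>) (at_right 0)"
      by (intro tendsto_intros) (use \<epsilon> in auto)
    then show "((\<lambda>y. y / \<epsilon>) \<longlongrightarrow> 0) (at_right 0)" by simp
  qed
  have "\<forall>\<^sub>F c in at_right 0. norm (r c f) \<le> 1 * norm (c powr \<delta>)"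
    using r f by (intro landau_o.smallD) auto
  then have ev: "\<forall>\<^sub>F y in at_right 0. \<bar>r (y / \<epsilon>) f\<bar> \<le> (y / \<epsilon>) powr \<delta>"
    using filterlim_iff[THEN iffD1, OF lim] by fastforce
  have small: "\<forall>\<^sub>F y in at_right 0. y \<in> {0<..<min \<epsilon> x0}"
    using \<epsilon> x0 by (intro eventually_at_right_real) auto
  show thesis
  proof (rule that)
    show "\<forall>\<^sub>F y in at_right 0. \<bar>prob_gt M X (\<lambda>_. - y) - y * \<theta>\<bar>
        \<le> (\<bar>\<theta>\<bar> * (\<bar>K f\<bar> + 1) / \<epsilon> powr \<delta>) * (y * y powr \<delta>)"
      using ev small
    proof eventually_elim
      case (elim y)
      define c where "c = y / \<epsilon>"
      have c: "c \<in> {0<..<1}" "\<And>t. c * f t = - y" using elim \<epsilon> by (auto simp: c_def f_def)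
      then have "prob_gt M X (\<lambda>_. - y) = prob_gt Q V (\<lambda>_. - y) * (1 + c powr \<delta> * K f + r c f)"
        using r f by fastforce
      also have "prob_gt Q V (\<lambda>_. - y) = y * \<theta>" using elim x0(2)[of y] by auto
      finally have "prob_gt M X (\<lambda>_. - y) - y * \<theta> = y * \<theta> * (c powr \<delta> * K f + r c f)"
        by (simp add: algebra_simps)
      then have "\<bar>prob_gt M X (\<lambda>_. - y) - y * \<theta>\<bar> = y * \<bar>\<theta>\<bar> * \<bar>c powr \<delta> * K f + r c f\<bar>"
        using elim by (simp add: abs_mult)
      also have "\<dots> \<le> y * \<bar>\<theta>\<bar> * (c powr \<delta> * (\<bar>K f\<bar> + 1))"
      proof (intro mult_left_mono)
        have "\<bar>c powr \<delta> * K f + r c f\<bar> \<le> c powr \<delta> * \<bar>K f\<bar> + \<bar>r c f\<bar>"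
          by (rule order_trans[OF abs_triangle_ineq]) (simp add: abs_mult)
        also have "\<dots> \<le> c powr \<delta> * (\<bar>K f\<bar> + 1)"
          using elim(1) by (simp add: c_def distrib_left)
        finally show "\<bar>c powr \<delta> * K f + r c f\<bar> \<le> c powr \<delta> * (\<bar>K f\<bar> + 1)" .
      qed (use elim in auto)
      also have "c powr \<delta> = y powr \<delta> / \<epsilon> powr \<delta>"
        unfolding c_def using elim \<epsilon> by (simp add: powr_divide)
      finally show ?case by (simp add: mult_ac)
    qed
  qed
qed

text \<open>Needed at each parameter separately: it rules out an atom of the supremum at 0, which
  differentiability on the open interval cannot exclude.\<close>

lemma process_exceedance_tendsto_0:
  assumes psi: "symmetric_unimodal_density \<psi>" and \<delta>: "\<delta> > 0"
    and V: "\<exists>\<beta>>0. \<theta> = 2 * Psi \<psi> (- \<beta> / 2) \<and> standard_GPP \<psi> \<beta> Q V"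
    and C: "neighborhood_condition \<delta> M X Q V"
  shows "((\<lambda>y. prob_gt M X (\<lambda>_. - y)) \<longlongrightarrow> 0) (at_right 0)"
proof -
  obtain K where K: "\<forall>\<^sub>F y in at_right 0. \<bar>prob_gt M X (\<lambda>_. - y) - y * \<theta>\<bar> \<le> K * (y * y powr \<delta>)"
    by (rule process_exceedance_expansion[OF psi V C])
  have "((\<lambda>y. y * (\<bar>\<theta>\<bar> + \<bar>K\<bar>)) \<longlongrightarrow> 0 * (\<bar>\<theta>\<bar> + \<bar>K\<bar>)) (at_right (0::real))"
    by (intro tendsto_intros)
  then have 0: "((\<lambda>y. y * (\<bar>\<theta>\<bar> + \<bar>K\<bar>)) \<longlongrightarrow> 0) (at_right (0::real))" by simp
  show ?thesis
  proof (rule Lim_null_comparison[OF _ 0])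
    have "\<forall>\<^sub>F y in at_right 0. y \<in> {0<..<1::real}" by (rule eventually_at_right_real) simp
    with K show "\<forall>\<^sub>F y in at_right 0. norm (prob_gt M X (\<lambda>_. - y)) \<le> y * (\<bar>\<theta>\<bar> + \<bar>K\<bar>)"
    proof eventually_elim
      case (elim y)
      have "y powr \<delta> \<le> 1" using elim \<delta> by (simp add: powr_le1)
      then have "K * (y * y powr \<delta>) \<le> \<bar>K\<bar> * (y * 1)"
        using elim by (intro mult_mono) auto
      moreover have "\<bar>y * \<theta>\<bar> = y * \<bar>\<theta>\<bar>" using elim by (simp add: abs_mult)
      ultimately show ?case
        using elim(1) by (simp add: distrib_left mult.commute)
    qed
  qed
qed

text \<open>A version of \<open>sup_ratio\<close> that factors through the restricted path, so that
  independence and identity of laws carry over from the paths.\<close>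

definition sample_sup :: "(nat \<Rightarrow> 'a \<Rightarrow> real \<Rightarrow> real) \<Rightarrow> real \<Rightarrow> nat \<Rightarrow> 'a \<Rightarrow> real" where
  "sample_sup Xs c i \<omega> = path_sup c (restrict (Xs i \<omega>) {0..1})"

lemma sample_sup:
  assumes X: "nonpos_continuous_process M X" and copies: "independent_copies M X Xs" and c: "c < 0"
  shows "\<forall>\<omega>\<in>space M. \<forall>i. sup_ratio Xs c i \<omega> = sample_sup Xs c i \<omega>"
    and "\<omega> \<in> space M \<Longrightarrow> 0 \<le> sample_sup Xs c i \<omega>"
    and "sample_sup Xs c i \<in> borel_measurable M"
    and "prob_space.indep_vars M (\<lambda>_. borel) (sample_sup Xs c) {..<n}"
    and "measure M {\<omega>\<in>space M. sample_sup Xs c i \<omega> < u} = prob_gt M X (\<lambda>_. u * c)"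
proof -
  have ncp: "nonpos_continuous_process M (Xs i)" for i
    using copies by (simp add: independent_copies_def)
  then have cp: "continuous_process M (Xs i)" for i by (simp add: nonpos_continuous_process_def)
  have cpX: "continuous_process M X" using X by (simp add: nonpos_continuous_process_def)
  interpret prob_space M using cpX by (simp add: continuous_process_def)
  show eq: "\<forall>\<omega>\<in>space M. \<forall>i. sup_ratio Xs c i \<omega> = sample_sup Xs c i \<omega>"
    unfolding sup_ratio_def sample_sup_def
    using cp by (auto simp: path_sup_eq_SUP continuous_process_def)
  show "0 \<le> sample_sup Xs c i \<omega>" if \<omega>: "\<omega> \<in> space M"
  proof -
    have "continuous_on {0..1} (Xs i \<omega>)" using cp \<omega> by (simp add: continuous_process_def)
    from path_SUP_less_iff[OF this c, of 0] have "\<not> sup_ratio Xs c i \<omega> < 0"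
      using ncp \<omega> unfolding sup_ratio_def nonpos_continuous_process_def by (auto intro!: bexI[of _ 0] simp: not_less)
    then show ?thesis using eq \<omega> by (simp add: not_less)
  qed
  have path: "(\<lambda>\<omega>. restrict (Xs i \<omega>) {0..1}) \<in> measurable M (PiM {0..1} (\<lambda>_. borel))" for i
    by (rule measurable_restrict_path[OF cp])
  show "sample_sup Xs c i \<in> borel_measurable M"
    unfolding sample_sup_def[abs_def] by (rule measurable_compose[OF path measurable_path_sup])
  have "indep_vars (\<lambda>_. borel) (\<lambda>i \<omega>. path_sup c (restrict (Xs i \<omega>) {0..1})) UNIV"
    by (rule indep_vars_compose2[where M'="\<lambda>_. PiM {0..1} (\<lambda>_. borel)"
          and X="\<lambda>i \<omega>. restrict (Xs i \<omega>) {0..1}" and Y="\<lambda>_. path_sup c"])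
      (use copies in \<open>auto simp: independent_copies_def\<close>)
  then show "indep_vars (\<lambda>_. borel) (sample_sup Xs c) {..<n}"
    unfolding sample_sup_def[abs_def] by (rule indep_vars_subset) simp
  let ?S = "PiM {0..1} (\<lambda>_. borel) :: (real \<Rightarrow> real) measure"
  have S: "{g\<in>space ?S. path_sup c g < u} \<in> sets ?S" by measurable
  have "measure M {\<omega>\<in>space M. sample_sup Xs c i \<omega> < u}
      = measure (distr M ?S (\<lambda>\<omega>. restrict (Xs i \<omega>) {0..1})) {g\<in>space ?S. path_sup c g < u}"
    using measurable_space[OF path]
    by (subst measure_distr[OF path S]) (auto simp: sample_sup_def intro!: arg_cong[where f=prob])
  also have "distr M ?S (\<lambda>\<omega>. restrict (Xs i \<omega>) {0..1}) = distr M ?S (\<lambda>\<omega>. restrict (X \<omega>) {0..1})"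
    using copies by (simp add: independent_copies_def)
  also have "measure \<dots> {g\<in>space ?S. path_sup c g < u} = measure M {\<omega>\<in>space M. path_sup c (restrict (X \<omega>) {0..1}) < u}"
    using measurable_space[OF measurable_restrict_path[OF cpX]]
    by (subst measure_distr[OF measurable_restrict_path[OF cpX] S]) (auto intro!: arg_cong[where f=prob])
  also have "\<dots> = prob_gt M X (\<lambda>_. u * c)"
    unfolding prob_gt_eq_path_SUP[OF cpX c]
    using cpX by (intro arg_cong[where f=prob]) (auto simp: path_sup_eq_SUP continuous_process_def)
  finally show "measure M {\<omega>\<in>space M. sample_sup Xs c i \<omega> < u} = prob_gt M X (\<lambda>_. u * c)" .
qed

lemma num_exceedances_eq_sum:
  "real (num_exceedances Xs n c \<omega>) = (\<Sum>i<n. indicat_real {..<1} (sup_ratio Xs c i \<omega>))"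
  unfolding num_exceedances_def
  by (auto simp: indicator_def sum_of_bool_eq intro!: arg_cong[where f=card])

lemma measurable_loglik_ratio:
  assumes "\<And>i. i < n \<Longrightarrow> sup_ratio Xs c i \<in> borel_measurable (P \<theta>0)"
  shows "loglik_ratio P Xs n c \<theta> \<theta>0 \<in> borel_measurable (P \<theta>0)"
proof -
  have "RN_deriv (exceedance_law (P \<theta>0) Xs n c) (exceedance_law (P \<theta>) Xs n c) \<in> borel_measurable finite_measure_algebra"
    using borel_measurable_RN_deriv[of "exceedance_law (P \<theta>0) Xs n c" "exceedance_law (P \<theta>) Xs n c"]
    by (simp add: exceedance_law_def)
  from measurable_compose[OF measurable_exceedance_process[OF assms] this]
  show ?thesis unfolding loglik_ratio_def by measurable
qed

text \<open>The value \<open>a\<close> at and below 0 is a free choice, because the law under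
  \<open>\<theta>0\<close> has no mass there. It is kept as a parameter so that the bound below the
  threshold can later be stated for all \<open>u < 1\<close> without exception.\<close>

lemma loglik_ratio_exceedance:
  fixes P :: "real \<Rightarrow> 'a measure" and F0 F1 :: "real \<Rightarrow> real"
  assumes n: "n > 0" and c: "c < 0"
    and X0: "nonpos_continuous_process (P \<theta>0) X" and copies0: "independent_copies (P \<theta>0) X Xs"
    and X1: "nonpos_continuous_process (P \<theta>) X" and copies1: "independent_copies (P \<theta>) X Xs"
    and F0: "\<And>u. F0 u = prob_gt (P \<theta>0) X (\<lambda>_. u * c)"
    and F1: "\<And>u. F1 u = prob_gt (P \<theta>) X (\<lambda>_. u * c)"
    and diff: "\<forall>s\<in>{0<..<1}. F0 differentiable (at s)" "\<forall>s\<in>{0<..<1}. F1 differentiable (at s)"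
    and lim: "(F0 \<longlongrightarrow> 0) (at_right 0)" "(F1 \<longlongrightarrow> 0) (at_right 0)"
    and ratio: "\<forall>s\<in>{0<..<1}. deriv F1 s / deriv F0 s > 0"
    and lt: "F0 1 < 1" "F1 1 < 1" and a: "a > 0"
  defines "\<phi> \<equiv> \<lambda>u. if u \<in> {0<..<1} then deriv F1 u / deriv F0 u
      else if u \<le> 0 then a else (1 - F1 1) / (1 - F0 1)"
  shows "\<phi> \<in> borel_measurable borel"
    and "i < n \<Longrightarrow> (\<integral>\<omega>. \<phi> (sample_sup Xs c i \<omega>) \<partial>P \<theta>0) = 1"
    and "AE \<omega> in P \<theta>0. loglik_ratio P Xs n c \<theta> \<theta>0 \<omega> = (\<Sum>i<n. ln (\<phi> (sample_sup Xs c i \<omega>)))"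
proof -
  let ?U = "sample_sup Xs c"
  note s0 = sample_sup[OF X0 copies0 c] and s1 = sample_sup[OF X1 copies1 c]
  interpret M0: prob_space "P \<theta>0"
    using X0 by (simp add: nonpos_continuous_process_def continuous_process_def)
  interpret M1: prob_space "P \<theta>"
    using X1 by (simp add: nonpos_continuous_process_def continuous_process_def)
  have F0': "F0 u = measure (P \<theta>0) {\<omega>\<in>space (P \<theta>0). ?U j \<omega> < u}"
    and F1': "F1 u = measure (P \<theta>) {\<omega>\<in>space (P \<theta>). ?U j \<omega> < u}" for u j
    using F0 F1 s0(5) s1(5) by simp_all
  \<comment> \<open>With \<open>x / 0 = 0\<close>, a positive quotient implies a nonzero
    denominator.\<close>
  have nz: "\<forall>s\<in>{0<..<1}. deriv F0 s \<noteq> 0" using ratio by fastforce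
  note f0 = clipped_law(1)[OF M0.prob_space_axioms s0(3)[of 0] F0'[of _ 0] diff(1) lim(1)]
  note f1 = clipped_law(1)[OF M1.prob_space_axioms s1(3)[of 0] F1'[of _ 0] diff(2) lim(2)]
  have \<phi>_alt: "\<phi> = (\<lambda>u. if u \<in> {0<..<1} then (indicator {0<..<1} u * deriv F1 u) / (indicator {0<..<1} u * deriv F0 u)
      else if u \<le> 0 then a else (1 - F1 1) / (1 - F0 1))"
    by (auto simp: \<phi>_def fun_eq_iff)
  show \<phi>_meas[measurable]: "\<phi> \<in> borel_measurable borel"
    unfolding \<phi>_alt using f0 f1 by measurable
  define q where "q = (1 - F1 1) / (1 - F0 1)"
  \<comment> \<open>\<open>RN_deriv_exceedance_law\<close> wants a constant value outside
    \<open>{0..<1}\<close>, so negative arguments are reset from \<open>a\<close> to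
    \<open>q\<close>. The paths are nonpositive and the threshold is negative, so the suprema are
    nonnegative and never see the change.\<close>
  define \<phi>' where "\<phi>' u = (if u < 0 then q else \<phi> u)" for u
  have [measurable]: "\<phi>' \<in> borel_measurable borel" unfolding \<phi>'_def by measurable
  have \<phi>_pos: "\<phi> u > 0" for u using ratio lt a by (auto simp: \<phi>_def)
  have \<phi>'_pos: "\<phi>' u > 0" for u using \<phi>_pos lt by (auto simp: \<phi>'_def q_def)
  have \<phi>'_out: "\<phi>' u = q" if "u \<notin> {0..<1}" for u
    using that by (auto simp: \<phi>'_def \<phi>_def q_def)
  have \<phi>'_eq: "\<phi>' (?U i \<omega>) = \<phi> (?U i \<omega>)" if "\<omega> \<in> space (P \<theta>0)" for i \<omega>
    using s0(2)[OF that, of i] by (simp add: \<phi>'_def)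
  have \<phi>'_min: "\<phi>' (min u 1) = \<phi>' u" for u
    using \<phi>'_out[of u] \<phi>'_out[of 1] by (auto simp: min_def)
  have dens: "distr (P \<theta>) borel (\<lambda>\<omega>. min (?U i \<omega>) 1) =
      density (distr (P \<theta>0) borel (\<lambda>\<omega>. min (?U i \<omega>) 1)) (\<lambda>u. ennreal (\<phi>' u))" for i
    by (rule clipped_law_density(1)[OF M0.prob_space_axioms M1.prob_space_axioms s0(3) s1(3) F0' F1' diff lim nz lt(1)])
      (auto simp: \<phi>'_def \<phi>_def)
  show "(\<integral>\<omega>. \<phi> (?U i \<omega>) \<partial>P \<theta>0) = 1" if "i < n" for i
  proof -
    have [measurable]: "?U i \<in> borel_measurable (P \<theta>0)" "?U i \<in> borel_measurable (P \<theta>)" by (rule s0(3) s1(3))+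
    have "(\<integral>\<^sup>+\<omega>. ennreal (\<phi> (?U i \<omega>)) \<partial>P \<theta>0) = (\<integral>\<^sup>+\<omega>. ennreal (\<phi>' (min (?U i \<omega>) 1)) \<partial>P \<theta>0)"
      by (intro nn_integral_cong) (simp add: \<phi>'_min \<phi>'_eq)
    also have "\<dots> = (\<integral>\<^sup>+u. ennreal (\<phi>' u) \<partial>distr (P \<theta>0) borel (\<lambda>\<omega>. min (?U i \<omega>) 1))"
      by (subst nn_integral_distr) auto
    also have "\<dots> = emeasure (distr (P \<theta>) borel (\<lambda>\<omega>. min (?U i \<omega>) 1)) UNIV"
      unfolding dens by (subst emeasure_density) auto
    also have "\<dots> = 1"
      using M1.emeasure_space_1 by (simp add: emeasure_distr)
    finally have 1: "(\<integral>\<^sup>+\<omega>. ennreal (\<phi> (?U i \<omega>)) \<partial>P \<theta>0) = 1" .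
    have "(\<integral>\<omega>. \<phi> (?U i \<omega>) \<partial>P \<theta>0) = enn2real (\<integral>\<^sup>+\<omega>. ennreal (\<phi> (?U i \<omega>)) \<partial>P \<theta>0)"
      using \<phi>_pos by (intro integral_eq_nn_integral) (auto simp: less_imp_le)
    then show ?thesis by (simp add: 1)
  qed
  have "AE \<omega> in P \<theta>0. RN_deriv (exceedance_law (P \<theta>0) Xs n c) (exceedance_law (P \<theta>) Xs n c)
      (exceedance_process Xs n c \<omega>) = ennreal (\<Prod>i<n. \<phi>' (?U i \<omega>))"
    by (rule RN_deriv_exceedance_law[OF n M0.prob_space_axioms M1.prob_space_axioms s0(1) s1(1) s0(4) s1(4)])
      (use \<phi>'_pos \<phi>'_out dens in auto)
  then show "AE \<omega> in P \<theta>0. loglik_ratio P Xs n c \<theta> \<theta>0 \<omega> = (\<Sum>i<n. ln (\<phi> (?U i \<omega>)))"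
  proof (rule AE_mp, intro AE_I2 impI)
    fix \<omega> assume \<omega>: "\<omega> \<in> space (P \<theta>0)"
      and RN: "RN_deriv (exceedance_law (P \<theta>0) Xs n c) (exceedance_law (P \<theta>) Xs n c)
        (exceedance_process Xs n c \<omega>) = ennreal (\<Prod>i<n. \<phi>' (?U i \<omega>))"
    have "loglik_ratio P Xs n c \<theta> \<theta>0 \<omega> = ln (\<Prod>i<n. \<phi> (?U i \<omega>))"
      using \<phi>_pos by (simp add: loglik_ratio_def RN \<phi>'_eq[OF \<omega>] prod_nonneg less_imp_le)
    also have "\<dots> = (\<Sum>i<n. ln (\<phi> (?U i \<omega>)))"
      using \<phi>_pos by (intro ln_prod) (auto simp: less_imp_neq[symmetric])
    finally show "loglik_ratio P Xs n c \<theta> \<theta>0 \<omega> = (\<Sum>i<n. ln (\<phi> (?U i \<omega>)))" .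
  qed
qed

text \<open>Turns a bound that holds eventually for every fixed \<open>e\<close> into one null
  sequence of bounds, by taking the supremum over \<open>S\<close> itself.\<close>

lemma uniform_rate:
  fixes g :: "nat \<Rightarrow> 'b \<Rightarrow> real"
  assumes g: "\<And>e. e > 0 \<Longrightarrow> \<forall>\<^sub>F n in sequentially. \<forall>u\<in>S. \<bar>g n u\<bar> \<le> e"
  obtains e where "\<forall>n. e n \<ge> 0" "e \<longlonglongrightarrow> 0" "\<forall>\<^sub>F n in sequentially. \<forall>u\<in>S. \<bar>g n u\<bar> \<le> e n"
proof -
  \<comment> \<open>The inserted 0 keeps the set nonempty and the supremum nonnegative. Indices with
    an unbounded set get the default rate 0; there are only finitely many of them.\<close>
  define A where "A n = insert 0 ((\<lambda>u. \<bar>g n u\<bar>) ` S)" for n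
  define e where "e n = (if bdd_above (A n) then Sup (A n) else 0)" for n
  have upper: "x \<le> e n" if "bdd_above (A n)" "x \<in> A n" for n x
    using that by (simp add: e_def cSup_upper)
  have nn: "e n \<ge> 0" for n
    using upper[of n 0] by (cases "bdd_above (A n)") (auto simp: A_def e_def)
  show thesis
  proof (rule that)
    show "\<forall>n. e n \<ge> 0" using nn by blast
    show "e \<longlonglongrightarrow> 0"
    proof (rule tendstoI)
      fix d :: real assume d: "d > 0"
      have "\<forall>\<^sub>F n in sequentially. \<forall>u\<in>S. \<bar>g n u\<bar> \<le> d / 2" by (rule g) (use d in simp)
      then show "\<forall>\<^sub>F n in sequentially. dist (e n) 0 < d"
      proof eventually_elim
        case (elim n)
        then have le: "x \<le> d / 2" if "x \<in> A n" for x using that d by (auto simp: A_def)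
        then have bdd: "bdd_above (A n)" by (intro bdd_aboveI)
        have "A n \<noteq> {}" by (simp add: A_def)
        then have "Sup (A n) \<le> d / 2" by (rule cSup_least) (rule le)
        then have "e n \<le> d / 2" using bdd by (simp add: e_def)
        then show ?case using nn[of n] d by simp
      qed
    qed
    show "\<forall>\<^sub>F n in sequentially. \<forall>u\<in>S. \<bar>g n u\<bar> \<le> e n"
      using g[of 1, simplified]
    proof eventually_elim
      case (elim n)
      then have "bdd_above (A n)" by (intro bdd_aboveI[of _ 1]) (auto simp: A_def)
      then show ?case using upper by (auto simp: A_def)
    qed
  qed
qed

text \<open>For \<open>d = \<mu>\<close> this is the square root of the rate condition; a larger
  exponent only helps once \<open>\<bar>c n\<bar> < 1\<close>. With \<mu> = min \<delta> \<gamma> it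
  applies to both exponents.\<close>

lemma sqrt_rate_tendsto_0:
  fixes c :: "nat \<Rightarrow> real"
  assumes c: "\<And>n. c n < 0" "c \<longlonglongrightarrow> 0"
    and rate: "(\<lambda>n. real n * \<bar>c n\<bar> powr (1 + 2 * \<mu>)) \<longlonglongrightarrow> 0" and d: "\<mu> \<le> d"
  shows "(\<lambda>n. sqrt (real n * \<bar>c n\<bar>) * \<bar>c n\<bar> powr d) \<longlonglongrightarrow> 0"
proof -
  have 0: "(\<lambda>n. sqrt (real n * \<bar>c n\<bar> powr (1 + 2 * \<mu>))) \<longlonglongrightarrow> 0"
    using tendsto_real_sqrt[OF rate] by simp
  have "\<forall>\<^sub>F n in sequentially. \<bar>c n\<bar> < 1"
    using tendstoD[OF c(2), of 1] by (simp add: dist_real_def)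
  then have "\<forall>\<^sub>F n in sequentially. norm (sqrt (real n * \<bar>c n\<bar>) * \<bar>c n\<bar> powr d) \<le> sqrt (real n * \<bar>c n\<bar> powr (1 + 2 * \<mu>))"
  proof eventually_elim
    case (elim n)
    have "c n \<noteq> 0" using c(1)[of n] by simp
    have "\<bar>c n\<bar> powr (1 + 2 * \<mu>) = \<bar>c n\<bar> powr (1 + (\<mu> + \<mu>))" by simp
    also have "\<dots> = \<bar>c n\<bar> * (\<bar>c n\<bar> powr \<mu>)\<^sup>2"
      unfolding powr_add using \<open>c n \<noteq> 0\<close> by (simp add: power2_eq_square)
    finally have "sqrt (real n * \<bar>c n\<bar> powr (1 + 2 * \<mu>)) = sqrt (real n * \<bar>c n\<bar>) * \<bar>c n\<bar> powr \<mu>"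
      by (simp add: real_sqrt_mult)
    moreover have "\<bar>c n\<bar> powr d \<le> \<bar>c n\<bar> powr \<mu>"
      using elim d by (intro powr_mono') auto
    ultimately show ?case by (simp add: mult_left_mono)
  qed
  then show ?thesis by (rule Lim_null_comparison[OF _ 0])
qed

theorem theorem4p1:
  fixes \<psi> :: "real \<Rightarrow> real" and \<delta> \<gamma> \<theta>0 L :: real
    and P :: "real \<Rightarrow> 'a measure" and X :: "'a \<Rightarrow> real \<Rightarrow> real"
    and Xs :: "nat \<Rightarrow> 'a \<Rightarrow> real \<Rightarrow> real"
    and Q :: "real \<Rightarrow> 'b measure" and V :: "real \<Rightarrow> 'b \<Rightarrow> real \<Rightarrow> real"
    and c :: "nat \<Rightarrow> real"
  assumes psi: "symmetric_unimodal_density \<psi>"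
    and pos: "\<delta> > 0" "\<gamma> > 0"
    and theta0: "\<theta>0 \<in> {0<..<1}"
    and X: "\<And>\<theta>. \<theta> \<in> {0<..<1} \<Longrightarrow> nonpos_continuous_process (P \<theta>) X"
    and copies: "\<And>\<theta>. \<theta> \<in> {0<..<1} \<Longrightarrow> independent_copies (P \<theta>) X Xs"
    and V: "\<And>\<theta>. \<theta> \<in> {0<..<1} \<Longrightarrow>
              \<exists>\<beta>>0. \<theta> = 2 * Psi \<psi> (- \<beta> / 2) \<and> standard_GPP \<psi> \<beta> (Q \<theta>) (V \<theta>)"
    and C: "\<And>\<theta>. \<theta> \<in> {0<..<1} \<Longrightarrow> neighborhood_condition \<delta> (P \<theta>) X (Q \<theta>) (V \<theta>)"
    and D: "derivative_expansion P X \<theta>0 L \<gamma>"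
    and c: "\<And>n. c n < 0" "incseq c" "c \<longlonglongrightarrow> 0"
    and growth: "filterlim (\<lambda>n. real n * \<bar>c n\<bar>) at_top sequentially"
    and rate: "(\<lambda>n. real n * \<bar>c n\<bar> powr (1 + 2 * min \<delta> \<gamma>)) \<longlonglongrightarrow> 0"
  shows "(\<forall>\<xi>::real.
            tends_to_0_in_prob (P \<theta>0)
              (\<lambda>n \<omega>. loglik_ratio P Xs n (c n) (\<theta>0 + \<xi> / sqrt (real n * \<bar>c n\<bar>)) \<theta>0 \<omega>
                    - (\<xi> * L * normalized_count Xs c \<theta>0 n \<omega> - \<xi>\<^sup>2 * L\<^sup>2 * \<theta>0 / 2)) \<and>
            conv_in_distribution (P \<theta>0)
              (\<lambda>n. loglik_ratio P Xs n (c n) (\<theta>0 + \<xi> / sqrt (real n * \<bar>c n\<bar>)) \<theta>0)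
              (normal_law (- (\<xi>\<^sup>2 * L\<^sup>2 * \<theta>0 / 2)) (\<xi>\<^sup>2 * L\<^sup>2 * \<theta>0))) \<and>
         conv_in_distribution (P \<theta>0) (normalized_count Xs c \<theta>0) (normal_law 0 \<theta>0)"
proof -
  define m where "m n = real n * \<bar>c n\<bar>" for n
  define p where "p n = prob_gt (P \<theta>0) X (\<lambda>_. c n)" for n
  define U where "U n = sample_sup Xs (c n)" for n
  define J where "J n \<omega> = (\<Sum>i<n. indicat_real {..<1} (U n i \<omega>))" for n \<omega>
  define Z where "Z n \<omega> = (J n \<omega> - m n * \<theta>0) / sqrt (m n)" for n \<omega>
  note ss = sample_sup[OF X[OF theta0] copies[OF theta0] c(1), folded U_def]
  interpret M: prob_space "P \<theta>0"
    using X[OF theta0] by (simp add: nonpos_continuous_process_def continuous_process_def)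
  have m_top: "filterlim m at_top sequentially" using growth by (simp add: m_def[abs_def])
  have w0: "(\<lambda>n. 1 / sqrt (m n)) \<longlonglongrightarrow> 0"
    by (intro tendsto_divide_0[OF tendsto_const] filterlim_at_top_imp_at_infinity
        filterlim_compose[OF sqrt_at_top] m_top)
  have m0: "\<forall>\<^sub>F n in sequentially. m n > 0"
    using m_top by (auto simp: filterlim_at_top_dense)
  have prob_U: "M.prob {\<omega>\<in>space (P \<theta>0). U n i \<omega> < 1} = p n" for n i
    using ss(5)[of n i 1] by (simp add: p_def)
  have c_lim: "filterlim (\<lambda>n. \<bar>c n\<bar>) (at_right 0) sequentially"
    using tendsto_rabs[OF c(3)] c(1) by (auto simp: filterlim_at intro!: always_eventually less_imp_neq)
  obtain K where "\<forall>\<^sub>F y in at_right 0. \<bar>prob_gt (P \<theta>0) X (\<lambda>_. - y) - y * \<theta>0\<bar> \<le> K * (y * y powr \<delta>)"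
    by (rule process_exceedance_expansion[OF psi V[OF theta0] C[OF theta0]])
  from filterlim_iff[THEN iffD1, OF c_lim, rule_format, OF this]
  have p_exp: "\<forall>\<^sub>F n in sequentially. \<bar>p n - \<bar>c n\<bar> * \<theta>0\<bar> \<le> K * (\<bar>c n\<bar> * \<bar>c n\<bar> powr \<delta>)"
    by (rule eventually_mono) (use c(1) in \<open>simp add: p_def abs_of_neg\<close>)
  \<comment> \<open>First use of the rate condition: the relative error |c_n|^\<delta> of the
    exceedance probability becomes sqrt m |c_n|^\<delta> after normalization.\<close>
  have bias: "(\<lambda>n. (real n * p n - m n * \<theta>0) / sqrt (m n)) \<longlonglongrightarrow> 0"
  proof (rule Lim_null_comparison)
    show "(\<lambda>n. K * (sqrt (real n * \<bar>c n\<bar>) * \<bar>c n\<bar> powr \<delta>)) \<longlonglongrightarrow> 0"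
      using tendsto_mult[OF tendsto_const sqrt_rate_tendsto_0[OF c(1,3) rate, of \<delta>], of K] by simp
    show "\<forall>\<^sub>F n in sequentially. norm ((real n * p n - m n * \<theta>0) / sqrt (m n))
        \<le> K * (sqrt (real n * \<bar>c n\<bar>) * \<bar>c n\<bar> powr \<delta>)"
      using p_exp m0
    proof eventually_elim
      case (elim n)
      have "norm ((real n * p n - m n * \<theta>0) / sqrt (m n)) = real n * \<bar>p n - \<bar>c n\<bar> * \<theta>0\<bar> / sqrt (m n)"
        using elim(2) by (simp add: m_def abs_mult mult.assoc flip: right_diff_distrib)
      also have "\<dots> \<le> real n * (K * (\<bar>c n\<bar> * \<bar>c n\<bar> powr \<delta>)) / sqrt (m n)"
        using elim by (intro divide_right_mono mult_left_mono) auto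
      also have "\<dots> = K * \<bar>c n\<bar> powr \<delta> * (m n / sqrt (m n))"
        by (simp add: m_def)
      also have "m n / sqrt (m n) = sqrt (m n)" using elim(2) by (simp add: real_div_sqrt)
      finally show ?case by (simp add: m_def mult_ac)
    qed
  qed
  have v: "(\<lambda>n. real n * p n / m n) \<longlonglongrightarrow> \<theta>0"
  proof -
    have "(\<lambda>n. (real n * p n - m n * \<theta>0) / sqrt (m n) * (1 / sqrt (m n)) + \<theta>0) \<longlonglongrightarrow> 0 * 0 + \<theta>0"
      by (intro tendsto_add tendsto_mult bias w0 tendsto_const)
    moreover have "\<forall>\<^sub>F n in sequentially. (real n * p n - m n * \<theta>0) / sqrt (m n) * (1 / sqrt (m n)) + \<theta>0 = real n * p n / m n"
      using m0 by eventually_elim (simp add: field_simps)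
    ultimately show ?thesis by (simp add: Lim_transform_eventually)
  qed
  have p0: "p \<longlonglongrightarrow> 0"
  proof -
    have "(\<lambda>n. real n * p n / m n * \<bar>c n\<bar>) \<longlonglongrightarrow> \<theta>0 * \<bar>0\<bar>"
      by (intro tendsto_mult v tendsto_rabs c(3))
    moreover have "\<forall>\<^sub>F n in sequentially. real n * p n / m n * \<bar>c n\<bar> = p n"
      using m0 by eventually_elim (auto simp: m_def)
    ultimately show ?thesis by (simp add: Lim_transform_eventually)
  qed
  have U_meas[measurable]: "U n i \<in> borel_measurable (P \<theta>0)" for n i by (rule ss(3))
  have Z_meas[measurable]: "Z n \<in> borel_measurable (P \<theta>0)" for n
    unfolding Z_def[abs_def] J_def by measurable
  have Z_eq: "normalized_count Xs c \<theta>0 n \<omega> = Z n \<omega>" if "\<omega> \<in> space (P \<theta>0)" for n \<omega>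
    using ss(1)[of n] that by (simp add: normalized_count_def num_exceedances_eq_sum Z_def J_def m_def mult_ac)
  have nc_meas[measurable]: "normalized_count Xs c \<theta>0 n \<in> borel_measurable (P \<theta>0)" for n
    using Z_meas[of n] by (rule measurable_cong[THEN iffD1, rotated]) (simp add: Z_eq)
  have sr_meas: "sup_ratio Xs (c n) i \<in> borel_measurable (P \<theta>0)" for n i
    using U_meas[of n i] by (rule measurable_cong[THEN iffD1, rotated]) (use ss(1)[of n] in simp)
  have ll_meas[measurable]: "loglik_ratio P Xs n (c n) \<theta> \<theta>0 \<in> borel_measurable (P \<theta>0)" for n \<theta>
    by (rule measurable_loglik_ratio) (rule sr_meas)

  \<comment> \<open>\<open>Z n\<close> and the sum of centred indicators differ by the deterministic
    bias only.\<close>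
  have char_Z: "(\<lambda>n. char (distr (P \<theta>0) borel (normalized_count Xs c \<theta>0 n)) t) \<longlonglongrightarrow> exp (- (\<theta>0 * t\<^sup>2) / 2)" for t
  proof -
    let ?Y = "\<lambda>n \<omega>. \<Sum>i<n. (indicat_real {..<1} (U n i \<omega>) - p n) / sqrt (m n)"
    have Y: "?Y n \<omega> = (J n \<omega> - real n * p n) / sqrt (m n)" for n \<omega>
      by (simp add: J_def sum_subtractf flip: sum_divide_distrib)
    have Y_meas: "?Y n \<in> borel_measurable (P \<theta>0)" for n by measurable
    have "tends_to_0_in_prob (P \<theta>0) (\<lambda>n \<omega>. (real n * p n - m n * \<theta>0) / sqrt (m n))"
      by (rule tends_to_0_in_prob_const[OF bias])
    then have "tends_to_0_in_prob (P \<theta>0) (\<lambda>n \<omega>. Z n \<omega> - ?Y n \<omega>)"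
      unfolding Y by (simp add: Z_def flip: diff_divide_distrib)
    from char_diff_tends_to_0[OF M.prob_space_axioms Z_meas Y_meas this]
    have "(\<lambda>n. char (distr (P \<theta>0) borel (Z n)) t - char (distr (P \<theta>0) borel (?Y n)) t) \<longlonglongrightarrow> 0" .
    from tendsto_add[OF this M.char_centered_count_tendsto[OF ss(4) prob_U p0 m_top v, of t]]
    have "(\<lambda>n. char (distr (P \<theta>0) borel (Z n)) t) \<longlonglongrightarrow> exp (- (\<theta>0 * t\<^sup>2) / 2)" by simp
    moreover have "distr (P \<theta>0) borel (normalized_count Xs c \<theta>0 n) = distr (P \<theta>0) borel (Z n)" for n
      by (intro distr_cong refl) (simp add: Z_eq)
    ultimately show ?thesis by simp
  qed

  have lan: "tends_to_0_in_prob (P \<theta>0)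
      (\<lambda>n \<omega>. loglik_ratio P Xs n (c n) (\<theta>0 + \<xi> / sqrt (m n)) \<theta>0 \<omega>
        - ((\<xi> * L) * normalized_count Xs c \<theta>0 n \<omega> - (\<xi> * L)\<^sup>2 * \<theta>0 / 2))" for \<xi>
  proof -
    define \<theta> where "\<theta> n = \<theta>0 + \<xi> / sqrt (m n)" for n
    define k where "k = \<xi> * L"
    define F where "F \<theta> n u = prob_gt (P \<theta>) X (\<lambda>_. u * c n)" for \<theta> n u
    have \<theta>_lim: "\<theta> \<longlonglongrightarrow> \<theta>0"
      using tendsto_add[OF tendsto_const tendsto_mult[OF tendsto_const w0], of \<theta>0 \<xi>] by (simp add: \<theta>_def[abs_def])
    have \<theta>_in: "\<forall>\<^sub>F n in sequentially. \<theta> n \<in> {0<..<1}"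
      using topological_tendstoD[OF \<theta>_lim, of "{0<..<1}"] theta0 by simp
    obtain c0 r1 r2 B where c0: "c0 < 0" and
      ratio: "\<forall>\<^sub>F \<theta> in nhds \<theta>0. \<forall>s\<in>{0<..<1}. \<forall>c\<in>{c0..<0}.
           (\<lambda>u. prob_gt (P \<theta>) X (\<lambda>_. u * c)) differentiable (at s) \<and>
           exceedance_deriv (P \<theta>0) X c s \<noteq> 0 \<and>
           exceedance_deriv (P \<theta>) X c s / exceedance_deriv (P \<theta>0) X c s =
             1 + L * (\<theta> - \<theta>0) + (r1 s \<theta> c + r2 s \<theta> c)" and
      r1: "\<forall>e>0. \<forall>\<^sub>F \<theta> in nhds \<theta>0. \<forall>s\<in>{0<..<1}. \<forall>c\<in>{c0..<0}. \<bar>r1 s \<theta> c\<bar> \<le> e * \<bar>\<theta> - \<theta>0\<bar>" and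
      r2: "\<forall>\<^sub>F \<theta> in nhds \<theta>0. \<forall>s\<in>{0<..<1}. \<forall>c\<in>{c0..<0}. \<bar>r2 s \<theta> c\<bar> \<le> B * \<bar>c\<bar> powr \<gamma>"
      using D unfolding derivative_expansion_def by blast
    note along = filterlim_iff[THEN iffD1, OF \<theta>_lim, rule_format]
    have c_in: "\<forall>\<^sub>F n in sequentially. c n \<in> {c0..<0}"
      using order_tendstoD(1)[OF c(3) c0] by eventually_elim (use c(1) in auto)
    have F_deriv: "exceedance_deriv (P \<theta>) X (c n) s = deriv (F \<theta> n) s" for \<theta> n s
      by (simp add: exceedance_deriv_def F_def[abs_def])
    have ratio': "\<forall>\<^sub>F n in sequentially. \<forall>s\<in>{0<..<1}.
        F (\<theta> n) n differentiable (at s) \<and> F \<theta>0 n differentiable (at s) \<and>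
        deriv (F (\<theta> n) n) s / deriv (F \<theta>0 n) s = 1 + L * (\<theta> n - \<theta>0) + (r1 s (\<theta> n) (c n) + r2 s (\<theta> n) (c n))"
      using along[OF ratio] c_in
    proof eventually_elim
      case (elim n)
      show ?case
      proof
        fix s :: real assume "s \<in> {0<..<1}"
        \<comment> \<open>The filter \<open>nhds \<theta>0\<close>, unlike a punctured one, includes
          the point itself and so provides differentiability under \<open>\<theta>0\<close>
          too.\<close>
        with elim eventually_nhds_x_imp_x[OF ratio]
        have "(\<lambda>u. prob_gt (P (\<theta> n)) X (\<lambda>_. u * c n)) differentiable (at s)"
          "(\<lambda>u. prob_gt (P \<theta>0) X (\<lambda>_. u * c n)) differentiable (at s)"
          "exceedance_deriv (P (\<theta> n)) X (c n) s / exceedance_deriv (P \<theta>0) X (c n) s =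
             1 + L * (\<theta> n - \<theta>0) + (r1 s (\<theta> n) (c n) + r2 s (\<theta> n) (c n))"
          by blast+
        then show "F (\<theta> n) n differentiable (at s) \<and> F \<theta>0 n differentiable (at s) \<and>
            deriv (F (\<theta> n) n) s / deriv (F \<theta>0 n) s = 1 + L * (\<theta> n - \<theta>0) + (r1 s (\<theta> n) (c n) + r2 s (\<theta> n) (c n))"
          unfolding F_deriv by (simp add: F_def[abs_def])
      qed
    qed
    \<comment> \<open>Second use of the rate condition: after multiplication by sqrt m,
      \<open>r1\<close> contributes at most \<open>d * \<bar>\<xi>\<bar>\<close> and
      \<open>r2\<close> at most a multiple of sqrt m |c_n|^\<gamma>, each below
      \<open>e / 2\<close>. The case \<open>e = 1\<close> yields the bound \<open>b\<close>,
      arbitrary \<open>e\<close> the limit \<open>k\<close>.\<close>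
    have close: "\<forall>\<^sub>F n in sequentially. \<forall>s\<in>{0<..<1}.
        \<bar>sqrt (m n) * (deriv (F (\<theta> n) n) s / deriv (F \<theta>0 n) s - 1) - k\<bar> \<le> e" if e: "e > 0" for e
    proof -
      define d where "d = e / (2 * (\<bar>\<xi>\<bar> + 1))"
      have d: "d > 0" "d * \<bar>\<xi>\<bar> \<le> e / 2" using e by (auto simp: d_def field_simps)
      have "(\<lambda>n. B * (sqrt (real n * \<bar>c n\<bar>) * \<bar>c n\<bar> powr \<gamma>)) \<longlonglongrightarrow> B * 0"
        by (intro tendsto_mult tendsto_const sqrt_rate_tendsto_0[OF c(1,3) rate]) simp
      then have "\<forall>\<^sub>F n in sequentially. B * (sqrt (m n) * \<bar>c n\<bar> powr \<gamma>) < e / 2"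
        unfolding m_def by (rule order_tendstoD(2)) (use e in simp)
      with ratio' along[OF r1[rule_format, OF d(1)]] along[OF r2] c_in m0 show ?thesis
      proof eventually_elim
        case (elim n)
        show ?case
        proof
          fix s :: real assume s: "s \<in> {0<..<1}"
          have sq: "sqrt (m n) * (\<theta> n - \<theta>0) = \<xi>" using elim(5) by (simp add: \<theta>_def)
          have eq: "deriv (F (\<theta> n) n) s / deriv (F \<theta>0 n) s
              = 1 + L * (\<theta> n - \<theta>0) + (r1 s (\<theta> n) (c n) + r2 s (\<theta> n) (c n))"
            using elim(1) s by blast
          have "sqrt (m n) * (deriv (F (\<theta> n) n) s / deriv (F \<theta>0 n) s - 1) - k
              = sqrt (m n) * r1 s (\<theta> n) (c n) + sqrt (m n) * r2 s (\<theta> n) (c n) + (L * (sqrt (m n) * (\<theta> n - \<theta>0)) - k)"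
            unfolding eq by (simp add: algebra_simps)
          also have "L * (sqrt (m n) * (\<theta> n - \<theta>0)) - k = 0" by (simp only: sq k_def mult.commute diff_self)
          finally have "\<bar>sqrt (m n) * (deriv (F (\<theta> n) n) s / deriv (F \<theta>0 n) s - 1) - k\<bar>
              \<le> sqrt (m n) * \<bar>r1 s (\<theta> n) (c n)\<bar> + sqrt (m n) * \<bar>r2 s (\<theta> n) (c n)\<bar>"
            using elim(5) abs_triangle_ineq[of "sqrt (m n) * r1 s (\<theta> n) (c n)" "sqrt (m n) * r2 s (\<theta> n) (c n)"]
            by (simp add: abs_mult)
          also have "\<dots> \<le> sqrt (m n) * (d * \<bar>\<theta> n - \<theta>0\<bar>) + sqrt (m n) * (B * \<bar>c n\<bar> powr \<gamma>)"
            using elim s by (intro add_mono mult_left_mono) auto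
          also have "sqrt (m n) * (d * \<bar>\<theta> n - \<theta>0\<bar>) = d * \<bar>\<xi>\<bar>"
            using elim(5) by (simp add: sq[symmetric] abs_mult)
          also have "d * \<bar>\<xi>\<bar> + sqrt (m n) * (B * \<bar>c n\<bar> powr \<gamma>) \<le> e"
            using d(2) elim(6) by (simp add: mult_ac)
          finally show "\<bar>sqrt (m n) * (deriv (F (\<theta> n) n) s / deriv (F \<theta>0 n) s - 1) - k\<bar> \<le> e" .
        qed
      qed
    qed
    define b where "b n = (\<bar>k\<bar> + 1) / sqrt (m n)" for n
    have b0: "b \<longlonglongrightarrow> 0"
      using tendsto_mult[OF tendsto_const w0, of "\<bar>k\<bar> + 1"] by (simp add: b_def[abs_def])
    have F_lim: "(F \<theta> n \<longlongrightarrow> 0) (at_right 0)" if "\<theta> \<in> {0<..<1}" for \<theta> n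
    proof -
      have "filterlim (\<lambda>u. u * - c n) (at_right 0) (at_right 0)"
        unfolding filterlim_at
      proof
        show "\<forall>\<^sub>F u in at_right 0. u * - c n \<in> {0<..} \<and> u * - c n \<noteq> 0"
          using eventually_at_right_less[of 0]
          by eventually_elim (use c(1)[of n] in \<open>auto simp: mult_pos_neg\<close>)
        have "((\<lambda>u. u * - c n) \<longlongrightarrow> 0 * - c n) (at_right 0)" by (intro tendsto_intros)
        then show "((\<lambda>u. u * - c n) \<longlongrightarrow> 0) (at_right 0)" by simp
      qed
      from filterlim_compose[OF process_exceedance_tendsto_0[OF psi pos(1) V[OF that] C[OF that]] this]
      show ?thesis by (simp add: F_def[abs_def])
    qed
    \<comment> \<open>\<open>b n \<le> 1 / 2\<close> keeps the quotients and \<open>a n\<close> at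
      least 1/2. Together with \<open>F \<theta>0 n 1 < 1 / 2\<close> it keeps the exceedance
      probability under \<open>\<theta> n\<close> below 3/4, so all values of the likelihood ratio
      are positive.\<close>
    define good where "good n \<longleftrightarrow> n > 0 \<and> m n > 0 \<and> \<theta> n \<in> {0<..<1} \<and>
        (\<forall>s\<in>{0<..<1}. F \<theta>0 n differentiable (at s)) \<and> (\<forall>s\<in>{0<..<1}. F (\<theta> n) n differentiable (at s)) \<and>
        (\<forall>s\<in>{0<..<1}. \<bar>deriv (F (\<theta> n) n) s / deriv (F \<theta>0 n) s - 1\<bar> \<le> b n) \<and>
        0 \<le> b n \<and> b n \<le> 1 / 2 \<and> F \<theta>0 n 1 < 1 / 2" for n
    have F1: "F \<theta>0 n 1 = p n" for n by (simp add: F_def p_def)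
    have "\<forall>\<^sub>F n in sequentially. p n < 1/2" by (rule order_tendstoD(2)[OF p0]) simp
    moreover have "\<forall>\<^sub>F n in sequentially. b n < 1/2" by (rule order_tendstoD(2)[OF b0]) simp
    ultimately have good: "\<forall>\<^sub>F n in sequentially. good n"
      using eventually_gt_at_top[of 0] m0 \<theta>_in ratio' close[of 1, OF zero_less_one]
    proof eventually_elim
      case (elim n)
      have "\<bar>deriv (F (\<theta> n) n) s / deriv (F \<theta>0 n) s - 1\<bar> \<le> b n" if "s \<in> {0<..<1}" for s
      proof -
        let ?x = "deriv (F (\<theta> n) n) s / deriv (F \<theta>0 n) s - 1"
        have "\<bar>sqrt (m n) * ?x - k\<bar> \<le> 1" using elim(7) that by blast
        then have "sqrt (m n) * \<bar>?x\<bar> \<le> \<bar>k\<bar> + 1"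
          using elim(4) abs_triangle_ineq2[of "sqrt (m n) * ?x" k] by (simp add: abs_mult)
        then show ?thesis using elim(4) by (simp add: b_def pos_le_divide_eq mult.commute)
      qed
      moreover have "0 \<le> b n" using elim(4) by (simp add: b_def)
      ultimately show ?case using elim by (simp add: good_def F1)
    qed
    have good_nz: "deriv (F (\<theta> n) n) s / deriv (F \<theta>0 n) s > 0" "deriv (F \<theta>0 n) s \<noteq> 0"
      if "good n" "s \<in> {0<..<1}" for n s
    proof -
      have "\<bar>deriv (F (\<theta> n) n) s / deriv (F \<theta>0 n) s - 1\<bar> \<le> 1 / 2"
        using that unfolding good_def by force
      then show "deriv (F (\<theta> n) n) s / deriv (F \<theta>0 n) s > 0" by linarith
      then show "deriv (F \<theta>0 n) s \<noteq> 0" by auto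
    qed
    have mass: "\<bar>F (\<theta> n) n 1 - F \<theta>0 n 1\<bar> \<le> b n * F \<theta>0 n 1" if g: "good n" for n
    proof -
      have \<theta>: "\<theta> n \<in> {0<..<1}" using g by (simp add: good_def)
      note s1 = sample_sup[OF X[OF \<theta>] copies[OF \<theta>] c(1), folded U_def]
      show ?thesis
      proof (rule clipped_mass_diff[of "P \<theta>0" "P (\<theta> n)" "U n 0"])
        show "prob_space (P (\<theta> n))"
          using X[OF \<theta>] by (simp add: nonpos_continuous_process_def continuous_process_def)
        show "F \<theta>0 n u = M.prob {\<omega>\<in>space (P \<theta>0). U n 0 \<omega> < u}" for u
          using ss(5)[of n 0 u] by (simp add: F_def)
        show "F (\<theta> n) n u = measure (P (\<theta> n)) {\<omega>\<in>space (P (\<theta> n)). U n 0 \<omega> < u}" for u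
          using s1(5)[of n 0 u] by (simp add: F_def)
        show "(F \<theta>0 n \<longlongrightarrow> 0) (at_right 0)" "(F (\<theta> n) n \<longlongrightarrow> 0) (at_right 0)"
          by (rule F_lim theta0 \<theta>)+
      qed (use g good_nz[OF g] s1(3) in \<open>auto simp: good_def M.prob_space_axioms\<close>)
    qed
    \<comment> \<open>The free value at and below 0 is taken to be the linear approximation itself,
      so the error \<open>g\<close> vanishes there.\<close>
    define a where "a n = 1 + k / sqrt (m n)" for n
    \<comment> \<open>The default 1 for the remaining finitely many \<open>n\<close> makes
      \<open>\<phi> n\<close> measurable for every \<open>n\<close>, as the triangular array lemma
      demands.\<close>
    define \<phi> where "\<phi> n u = (if good n then
        (if u \<in> {0<..<1} then deriv (F (\<theta> n) n) u / deriv (F \<theta>0 n) u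
          else if u \<le> 0 then a n else (1 - F (\<theta> n) n 1) / (1 - F \<theta>0 n 1)) else 1)" for n u
    have a_pos: "a n > 0" if g: "good n" for n
    proof -
      have "\<bar>k / sqrt (m n)\<bar> \<le> b n"
        using g by (auto simp: good_def b_def intro!: divide_right_mono)
      moreover have "b n \<le> 1 / 2" using g by (simp add: good_def)
      ultimately show ?thesis unfolding a_def by linarith
    qed
    have F1_lt: "F (\<theta> n) n 1 < 1" "F \<theta>0 n 1 < 1" if g: "good n" for n
    proof -
      have "b n * F \<theta>0 n 1 \<le> 1/2 * F \<theta>0 n 1"
        using g by (intro mult_right_mono) (auto simp: good_def F1 p_def prob_gt_def)
      then show "F (\<theta> n) n 1 < 1" "F \<theta>0 n 1 < 1"
        using mass[OF g] g unfolding good_def by linarith+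
    qed
    have lik: "\<phi> n \<in> borel_measurable borel \<and> (\<forall>i<n. M.expectation (\<lambda>\<omega>. \<phi> n (U n i \<omega>)) = 1) \<and>
        (AE \<omega> in P \<theta>0. loglik_ratio P Xs n (c n) (\<theta> n) \<theta>0 \<omega> = (\<Sum>i<n. ln (\<phi> n (U n i \<omega>))))"
      if g: "good n" for n
    proof -
      have \<theta>: "\<theta> n \<in> {0<..<1}" and n: "n > 0" using g by (simp_all add: good_def)
      have g': "\<forall>s\<in>{0<..<1}. F \<theta>0 n differentiable (at s)" "\<forall>s\<in>{0<..<1}. F (\<theta> n) n differentiable (at s)"
        using g by (simp_all add: good_def)
      have rp: "\<forall>s\<in>{0<..<1}. deriv (F (\<theta> n) n) s / deriv (F \<theta>0 n) s > 0" using good_nz[OF g] by blast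
      note lr = loglik_ratio_exceedance[OF n c(1) X[OF theta0] copies[OF theta0] X[OF \<theta>] copies[OF \<theta>]
          F_def F_def g' F_lim[OF theta0] F_lim[OF \<theta>] rp F1_lt(2)[OF g] F1_lt(1)[OF g] a_pos[OF g], folded U_def]
      have \<phi>: "\<phi> n = (\<lambda>u. if u \<in> {0<..<1} then deriv (F (\<theta> n) n) u / deriv (F \<theta>0 n) u
          else if u \<le> 0 then a n else (1 - F (\<theta> n) n 1) / (1 - F \<theta>0 n 1))"
        using g by (simp add: \<phi>_def fun_eq_iff)
      show ?thesis unfolding \<phi> using lr by blast
    qed
    have \<phi>_meas: "\<phi> n \<in> borel_measurable borel" for n
      using lik[of n] by (cases "good n") (auto simp: \<phi>_def[abs_def])
    define g where "g n u = sqrt (m n) * (\<phi> n u - 1) - k" for n u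
    have g_small: "\<forall>\<^sub>F n in sequentially. \<forall>u\<in>{..<1}. \<bar>g n u\<bar> \<le> e" if "e > 0" for e
      using close[OF that] good
    proof eventually_elim
      case (elim n)
      have "g n u = 0" if "u \<le> 0" for u
        using elim(2) that by (simp add: g_def \<phi>_def a_def good_def)
      moreover have "\<bar>g n u\<bar> \<le> e" if "u \<in> {0<..<1}" for u
        using elim that by (simp add: g_def \<phi>_def)
      ultimately show ?case using \<open>e > 0\<close> by (metis abs_zero greaterThanLessThan_iff lessThan_iff less_imp_le not_le)
    qed
    obtain e where e: "\<forall>n. e n \<ge> 0" "e \<longlonglongrightarrow> 0" "\<forall>\<^sub>F n in sequentially. \<forall>u\<in>{..<1}. \<bar>g n u\<bar> \<le> e n"
      by (rule uniform_rate[of "{..<1}" g, OF g_small])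
    have "tends_to_0_in_prob (P \<theta>0) (\<lambda>n \<omega>. (\<Sum>i<n. ln (\<phi> n (U n i \<omega>)))
        - (k * (((\<Sum>i<n. indicat_real {..<1} (U n i \<omega>)) - m n * \<theta>0) / sqrt (m n)) - k\<^sup>2 * \<theta>0 / 2))"
    \<comment> \<open>The constant \<open>C\<close> comes from the atom: the mass difference is at
      most \<open>b n * p n\<close>, and the denominator \<open>1 - F \<theta>0 n 1\<close> is at
      least 1/2, whence the factor 2.\<close>
    proof (rule M.local_asymptotic_normality[where C="2 * (\<bar>k\<bar> + 1)" and e=e and p=p])
      show "\<forall>\<^sub>F n in sequentially. \<forall>i<n. M.expectation (\<lambda>\<omega>. \<phi> n (U n i \<omega>)) = 1"
        using good by eventually_elim (use lik in blast)
      show "\<forall>\<^sub>F n in sequentially. \<forall>u<1. \<bar>\<phi> n u - 1 - k / sqrt (m n)\<bar> \<le> e n / sqrt (m n)"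
        using e(3) m0
      proof eventually_elim
        case (elim n)
        show ?case
        proof (intro allI impI)
          fix u :: real assume "u < 1"
          have "\<phi> n u - 1 - k / sqrt (m n) = g n u / sqrt (m n)"
            using elim(2) by (simp add: g_def diff_divide_distrib)
          then show "\<bar>\<phi> n u - 1 - k / sqrt (m n)\<bar> \<le> e n / sqrt (m n)"
            using elim \<open>u < 1\<close> by (simp add: divide_right_mono)
        qed
      qed
      show "\<forall>\<^sub>F n in sequentially. \<forall>u\<ge>1. \<bar>\<phi> n u - 1\<bar> \<le> 2 * (\<bar>k\<bar> + 1) * p n / sqrt (m n)"
        using good
      proof eventually_elim
        case (elim n)
        show ?case
        proof (intro allI impI)
          fix u :: real assume "1 \<le> u"
          then have "\<phi> n u - 1 = (F \<theta>0 n 1 - F (\<theta> n) n 1) / (1 - F \<theta>0 n 1)"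
            using elim F1_lt(2)[OF elim] by (simp add: \<phi>_def field_simps)
          then have "\<bar>\<phi> n u - 1\<bar> = \<bar>F (\<theta> n) n 1 - F \<theta>0 n 1\<bar> / (1 - F \<theta>0 n 1)"
            using F1_lt(2)[OF elim] by (simp add: abs_minus_commute)
          also have "\<dots> \<le> (b n * p n) / (1 / 2)"
            using mass[OF elim] elim by (intro frac_le) (auto simp: good_def F1)
          also have "\<dots> = 2 * (\<bar>k\<bar> + 1) * p n / sqrt (m n)" by (simp add: b_def)
          finally show "\<bar>\<phi> n u - 1\<bar> \<le> 2 * (\<bar>k\<bar> + 1) * p n / sqrt (m n)" .
        qed
      qed
    qed (use ss(4) \<phi>_meas prob_U e p0 m_top v bias in auto)
    then have T: "tends_to_0_in_prob (P \<theta>0) (\<lambda>n \<omega>. (\<Sum>i<n. ln (\<phi> n (U n i \<omega>))) - (k * Z n \<omega> - k\<^sup>2 * \<theta>0 / 2))"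
      by (simp add: Z_def J_def)
    show ?thesis
      unfolding k_def[symmetric] \<theta>_def[symmetric]
    proof (rule tends_to_0_in_prob_cong_AE[OF M.prob_space_axioms _ _ T])
      show "(\<lambda>\<omega>. (\<Sum>i<n. ln (\<phi> n (U n i \<omega>))) - (k * Z n \<omega> - k\<^sup>2 * \<theta>0 / 2)) \<in> borel_measurable (P \<theta>0)" for n
        using measurable_compose[OF U_meas \<phi>_meas[of n]] by measurable
      show "\<forall>\<^sub>F n in sequentially. AE \<omega> in P \<theta>0.
          loglik_ratio P Xs n (c n) (\<theta> n) \<theta>0 \<omega> - (k * normalized_count Xs c \<theta>0 n \<omega> - k\<^sup>2 * \<theta>0 / 2)
          = (\<Sum>i<n. ln (\<phi> n (U n i \<omega>))) - (k * Z n \<omega> - k\<^sup>2 * \<theta>0 / 2)"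
        using good
      proof eventually_elim
        case (elim n)
        from lik[OF elim] have "AE \<omega> in P \<theta>0. loglik_ratio P Xs n (c n) (\<theta> n) \<theta>0 \<omega> = (\<Sum>i<n. ln (\<phi> n (U n i \<omega>)))"
          by blast
        with AE_space show ?case by eventually_elim (simp add: Z_eq)
      qed
    qed measurable
  qed

  have "conv_in_distribution (P \<theta>0) (\<lambda>n. loglik_ratio P Xs n (c n) (\<theta>0 + \<xi> / sqrt (m n)) \<theta>0)
      (normal_law (- (\<xi>\<^sup>2 * L\<^sup>2 * \<theta>0 / 2)) ((\<xi> * L)\<^sup>2 * \<theta>0))" for \<xi>
  proof (rule conv_in_distribution_normalI[OF M.prob_space_axioms _ ll_meas nc_meas _ char_Z])
    show "tends_to_0_in_prob (P \<theta>0) (\<lambda>n \<omega>. loglik_ratio P Xs n (c n) (\<theta>0 + \<xi> / sqrt (m n)) \<theta>0 \<omega>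
        - (- (\<xi>\<^sup>2 * L\<^sup>2 * \<theta>0 / 2) + \<xi> * L * normalized_count Xs c \<theta>0 n \<omega>))"
      using lan[of \<xi>] by (simp add: power_mult_distrib algebra_simps)
  qed (use theta0 in simp)
  moreover have "conv_in_distribution (P \<theta>0) (normalized_count Xs c \<theta>0) (normal_law 0 (1\<^sup>2 * \<theta>0))"
    by (rule conv_in_distribution_normalI[OF M.prob_space_axioms _ nc_meas nc_meas _ char_Z])
      (use theta0 tends_to_0_in_prob_const[of "\<lambda>_. 0"] in auto)
  ultimately show ?thesis
    using lan by (simp add: power_mult_distrib m_def)
qed

end
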